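(* Let $\Sigma$ be a finite monoid and consider its fundamental network with $1$-dimensional internal dynamics (case 1D, phase space $\mathcal N^1=\bigoplus_{\sigma\in\Sigma}\mathbb R$) and with $d$-dimensional internal dynamics (case DD, phase space $\mathcal N^D=\bigoplus_{\sigma\in\Sigma}\mathbb R^d$). (i) All center subspaces in generic $1$-parameter Hopf bifurcations in the case 1D are, up to isomorphism of $\Sigma$-representations, generic as center subspaces in a $1$-parameter Hopf bifurcation in the case DD for any $d$. The branching periodic solutions corresponding to one center subspace are qualitatively the same for all values of $d$, in the sense that the reduced bifurcation problems are equivalent. (ii) Let $\mathcal N^1=Y_1\oplus\cdots\oplus Y_s$ be a decomposition into indecomposable subrepresentations and assume $Y_i$ is of real type with $Y_i\not\cong Y_j$ for all $j\neq i$. If $d\ge 2$, then $Y_i$ yields a center subspace $\mathcal X^c\cong Y_i^2$ of a generic $1$-parameter Hopf bifurcation in the case DD. The corresponding branching periodic solutions cannot be observed in the case 1D (no generic $1$-parameter Hopf bifurcation in the case 1D has center subspace isomorphic to $Y_i^2$). All remaining generic $1$-parameter Hopf bifurcations in the case DD are as described in (i).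
   Context: Fundamental network: let $\Sigma=\{\sigma_1=\mathrm{Id},\dots,\sigma_n\}$ be a finite monoid and $V$ a finite-dimensional real vector space (internal phase space). $\Sigma$ acts on $\bigoplus_{\sigma\in\Sigma}V$ by $(A_\sigma v)_\tau=v_{\tau\sigma}$. Admissible $1$-parameter families are $\Gamma_f(v,\lambda)$, $\lambda\in\mathbb R$, with $(\Gamma_f(v,\lambda))_\sigma=f(v_{\sigma_1\sigma},\dots,v_{\sigma_n\sigma},\lambda)$, $f$ smooth; equivalently (known), the smooth families equivariant under all $A_\sigma$. One assumes $\Gamma_f(0,0)=0$. The center subspace $\mathcal X^c$ is the sum of the (real) generalized eigenspaces of $D_v\Gamma_f(0,0)$ for eigenvalues on the imaginary axis; it is a complementable subrepresentation. A Hopf bifurcation requires nonzero purely imaginary eigenvalues. Types: an indecomposable representation $U$ is of real, complex or quaternionic type according to whether $\mathrm{End}_\Sigma(U)$ modulo its radical is $\mathbb R$, $\mathbb C$ or $\mathbb H$. Decompositions into indecomposables are unique up to isomorphism. Genericity (known classification, used as the meaning of "generic"): the center subspaces of generic $1$-parameter Hopf bifurcations on $\bigoplus_\sigma V$ are, up to isomorphism, exactly: one indecomposable component of complex type, one indecomposable component of quaternionic type, or the direct sum of two isomorphic components of real type, where the required components must be present (with multiplicity) in the decomposition of $\bigoplus_\sigma V$. Reduced problem: by equivariant center manifold reduction, the dynamics reduces to a generic $\Sigma$-equivariant family $r:\mathcal X^c\times\mathbb R\to\mathcal X^c$ with $r(0,0)=0$ and all eigenvalues of the linearization at $(0,0)$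 in the $\mathcal X^c$-direction on the imaginary axis. Two reduced bifurcation problems are equivalent if they are posed on equivariantly isomorphic $\Sigma$-representations, so that conjugation by the isomorphism identifies the two classes of equivariant bifurcation problems. *)

theory Defs
  imports "HOL-Analysis.Analysis" "HOL-Algebra.QuotRing"
begin

section \<open>Representations of a monoid\<close>

text \<open>
  A representation is given by an action \<open>A :: 's \<Rightarrow> 'a \<Rightarrow> 'a\<close> on an ambient vector space
  together with the invariant linear subspace \<open>U\<close> on which it is considered.  The action is only
  ever \<open>net_action\<close> or the product of two copies of it, so its functoriality and linearity are
  not restated here.
\<close>

definition subrep :: "('s \<Rightarrow> 'a \<Rightarrow> 'a::real_vector) \<Rightarrow> 'a set \<Rightarrow> bool" where
  "subrep A U \<longleftrightarrow> subspace U \<and> (\<forall>\<sigma>. A \<sigma> ` U \<subseteq> U)"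

text \<open>Homomorphisms are extensional, so that they are determined by their values on \<open>U\<close>.\<close>

definition rep_hom ::
  "('s \<Rightarrow> 'a \<Rightarrow> 'a::real_vector) \<Rightarrow> 'a set \<Rightarrow> ('s \<Rightarrow> 'b \<Rightarrow> 'b::real_vector) \<Rightarrow> 'b set \<Rightarrow> ('a \<Rightarrow> 'b) set"
where
  "rep_hom A U B W = {f \<in> U \<rightarrow>\<^sub>E W.
     (\<forall>x\<in>U. \<forall>y\<in>U. f (x + y) = f x + f y) \<and>
     (\<forall>c. \<forall>x\<in>U. f (c *\<^sub>R x) = c *\<^sub>R f x) \<and>
     (\<forall>\<sigma>. \<forall>x\<in>U. f (A \<sigma> x) = B \<sigma> (f x))}"

definition rep_isos ::
  "('s \<Rightarrow> 'a \<Rightarrow> 'a::real_vector) \<Rightarrow> 'a set \<Rightarrow> ('s \<Rightarrow> 'b \<Rightarrow> 'b::real_vector) \<Rightarrow> 'b set \<Rightarrow> ('a \<Rightarrow> 'b) set"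
where
  "rep_isos A U B W = {f \<in> rep_hom A U B W. bij_betw f U W}"

definition rep_iso ::
  "('s \<Rightarrow> 'a \<Rightarrow> 'a::real_vector) \<Rightarrow> 'a set \<Rightarrow> ('s \<Rightarrow> 'b \<Rightarrow> 'b::real_vector) \<Rightarrow> 'b set \<Rightarrow> bool"
where
  "rep_iso A U B W \<longleftrightarrow> rep_isos A U B W \<noteq> {}"

text \<open>The action on the external direct sum \<open>U \<times> W\<close>.\<close>

definition prod_action :: "('s \<Rightarrow> 'a \<Rightarrow> 'a) \<Rightarrow> ('s \<Rightarrow> 'b \<Rightarrow> 'b) \<Rightarrow> 's \<Rightarrow> 'a \<times> 'b \<Rightarrow> 'a \<times> 'b" where
  "prod_action A B \<sigma> = map_prod (A \<sigma>) (B \<sigma>)"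

definition indecomposable :: "('s \<Rightarrow> 'a \<Rightarrow> 'a::real_vector) \<Rightarrow> 'a set \<Rightarrow> bool" where
  "indecomposable A U \<longleftrightarrow> subrep A U \<and> U \<noteq> {0} \<and>
     (\<forall>U1 U2. subrep A U1 \<and> subrep A U2 \<and> U1 \<inter> U2 = {0} \<and> U = {x + y | x y. x \<in> U1 \<and> y \<in> U2}
        \<longrightarrow> U1 = {0} \<or> U2 = {0})"

text \<open>\<open>U\<close> is the internal direct sum of the indecomposable subrepresentations \<open>Y 1, ..., Y s\<close>.\<close>

definition decomposition :: "('s \<Rightarrow> 'a \<Rightarrow> 'a::real_vector) \<Rightarrow> 'a set \<Rightarrow> nat \<Rightarrow> (nat \<Rightarrow> 'a set) \<Rightarrow> bool" where
  "decomposition A U s Y \<longleftrightarrow> (\<forall>i\<in>{1..s}. indecomposable A (Y i)) \<and>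
     bij_betw (\<lambda>y. \<Sum>i\<in>{1..s}. y i) (\<Pi>\<^sub>E i\<in>{1..s}. Y i) U"


section \<open>The type of an indecomposable representation\<close>

definition End_ring :: "('s \<Rightarrow> 'a \<Rightarrow> 'a::real_vector) \<Rightarrow> 'a set \<Rightarrow> ('a \<Rightarrow> 'a) ring" where
  "End_ring A U =
     \<lparr>carrier = rep_hom A U A U, mult = (\<lambda>f g. compose U f g), one = (\<lambda>x\<in>U. x),
      zero = (\<lambda>x\<in>U. 0), add = (\<lambda>f g. \<lambda>x\<in>U. f x + g x)\<rparr>"

definition left_ideal :: "('a, 'b) ring_scheme \<Rightarrow> 'a set \<Rightarrow> bool" where
  "left_ideal R I \<longleftrightarrow> additive_subgroup I R \<and> (\<forall>r\<in>carrier R. \<forall>x\<in>I. r \<otimes>\<^bsub>R\<^esub> x \<in> I)"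

definition maximal_left_ideal :: "('a, 'b) ring_scheme \<Rightarrow> 'a set \<Rightarrow> bool" where
  "maximal_left_ideal R M \<longleftrightarrow> left_ideal R M \<and> M \<noteq> carrier R \<and>
     (\<forall>I. left_ideal R I \<and> M \<subseteq> I \<longrightarrow> I = M \<or> I = carrier R)"

definition jacobson_radical :: "('a, 'b) ring_scheme \<Rightarrow> 'a set" where
  "jacobson_radical R = carrier R \<inter> \<Inter>{M. maximal_left_ideal R M}"

definition type_ring :: "'k::ring_1 ring" where
  "type_ring = \<lparr>carrier = UNIV, mult = (*), one = 1, zero = 0, add = (+)\<rparr>"

definition quaternion_ring :: "(real \<times> real \<times> real \<times> real) ring" where
  "quaternion_ring =
     \<lparr>carrier = UNIV,
      mult = (\<lambda>(a1, b1, c1, d1) (a2, b2, c2, d2).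
        (a1 * a2 - b1 * b2 - c1 * c2 - d1 * d2,
         a1 * b2 + b1 * a2 + c1 * d2 - d1 * c2,
         a1 * c2 - b1 * d2 + c1 * a2 + d1 * b2,
         a1 * d2 + b1 * c2 - c1 * b2 + d1 * a2)),
      one = (1, 0, 0, 0), zero = (0, 0, 0, 0), add = (+)\<rparr>"

text \<open>
  The endomorphism ring modulo its radical is isomorphic to \<open>K\<close> as a unital real algebra, where the
  algebra structure of \<open>K\<close> is given by the embedding \<open>\<iota>\<close> of the real scalars.
\<close>

definition has_type ::
  "('s \<Rightarrow> 'a \<Rightarrow> 'a::real_vector) \<Rightarrow> 'a set \<Rightarrow> 'k ring \<Rightarrow> (real \<Rightarrow> 'k) \<Rightarrow> bool"
where
  "has_type A U K \<iota> \<longleftrightarrow>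
     (\<exists>h \<in> ring_iso (End_ring A U Quot jacobson_radical (End_ring A U)) K.
        \<forall>c. h (jacobson_radical (End_ring A U) +>\<^bsub>End_ring A U\<^esub> (\<lambda>x\<in>U. c *\<^sub>R x)) = \<iota> c)"

definition real_type :: "('s \<Rightarrow> 'a \<Rightarrow> 'a::real_vector) \<Rightarrow> 'a set \<Rightarrow> bool" where
  "real_type A U \<longleftrightarrow> has_type A U (type_ring :: real ring) (\<lambda>c. c)"

definition complex_type :: "('s \<Rightarrow> 'a \<Rightarrow> 'a::real_vector) \<Rightarrow> 'a set \<Rightarrow> bool" where
  "complex_type A U \<longleftrightarrow> has_type A U (type_ring :: complex ring) complex_of_real"

definition quaternionic_type :: "('s \<Rightarrow> 'a \<Rightarrow> 'a::real_vector) \<Rightarrow> 'a set \<Rightarrow> bool" where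
  "quaternionic_type A U \<longleftrightarrow> has_type A U quaternion_ring (\<lambda>c. (c, 0, 0, 0))"


section \<open>Spectrum of a real linear map and smooth maps\<close>

text \<open>Complexification: the pair \<open>(u, w)\<close> stands for \<open>u + \<i> w\<close>.\<close>

definition complex_scale :: "complex \<Rightarrow> 'a \<times> 'a \<Rightarrow> 'a \<times> 'a::real_vector" where
  "complex_scale \<mu> z =
     (Re \<mu> *\<^sub>R fst z - Im \<mu> *\<^sub>R snd z, Im \<mu> *\<^sub>R fst z + Re \<mu> *\<^sub>R snd z)"

definition is_eigenvalue :: "('a \<Rightarrow> 'a::real_vector) \<Rightarrow> 'a set \<Rightarrow> complex \<Rightarrow> bool" where
  "is_eigenvalue L X \<mu> \<longleftrightarrow> (\<exists>z \<in> X \<times> X. z \<noteq> 0 \<and> map_prod L L z = complex_scale \<mu> z)"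

text \<open>
  For a complex eigenvalue \<open>\<mu>\<close> the real generalized eigenspace consists of the real parts of the
  complex generalized eigenvectors; for nonreal \<open>\<mu>\<close> it is the real form of the sum of the
  generalized eigenspaces of \<open>\<mu>\<close> and its conjugate.
\<close>

definition real_gen_eigenspace :: "('a \<Rightarrow> 'a::real_vector) \<Rightarrow> complex \<Rightarrow> 'a set" where
  "real_gen_eigenspace L \<mu> =
     {fst z | z. \<exists>k. ((\<lambda>z. map_prod L L z - complex_scale \<mu> z) ^^ k) z = 0}"

definition center_subspace :: "('a \<Rightarrow> 'a::real_vector) \<Rightarrow> 'a set" where
  "center_subspace L =
     span (\<Union>\<mu>\<in>{\<mu>. is_eigenvalue L UNIV \<mu> \<and> Re \<mu> = 0}. real_gen_eigenspace L \<mu>)"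

text \<open>
  \<open>C\<^sup>k\<close> maps on a finite-dimensional linear subspace \<open>S\<close>: the derivatives are taken within \<open>S\<close>,
  hence only the directions in \<open>S\<close> are meaningful.
\<close>

primrec Ck_on :: "nat \<Rightarrow> 'a set \<Rightarrow> ('a::real_normed_vector \<Rightarrow> 'b::real_normed_vector) \<Rightarrow> bool" where
  "Ck_on 0 S f \<longleftrightarrow> continuous_on S f"
| "Ck_on (Suc k) S f \<longleftrightarrow>
     (\<exists>f'. (\<forall>x\<in>S. (f has_derivative f' x) (at x within S)) \<and> (\<forall>h\<in>S. Ck_on k S (\<lambda>x. f' x h)))"

definition smooth_on :: "'a set \<Rightarrow> ('a::real_normed_vector \<Rightarrow> 'b::real_normed_vector) \<Rightarrow> bool" where
  "smooth_on S f \<longleftrightarrow> (\<forall>k. Ck_on k S f)"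


section \<open>Fundamental networks and Hopf bifurcations\<close>

text \<open>
  The finite monoid is the type \<open>'s\<close>, the internal phase space is \<open>'v\<close>, and the total phase space
  is \<open>'v ^ 's\<close>, written with a synonym because that notation fixes the sort of \<open>'s\<close>.
\<close>

type_synonym ('v, 's) net = "('v, 's) vec"

definition net_action :: "'s::{finite, monoid_mult} \<Rightarrow> ('v, 's) net \<Rightarrow> ('v, 's) net" where
  "net_action \<sigma> v = (\<chi> \<tau>. v $ (\<tau> * \<sigma>))"

definition Gamma ::
  "(('v, 's::{finite, monoid_mult}) net \<times> real \<Rightarrow> 'v) \<Rightarrow> ('v, 's) net \<Rightarrow> real \<Rightarrow> ('v, 's) net"
where
  "Gamma f v l = (\<chi> \<sigma>. f ((\<chi> \<tau>. v $ (\<tau> * \<sigma>)), l))"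

definition linearization ::
  "(('v::euclidean_space, 's::{finite, monoid_mult}) net \<times> real \<Rightarrow> 'v) \<Rightarrow> ('v, 's) net \<Rightarrow> ('v, 's) net"
where
  "linearization f = frechet_derivative (\<lambda>v. Gamma f v 0) (at 0)"

text \<open>
  The representations (\<open>X\<close> with action \<open>B\<close>) in the classification of generic Hopf center subspaces
  on the phase space carrying the action \<open>A\<close>.
\<close>

definition generic_Hopf_rep ::
  "('s \<Rightarrow> 'a \<Rightarrow> 'a::real_vector) \<Rightarrow> ('s \<Rightarrow> 'b \<Rightarrow> 'b::real_vector) \<Rightarrow> 'b set \<Rightarrow> bool"
where
  "generic_Hopf_rep A B X \<longleftrightarrow> (\<exists>s Y. decomposition A UNIV s Y \<and>
     ((\<exists>i\<in>{1..s}. complex_type A (Y i) \<and> rep_iso B X A (Y i)) \<or>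
      (\<exists>i\<in>{1..s}. quaternionic_type A (Y i) \<and> rep_iso B X A (Y i)) \<or>
      (\<exists>i\<in>{1..s}. \<exists>j\<in>{1..s}. i \<noteq> j \<and> real_type A (Y i) \<and> real_type A (Y j) \<and>
         rep_iso A (Y i) A (Y j) \<and> rep_iso B X (prod_action A A) (Y i \<times> Y j))))"

text \<open>
  An admissible family with a Hopf bifurcation at the origin.  Genericity is understood through the
  classification of center subspaces and is a condition on the center subspace alone.
\<close>

definition generic_Hopf ::
  "(('v::euclidean_space, 's::{finite, monoid_mult}) net \<times> real \<Rightarrow> 'v) \<Rightarrow> bool"
where
  "generic_Hopf f \<longleftrightarrow> smooth_on UNIV f \<and> Gamma f 0 0 = 0 \<and>
     (\<exists>\<omega>. \<omega> \<noteq> 0 \<and> is_eigenvalue (linearization f) UNIV (Complex 0 \<omega>)) \<and>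
     generic_Hopf_rep (net_action :: 's \<Rightarrow> ('v, 's) net \<Rightarrow> ('v, 's) net) net_action
       (center_subspace (linearization f))"

definition generic_Hopf_center ::
  "('v::euclidean_space, 's::{finite, monoid_mult}) net set \<Rightarrow> bool"
where
  "generic_Hopf_center X \<longleftrightarrow> (\<exists>f. generic_Hopf f \<and> X = center_subspace (linearization f))"


section \<open>Reduced bifurcation problems\<close>

text \<open>Extensional functions, so that a problem is determined by its values on \<open>X \<times> \<real>\<close>.\<close>

definition reduced_problems ::
  "('s \<Rightarrow> 'a \<Rightarrow> 'a::euclidean_space) \<Rightarrow> 'a set \<Rightarrow> ('a \<times> real \<Rightarrow> 'a) set"
where
  "reduced_problems A X = {r \<in> X \<times> UNIV \<rightarrow>\<^sub>E X.
     smooth_on (X \<times> UNIV) r \<and>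
     (\<forall>\<sigma>. \<forall>x\<in>X. \<forall>l. r (A \<sigma> x, l) = A \<sigma> (r (x, l))) \<and>
     r (0, 0) = 0 \<and>
     (\<exists>L. ((\<lambda>x. r (x, 0)) has_derivative L) (at 0 within X) \<and>
          (\<forall>\<mu>. is_eigenvalue L X \<mu> \<longrightarrow> Re \<mu> = 0))}"

definition conjugate ::
  "('a \<Rightarrow> 'b) \<Rightarrow> 'a set \<Rightarrow> 'b set \<Rightarrow> ('a \<times> real \<Rightarrow> 'a) \<Rightarrow> 'b \<times> real \<Rightarrow> 'b"
where
  "conjugate \<phi> X Z r = restrict (\<lambda>(z, l). \<phi> (r (inv_into X \<phi> z, l))) (Z \<times> UNIV)"

definition reduced_equivalent ::
  "('s \<Rightarrow> 'a \<Rightarrow> 'a::euclidean_space) \<Rightarrow> 'a set \<Rightarrow> ('s \<Rightarrow> 'b \<Rightarrow> 'b::euclidean_space) \<Rightarrow> 'b set \<Rightarrow> bool"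
where
  "reduced_equivalent A X B Z \<longleftrightarrow>
     (\<exists>\<phi> \<in> rep_isos A X B Z.
        bij_betw (conjugate \<phi> X Z) (reduced_problems A X) (reduced_problems B Z))"

end

theory Submission
  imports Defs
begin

text \<open>
  Let \<open>U\<close> be a summand of the phase space with an equivariant \<open>J\<close> such that \<open>J\<^sup>2 = -1\<close>.  Taking \<open>J\<close> on
  \<open>U\<close> and the identity on a complement defines a linear admissible vector field with center subspace
  \<open>U\<close>.  Such a \<open>J\<close> exists on an indecomposable representation of complex or quaternionic type, because
  a square root of \<open>-1\<close> lifts along the nilpotent radical of its endomorphism ring, and on \<open>Y \<oplus> Y\<close>.
  Thus a center subspace is realized as soon as its components occur in the phase space.  Since \<open>N\<^sup>D\<close> is
  a sum of \<open>d\<close> copies of \<open>N\<^sup>1\<close>, the locality of endomorphism rings of indecomposables shows that it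
  has the same components; only the multiplicities differ, and they matter only for \<open>Y \<oplus> Y\<close>.
\<close>

section \<open>Homomorphisms and direct sums of representations\<close>

text \<open>Genericity is a condition on the center subspace alone, so a linear family that is
  constant in the parameter can realize it. The identity on the complement only contributes the
  eigenvalue 1, which is off the imaginary axis. The full Krull-Schmidt theorem is not proved.
  \<open>generic_Hopf_rep\<close> chooses some decomposition of the phase space, whereas the second
  half of the theorem fixes one. Two consequences of locality bridge this gap: every component in
  the multi-dimensional case is isomorphic to a component of the fixed decomposition, and a
  component repeated in one decomposition is repeated in every other. The second is the delicate
  one; it alone excludes that another decomposition contains a pair where the fixed one has a single
  copy. Locality is used in the following form: if a finite sum of endomorphisms of an
  indecomposable representation is injective, then so is one of the summands.\<close>

definition linear_action :: "('s \<Rightarrow> 'a \<Rightarrow> 'a::real_vector) \<Rightarrow> bool" where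
  "linear_action A \<longleftrightarrow> (\<forall>\<sigma>. linear (A \<sigma>))"

text \<open>Linear on the whole ambient space, with range and equivariance demanded only on
  \<open>U\<close>. Sums and compositions then need no restriction, and the theory of linear maps
  applies directly; \<open>rep_hom_extend\<close> and \<open>rep_map_restrict\<close> translate from
  and to the extensional \<open>rep_hom\<close>.\<close>

definition rep_map ::
  "('s \<Rightarrow> 'a \<Rightarrow> 'a::real_vector) \<Rightarrow> 'a set \<Rightarrow> ('s \<Rightarrow> 'b \<Rightarrow> 'b::real_vector) \<Rightarrow> 'b set \<Rightarrow> ('a \<Rightarrow> 'b) \<Rightarrow> bool"
where
  "rep_map A U B W f \<longleftrightarrow> linear f \<and> f ` U \<subseteq> W \<and> (\<forall>\<sigma>. \<forall>x\<in>U. f (A \<sigma> x) = B \<sigma> (f x))"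

text \<open>The formula is the one inside \<open>indecomposable\<close>, so that unfolding makes the
  two match. Linearity and invariance of the sets are supplied separately.\<close>

definition dsum :: "'a::real_vector set \<Rightarrow> 'a set \<Rightarrow> 'a set \<Rightarrow> bool" where
  "dsum U V W \<longleftrightarrow> V \<inter> W = {0} \<and> U = {x + y | x y. x \<in> V \<and> y \<in> W}"

lemma linear_action_net_action:
  "linear_action (net_action :: 's::{finite, monoid_mult} \<Rightarrow> ('v::real_vector, 's) net \<Rightarrow> ('v, 's) net)"
  unfolding linear_action_def net_action_def
  by (auto intro!: linearI simp: vec_eq_iff)

lemma subrepD:
  assumes "subrep A U"
  shows "subspace U" "x \<in> U \<Longrightarrow> A \<sigma> x \<in> U"
  using assms unfolding subrep_def by auto

lemma subrep_Times:
  assumes "subrep A U" "subrep B W"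
  shows "subrep (prod_action A B) (U \<times> W)"
  using assms unfolding subrep_def prod_action_def image_subset_iff by (auto intro: subspace_Times)

lemma rep_mapD:
  assumes "rep_map A U B W f"
  shows "linear f" "x \<in> U \<Longrightarrow> f x \<in> W" "x \<in> U \<Longrightarrow> f (A \<sigma> x) = B \<sigma> (f x)"
  using assms unfolding rep_map_def by auto

lemma rep_mapI:
  assumes "linear f" "\<And>x. x \<in> U \<Longrightarrow> f x \<in> W" "\<And>\<sigma> x. x \<in> U \<Longrightarrow> f (A \<sigma> x) = B \<sigma> (f x)"
  shows "rep_map A U B W f"
  using assms unfolding rep_map_def by auto

lemma rep_map_compose:
  assumes "rep_map A U B W f" "rep_map B W C Z g"
  shows "rep_map A U C Z (\<lambda>x. g (f x))"
  using assms linear_compose[of f g] unfolding rep_map_def image_subset_iff by (auto simp: o_def)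

lemma rep_map_id: "rep_map A U A U (\<lambda>x. x)"
  unfolding rep_map_def by (auto simp: linear_iff)

lemma rep_map_subset:
  assumes "rep_map A U B W f" "U' \<subseteq> U" "W \<subseteq> W'"
  shows "rep_map A U' B W' f"
  using assms unfolding rep_map_def by blast

lemma rep_map_scale:
  assumes "linear_action B" "subspace W" "rep_map A U B W f"
  shows "rep_map A U B W (\<lambda>x. c *\<^sub>R f x)"
  using assms unfolding rep_map_def linear_action_def image_subset_iff
  by (auto simp: linear_scale subspace_scale linear_compose_scale_right)

lemma rep_map_add:
  assumes "linear_action B" "subspace W" "rep_map A U B W f" "rep_map A U B W g"
  shows "rep_map A U B W (\<lambda>x. f x + g x)"
  using assms unfolding rep_map_def linear_action_def image_subset_iff
  by (auto simp: linear_add intro: linear_compose_add subspace_add)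

lemma rep_map_sum:
  assumes "linear_action B" "subspace W" "\<And>t. t \<in> T \<Longrightarrow> rep_map A U B W (f t)"
  shows "rep_map A U B W (\<lambda>x. \<Sum>t\<in>T. f t x)"
  using assms unfolding rep_map_def linear_action_def image_subset_iff
  by (auto simp: linear_sum intro!: linear_compose_sum subspace_sum)

text \<open>A linear map with the values of \<open>f\<close> on a basis of \<open>U\<close> agrees
  with \<open>f\<close> on its span. The induction carries membership in \<open>U\<close> along,
  because \<open>f\<close> is controlled only there.\<close>

lemma linear_extension_on_subspace:
  fixes f :: "'a::real_vector \<Rightarrow> 'b::real_vector"
  assumes U: "subspace U"
    and add: "\<And>x y. x \<in> U \<Longrightarrow> y \<in> U \<Longrightarrow> f (x + y) = f x + f y"
    and scale: "\<And>c x. x \<in> U \<Longrightarrow> f (c *\<^sub>R x) = c *\<^sub>R f x"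
  obtains g where "linear g" "\<And>x. x \<in> U \<Longrightarrow> g x = f x"
proof -
  obtain B where B: "B \<subseteq> U" "independent B" "U \<subseteq> span B"
    by (rule basis_exists[of U])
  obtain g where g: "linear g" "\<And>x. x \<in> B \<Longrightarrow> g x = f x"
    using linear_independent_extend[OF B(2), of f] by auto
  have *: "x \<in> U \<and> g x = f x" if "x \<in> span B" for x
    using that
  proof (induction x rule: span_induct_alt)
    case base
    show ?case using scale[of 0 0] subspace_0[OF U] linear_0[OF g(1)] by simp
  next
    case (step c x y)
    then have "x \<in> U" "y \<in> U" "c *\<^sub>R x \<in> U"
      using B(1) subspace_scale[OF U] by auto
    then show ?case
      using step add[of "c *\<^sub>R x" y] scale[of x c] g(2) subspace_add[OF U]
      by (simp add: linear_add[OF g(1)] linear_scale[OF g(1)])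
  qed
  show ?thesis
    by (rule that[OF g(1)]) (use * B(3) in auto)
qed

lemma rep_hom_extend:
  assumes U: "subrep A U" and f: "f \<in> rep_hom A U B W"
  obtains g where "rep_map A U B W g" "restrict g U = f" "\<And>x. x \<in> U \<Longrightarrow> g x = f x"
proof -
  have add: "f (x + y) = f x + f y" if "x \<in> U" "y \<in> U" for x y
    using f that unfolding rep_hom_def by simp
  have scale: "f (c *\<^sub>R x) = c *\<^sub>R f x" if "x \<in> U" for c x
    using f that unfolding rep_hom_def by simp
  obtain g where g: "linear g" "\<And>x. x \<in> U \<Longrightarrow> g x = f x"
    using linear_extension_on_subspace[OF subrepD(1)[OF U] add scale] by metis
  have "rep_map A U B W g"
  proof (rule rep_mapI[OF g(1)])
    fix x \<sigma> assume x: "x \<in> U"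
    then show "g x \<in> W" using f g(2) unfolding rep_hom_def by auto
    have "A \<sigma> x \<in> U" using subrepD(2)[OF U] x .
    then show "g (A \<sigma> x) = B \<sigma> (g x)"
      using x f g(2) unfolding rep_hom_def by simp
  qed
  moreover have "restrict g U = f"
  proof
    have "f \<in> extensional U" using f unfolding rep_hom_def by (auto simp: PiE_iff)
    then show "restrict g U x = f x" for x
      by (cases "x \<in> U") (auto simp: g(2) extensional_def)
  qed
  ultimately show ?thesis using g(2) by (rule that)
qed

lemma rep_map_restrict:
  assumes U: "subrep A U" and f: "rep_map A U B W f"
  shows "restrict f U \<in> rep_hom A U B W"
  using rep_mapD[OF f] subrepD[OF U] unfolding rep_hom_def
  by (simp add: linear_add linear_scale subspace_add subspace_scale)

lemma rep_iso_iff: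
  assumes U: "subrep A U"
  shows "rep_iso A U B W \<longleftrightarrow> (\<exists>f. rep_map A U B W f \<and> bij_betw f U W)"
proof
  assume "rep_iso A U B W"
  then obtain f where f: "f \<in> rep_hom A U B W" "bij_betw f U W"
    unfolding rep_iso_def rep_isos_def by blast
  obtain g where g: "rep_map A U B W g" "restrict g U = f" "\<And>x. x \<in> U \<Longrightarrow> g x = f x"
    using rep_hom_extend[OF U f(1)] by metis
  have "bij_betw g U W"
    using f(2) g(3) by (metis bij_betw_cong)
  with g(1) show "\<exists>f. rep_map A U B W f \<and> bij_betw f U W" by blast
next
  assume "\<exists>f. rep_map A U B W f \<and> bij_betw f U W"
  then obtain f where f: "rep_map A U B W f" "bij_betw f U W" by blast
  have "restrict f U \<in> rep_isos A U B W"
    using rep_map_restrict[OF U f(1)] f(2) unfolding rep_isos_def by simp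
  then show "rep_iso A U B W" unfolding rep_iso_def by blast
qed

text \<open>A linear left inverse of \<open>f\<close> on \<open>U\<close> exists on the whole space.
  As \<open>f\<close> maps onto \<open>W\<close>, it is a right inverse there as well, and its
  equivariance is read off by writing the points of \<open>W\<close> as \<open>f x\<close>.\<close>

lemma rep_map_inverse:
  assumes U: "subrep A U" and f: "rep_map A U B W f" "bij_betw f U W"
  obtains g where "rep_map B W A U g" "bij_betw g W U"
    "\<And>x. x \<in> U \<Longrightarrow> g (f x) = x" "\<And>y. y \<in> W \<Longrightarrow> f (g y) = y"
proof -
  have lf: "linear f" and inj: "inj_on f U" and im: "f ` U = W"
    using f unfolding rep_map_def bij_betw_def by auto
  obtain g where g: "linear g" "\<And>x. x \<in> U \<Longrightarrow> g (f x) = x"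
    using linear_exists_left_inverse_on[OF lf subrepD(1)[OF U] inj] by blast
  have fg: "f (g y) = y" if y: "y \<in> W" for y
  proof -
    obtain x where "x \<in> U" "y = f x" using im y by blast
    then show ?thesis by (simp add: g(2))
  qed
  have "rep_map B W A U g"
  proof (rule rep_mapI[OF g(1)])
    fix y assume "y \<in> W"
    then obtain x where x: "x \<in> U" "y = f x" using im by auto
    then show "g y \<in> U" by (simp add: g(2))
    fix \<sigma>
    have "B \<sigma> y = f (A \<sigma> x)" using x rep_mapD(3)[OF f(1)] by simp
    then show "g (B \<sigma> y) = A \<sigma> (g y)"
      using x g(2) subrepD(2)[OF U] by simp
  qed
  moreover have "bij_betw g W U"
    unfolding bij_betw_def
  proof
    show "inj_on g W" using fg by (metis inj_onI)
    show "g ` W = U" unfolding im[symmetric] image_image by (simp add: g(2))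
  qed
  ultimately show ?thesis using g(2) fg by (rule that)
qed

lemma rep_iso_refl: "subrep A U \<Longrightarrow> rep_iso A U A U"
  using rep_iso_iff rep_map_id bij_betw_id[unfolded id_def] by blast

lemma rep_iso_sym:
  assumes "subrep A U" "subrep B W" "rep_iso A U B W"
  shows "rep_iso B W A U"
  using assms by (metis rep_iso_iff rep_map_inverse)

lemma rep_iso_trans:
  assumes "subrep A U" "subrep B W" "rep_iso A U B W" "rep_iso B W C Z"
  shows "rep_iso A U C Z"
proof -
  obtain f g where "rep_map A U B W f" "bij_betw f U W" "rep_map B W C Z g" "bij_betw g W Z"
    using assms rep_iso_iff by metis
  then show ?thesis
    using rep_iso_iff[OF assms(1)] rep_map_compose bij_betw_trans[of f U W g Z]
    unfolding o_def by blast
qed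

lemma rep_iso_Times:
  assumes "subrep A U" "subrep A' U'" "rep_iso A U B W" "rep_iso A' U' B' W'"
  shows "rep_iso (prod_action A A') (U \<times> U') (prod_action B B') (W \<times> W')"
proof -
  obtain f g where fg: "rep_map A U B W f" "bij_betw f U W" "rep_map A' U' B' W' g" "bij_betw g U' W'"
    using assms rep_iso_iff by metis
  have "linear (map_prod f g)"
    using fg unfolding rep_map_def by (auto intro!: linearI simp: linear_add linear_scale)
  then have "rep_map (prod_action A A') (U \<times> U') (prod_action B B') (W \<times> W') (map_prod f g)"
    using fg unfolding rep_map_def prod_action_def by auto
  then show ?thesis
    using rep_iso_iff[OF subrep_Times[OF assms(1,2)]] bij_betw_map_prod[OF fg(2,4)] by blast
qed

lemma rep_map_kernel_subrep:
  assumes "subrep A U" "linear_action B" "rep_map A U B W f"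
  shows "subrep A {x \<in> U. f x = 0}"
  using assms unfolding subrep_def rep_map_def linear_action_def image_subset_iff
  by (auto simp: subspace_def linear_add linear_scale linear_0)

lemma rep_map_image_subrep:
  assumes "subrep A U" "rep_map A U B W f"
  shows "subrep B (f ` U)"
  unfolding subrep_def image_subset_iff
proof (intro conjI allI ballI)
  show "subspace (f ` U)"
    using assms by (simp add: subrep_def rep_map_def linear_subspace_image)
  show "B \<sigma> y \<in> f ` U" if "y \<in> f ` U" for \<sigma> y
    using that subrepD(2)[OF assms(1)] rep_mapD(3)[OF assms(2), symmetric] by (auto intro!: imageI)
qed

section \<open>Internal direct sums\<close>

lemma dsumD:
  assumes "dsum U V W"
  shows "x \<in> V \<Longrightarrow> x \<in> W \<Longrightarrow> x = 0" "x \<in> V \<Longrightarrow> y \<in> W \<Longrightarrow> x + y \<in> U"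
    "x \<in> V \<Longrightarrow> x \<in> U" "y \<in> W \<Longrightarrow> y \<in> U"
    "x \<in> U \<Longrightarrow> \<exists>v\<in>V. \<exists>w\<in>W. x = v + w" "0 \<in> V" "0 \<in> W"
proof -
  have 0: "V \<inter> W = {0}" and U: "U = {x + y | x y. x \<in> V \<and> y \<in> W}"
    using assms unfolding dsum_def by auto
  show "x \<in> V \<Longrightarrow> x \<in> W \<Longrightarrow> x = 0" "0 \<in> V" "0 \<in> W" using 0 by auto
  show *: "x \<in> V \<Longrightarrow> y \<in> W \<Longrightarrow> x + y \<in> U" for x y using U by blast
  show "x \<in> V \<Longrightarrow> x \<in> U" using *[of x 0] 0 by auto
  show "y \<in> W \<Longrightarrow> y \<in> U" using *[of 0 y] 0 by auto
  show "x \<in> U \<Longrightarrow> \<exists>v\<in>V. \<exists>w\<in>W. x = v + w" using U by blast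
qed

lemma dsumI:
  assumes "\<And>x. x \<in> V \<Longrightarrow> x \<in> W \<Longrightarrow> x = 0" "0 \<in> V" "0 \<in> W"
    "\<And>x y. x \<in> V \<Longrightarrow> y \<in> W \<Longrightarrow> x + y \<in> U"
    "\<And>x. x \<in> U \<Longrightarrow> \<exists>v\<in>V. \<exists>w\<in>W. x = v + w"
  shows "dsum U V W"
  using assms unfolding dsum_def by blast

lemma dsum_subrep:
  assumes A: "linear_action A" and V: "subrep A V" and W: "subrep A W" and d: "dsum U V W"
  shows "subrep A U"
  unfolding subrep_def image_subset_iff
proof (intro conjI allI ballI)
  show "subspace U"
    using V W d subspace_sums[of V W] unfolding subrep_def dsum_def by auto
  fix \<sigma> x assume "x \<in> U"
  then obtain v w where "v \<in> V" "w \<in> W" "x = v + w" using dsumD(5)[OF d] by blast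
  then show "A \<sigma> x \<in> U"
    using A subrepD(2)[OF V] subrepD(2)[OF W] dsumD(2)[OF d]
    unfolding linear_action_def by (simp add: linear_add)
qed

lemma dsum_sym:
  assumes "dsum U V W"
  shows "dsum U W V"
proof (rule dsumI)
  show "\<exists>w\<in>W. \<exists>v\<in>V. x = w + v" if "x \<in> U" for x
    using dsumD(5)[OF assms that] by (metis add.commute)
  show "x + y \<in> U" if "x \<in> W" "y \<in> V" for x y
    using dsumD(2)[OF assms that(2,1)] by (simp add: add.commute)
qed (use dsumD(1,6,7)[OF assms] in auto)

text \<open>Regroups \<open>(P + Q) + W\<close> as \<open>P + (Q + W)\<close>, which turns a summand
  of a summand into a summand of the whole with an explicit complement.\<close>

lemma dsum_assoc:
  assumes V: "dsum U V W" and P: "dsum V P Q" and sV: "subspace V"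
  shows "dsum U P {x + y | x y. x \<in> Q \<and> y \<in> W}" "dsum {x + y | x y. x \<in> Q \<and> y \<in> W} Q W"
proof -
  show "dsum U P {x + y | x y. x \<in> Q \<and> y \<in> W}"
  proof (rule dsumI)
    fix p assume p: "p \<in> P" "p \<in> {x + y | x y. x \<in> Q \<and> y \<in> W}"
    then obtain q w where q: "p = q + w" "q \<in> Q" "w \<in> W" by auto
    \<comment> \<open>As a difference of two elements of \<open>V\<close>, this \<open>w\<close>
      lies in both \<open>V\<close> and \<open>W\<close>.\<close>
    have "w = p - q" using q by simp
    then have "w \<in> V" using sV p(1) q(2) dsumD(3,4)[OF P] subspace_diff by metis
    then have "w = 0" using q dsumD(1)[OF V] by blast
    then show "p = 0" using p q dsumD(1)[OF P] by auto
  next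
    show "0 \<in> {x + y | x y. x \<in> Q \<and> y \<in> W}"
      using dsumD(7)[OF P] dsumD(7)[OF V] by force
  next
    fix x y assume "x \<in> P" "y \<in> {x + y | x y. x \<in> Q \<and> y \<in> W}"
    then show "x + y \<in> U"
      using dsumD(2)[OF V] dsumD(2)[OF P] by (auto simp: add.assoc[symmetric])
  next
    fix x assume "x \<in> U"
    then obtain v w where v: "v \<in> V" "w \<in> W" "x = v + w" using dsumD(5)[OF V] by blast
    then obtain p q where "p \<in> P" "q \<in> Q" "v = p + q" using dsumD(5)[OF P] by blast
    then show "\<exists>v\<in>P. \<exists>w\<in>{x + y |x y. x \<in> Q \<and> y \<in> W}. x = v + w"
      using v by (intro bexI[of _ p] bexI[of _ "q + w"]) (auto simp: add.assoc)
  qed (rule dsumD(6)[OF P])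
  show "dsum {x + y | x y. x \<in> Q \<and> y \<in> W} Q W"
  proof -
    have "Q \<inter> W = {0}"
      using dsumD(1,7)[OF V] dsumD(4,7)[OF P] by blast
    then show ?thesis unfolding dsum_def by (rule conjI) (rule refl)
  qed
qed

lemma indecomposable_dsum:
  assumes "indecomposable A U" "subrep A V" "subrep A W" "dsum U V W"
  shows "V = {0} \<or> W = {0}"
proof -
  have "\<forall>U1 U2. subrep A U1 \<and> subrep A U2 \<and> U1 \<inter> U2 = {0} \<and> U = {x + y | x y. x \<in> U1 \<and> y \<in> U2}
        \<longrightarrow> U1 = {0} \<or> U2 = {0}"
    using assms(1) unfolding indecomposable_def by (elim conjE)
  from this[rule_format, of V W] show ?thesis
    using assms(2-4) unfolding dsum_def by argo
qed

lemma indecomposableD: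
  assumes "indecomposable A U"
  shows "subrep A U" "U \<noteq> {0}"
  using assms unfolding indecomposable_def by auto

section \<open>Dimension counts for linear maps on subspaces\<close>

lemma linear_inj_imp_bij_betw:
  fixes f :: "'a::euclidean_space \<Rightarrow> 'b::euclidean_space"
  assumes "linear f" "subspace U" "subspace W" "f ` U \<subseteq> W" "inj_on f U" "dim W \<le> dim U"
  shows "bij_betw f U W"
proof -
  have "dim (f ` U) = dim U" using assms(1,2,5) by (intro dim_image_eq) (simp_all add: span_eq_iff[THEN iffD2])
  then have "f ` U = W"
    using assms(6) by (intro subspace_dim_equal linear_subspace_image assms(1-4)) simp
  then show ?thesis using assms(5) unfolding bij_betw_def by blast
qed

text \<open>A linear right inverse of \<open>f\<close> on the image is injective, and the dimension
  hypothesis makes it onto \<open>U\<close>. Hence it is also a left inverse of \<open>f\<close> on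
  \<open>U\<close>.\<close>

lemma linear_surj_imp_inj_on:
  fixes f :: "'a::euclidean_space \<Rightarrow> 'b::euclidean_space"
  assumes "linear f" "subspace U" "dim U \<le> dim (f ` U)"
  shows "inj_on f U"
proof -
  obtain g where g: "range g \<subseteq> U" "linear g" "\<And>v. v \<in> f ` U \<Longrightarrow> f (g v) = v"
    using linear_exists_right_inverse_on[OF assms(1,2)] by blast
  have s: "subspace (f ` U)" using assms linear_subspace_image by blast
  have "inj_on g (f ` U)" by (metis g(3) inj_onI)
  then have "bij_betw g (f ` U) U"
    using g assms s by (intro linear_inj_imp_bij_betw) auto
  then have "x = g (f x)" if "x \<in> U" for x
    using that g(3) unfolding bij_betw_def by (metis imageE)
  then show ?thesis by (metis inj_onI)
qed


section \<open>Fitting decomposition and decompositions into indecomposables\<close>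

lemma subrep_zero: "linear_action A \<Longrightarrow> subrep A {0}"
  unfolding subrep_def linear_action_def by (auto simp: linear_0 subspace_def)

lemma rep_map_funpow: "rep_map A U A U f \<Longrightarrow> rep_map A U A U (f ^^ n)"
proof (induction n)
  case 0
  then show ?case using rep_map_id[of A U] by (simp add: id_def)
next
  case (Suc n)
  then show ?case using rep_map_compose[of A U A U "f ^^ n" A U f] by (simp add: o_def)
qed

text \<open>Let \<open>g\<close> be a power of \<open>f\<close> whose image has least dimension.
  Then \<open>g\<close> is bijective on its own image, so \<open>U\<close> is the direct sum of the
  kernel and the image of \<open>g\<close>, and indecomposability leaves only one of them.\<close>

lemma fitting:
  fixes A :: "'s \<Rightarrow> 'a \<Rightarrow> 'a::euclidean_space"
  assumes A: "linear_action A" and U: "indecomposable A U" and f: "rep_map A U A U f"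
  shows "inj_on f U \<or> (\<exists>n. \<forall>x\<in>U. (f ^^ n) x = 0)"
proof -
  note sU = indecomposableD(1)[OF U]
  \<comment> \<open>The exponent is \<open>Suc n\<close> because injectivity of a positive power
    passes to \<open>f\<close>, while the zeroth power is always injective.\<close>
  obtain n where n: "\<And>m. dim ((f ^^ Suc n) ` U) \<le> dim ((f ^^ Suc m) ` U)"
    using ex_has_least_nat[of "\<lambda>_. True" 0 "\<lambda>n. dim ((f ^^ Suc n) ` U)"] by auto
  define g where "g = f ^^ Suc n"
  have g: "rep_map A U A U g"
    unfolding g_def by (rule rep_map_funpow[OF f])
  note gl = rep_mapD(1)[OF g] and gU = rep_mapD(2)[OF g]
  have sI: "subrep A (g ` U)" using rep_map_image_subrep[OF sU g] .
  have "g ` g ` U = (f ^^ Suc (n + Suc n)) ` U"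
    unfolding g_def image_comp funpow_add[symmetric] by simp
  then have d: "dim (g ` U) \<le> dim (g ` g ` U)"
    using n[of "n + Suc n"] unfolding g_def by simp
  have inj: "inj_on g (g ` U)"
    by (rule linear_surj_imp_inj_on[OF gl subrepD(1)[OF sI] d])
  have "bij_betw g (g ` U) (g ` U)"
    by (rule linear_inj_imp_bij_betw[OF gl subrepD(1)[OF sI] subrepD(1)[OF sI] _ inj])
      (use gU in auto)
  then have surj: "g ` g ` U = g ` U" unfolding bij_betw_def by blast
  let ?K = "{x \<in> U. g x = 0}"
  have g0: "g 0 = 0" using linear_0[OF gl] .
  have "dsum U ?K (g ` U)"
  proof (rule dsumI)
    fix x assume "x \<in> ?K" "x \<in> g ` U"
    moreover have "0 \<in> g ` U" using subspace_0[OF subrepD(1)[OF sI]] .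
    ultimately show "x = 0" using inj_onD[OF inj, of x 0] g0 by simp
  next
    show "0 \<in> ?K" using subspace_0[OF subrepD(1)[OF sU]] g0 by simp
    show "0 \<in> g ` U" using subspace_0[OF subrepD(1)[OF sI]] .
    show "x + y \<in> U" if "x \<in> ?K" "y \<in> g ` U" for x y
      using that gU subspace_add[OF subrepD(1)[OF sU]] by auto
    fix x assume x: "x \<in> U"
    then have "g x \<in> g ` g ` U" using surj by blast
    then obtain y where y: "y \<in> g ` U" "g x = g y" by auto
    then have "y \<in> U" using gU by auto
    then have "x - y \<in> ?K"
      using x y subspace_diff[OF subrepD(1)[OF sU]] by (simp add: linear_diff[OF gl])
    then show "\<exists>v\<in>?K. \<exists>w\<in>g ` U. x = v + w"
      using y by (intro bexI[of _ "x - y"] bexI[of _ y]) auto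
  qed
  from indecomposable_dsum[OF U rep_map_kernel_subrep[OF sU A g] sI this]
  show ?thesis
  proof
    assume "?K = {0}"
    then have "inj_on g U"
      using linear_inj_on_iff_eq_0[OF gl subrepD(1)[OF sU]] by auto
    then have "inj_on f U"
      unfolding g_def funpow_Suc_right by (rule inj_on_imageI2)
    then show ?thesis ..
  next
    assume "g ` U = {0}"
    then have "\<forall>x\<in>U. (f ^^ Suc n) x = 0" unfolding g_def by blast
    then show ?thesis by blast
  qed
qed

text \<open>Locality of the endomorphism ring. Let \<open>t\<close> invert \<open>f + g\<close>. If
  \<open>g\<close> is not injective, neither is \<open>t g\<close>, which is therefore nilpotent by
  \<open>fitting\<close>. But \<open>t g\<close> fixes every point of the kernel of
  \<open>f\<close>, so this kernel is zero.\<close>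

lemma endo_add_inj_on:
  fixes A :: "'s \<Rightarrow> 'a \<Rightarrow> 'a::euclidean_space"
  assumes A: "linear_action A" and U: "indecomposable A U"
    and f: "rep_map A U A U f" and g: "rep_map A U A U g"
    and inj: "inj_on (\<lambda>x. f x + g x) U"
  shows "inj_on f U \<or> inj_on g U"
proof (rule disjCI)
  note sU = indecomposableD(1)[OF U]
  assume ng: "\<not> inj_on g U"
  let ?s = "\<lambda>x. f x + g x"
  have s: "rep_map A U A U ?s" by (rule rep_map_add[OF A subrepD(1)[OF sU] f g])
  have "bij_betw ?s U U"
    by (rule linear_inj_imp_bij_betw[OF rep_mapD(1)[OF s] subrepD(1)[OF sU] subrepD(1)[OF sU] _ inj])
      (use rep_mapD(2)[OF s] in auto)
  from rep_map_inverse[OF sU s this] obtain t where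
    t: "rep_map A U A U t" "\<And>x. x \<in> U \<Longrightarrow> t (?s x) = x" by metis
  define h where "h = (\<lambda>x. t (g x))"
  have h: "rep_map A U A U h"
    unfolding h_def by (rule rep_map_compose[OF g t(1)])
  have "\<not> inj_on h U"
    using ng inj_on_imageI2[of t g U] unfolding h_def o_def by blast
  then obtain n where n: "\<And>x. x \<in> U \<Longrightarrow> (h ^^ n) x = 0"
    using fitting[OF A U h] by blast
  show "inj_on f U"
    unfolding linear_inj_on_iff_eq_0[OF rep_mapD(1)[OF f] subrepD(1)[OF sU]]
  proof (intro ballI impI)
    fix x assume x: "x \<in> U" "f x = 0"
    then have "h x = x" using t(2)[OF x(1)] unfolding h_def by simp
    then have "(h ^^ n) x = x" by (induction n) auto
    then show "x = 0" using n[OF x(1)] by simp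
  qed
qed

text \<open>The form in which locality is applied: the identity is written as a sum of endomorphisms
  that factor through other components, and one of these must be invertible. The empty sum is
  excluded by \<open>U\<close> being nonzero.\<close>

lemma endo_sum_inj_on:
  fixes A :: "'s \<Rightarrow> 'a \<Rightarrow> 'a::euclidean_space"
  assumes A: "linear_action A" and U: "indecomposable A U" and "finite T"
    and "\<And>t. t \<in> T \<Longrightarrow> rep_map A U A U (f t)" and "inj_on (\<lambda>x. \<Sum>t\<in>T. f t x) U"
  shows "\<exists>t\<in>T. inj_on (f t) U"
  using assms(3-)
proof (induction T)
  case empty
  have "0 \<in> U" using indecomposableD(1)[OF U] subrepD(1) subspace_0 by blast
  with empty indecomposableD(2)[OF U] show ?case by (auto simp: inj_on_def)
next
  case (insert t T)
  have "rep_map A U A U (\<lambda>x. \<Sum>t\<in>T. f t x)"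
    using insert.prems(1) by (intro rep_map_sum[OF A subrepD(1)[OF indecomposableD(1)[OF U]]]) auto
  then have "inj_on (f t) U \<or> inj_on (\<lambda>x. \<Sum>t\<in>T. f t x) U"
    using insert.prems insert.hyps by (intro endo_add_inj_on[OF A U]) auto
  then show ?case using insert.IH insert.prems(1) by auto
qed

text \<open>Since \<open>g f\<close> is an automorphism of \<open>U\<close>, the image of
  \<open>f\<close> is a direct summand of \<open>Z\<close> with the kernel of \<open>g\<close> as
  complement. It is nonzero, so indecomposability of \<open>Z\<close> makes it all of
  \<open>Z\<close>.\<close>

lemma rep_map_split_bij_betw:
  fixes A :: "'s \<Rightarrow> 'a \<Rightarrow> 'a::euclidean_space" and B :: "'s \<Rightarrow> 'b \<Rightarrow> 'b::euclidean_space"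
  assumes A: "linear_action A" and U: "indecomposable A U" and Z: "indecomposable B Z"
    and f: "rep_map A U B Z f" and g: "rep_map B Z A U g" and inj: "inj_on (\<lambda>x. g (f x)) U"
  shows "bij_betw f U Z"
proof -
  note sU = indecomposableD(1)[OF U] and sZ = indecomposableD(1)[OF Z]
  note s0 = subspace_0[OF subrepD(1)]
  let ?h = "\<lambda>x. g (f x)"
  have h: "rep_map A U A U ?h" by (rule rep_map_compose[OF f g])
  note fl = rep_mapD(1)[OF f] and gl = rep_mapD(1)[OF g] and hl = rep_mapD(1)[OF h]
  have "bij_betw ?h U U"
    by (rule linear_inj_imp_bij_betw[OF hl subrepD(1)[OF sU] subrepD(1)[OF sU] _ inj])
      (use rep_mapD(2)[OF h] in auto)
  then have surj: "?h ` U = U" unfolding bij_betw_def by blast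
  have ker: "x = 0" if "x \<in> U" "?h x = 0" for x
    using that inj linear_inj_on_iff_eq_0[OF hl subrepD(1)[OF sU]] by blast
  have fi: "inj_on f U" using inj_on_imageI2[of g f U] inj unfolding o_def by blast
  let ?K = "{z \<in> Z. g z = 0}"
  have "dsum Z (f ` U) ?K"
  proof (rule dsumI)
    fix z assume "z \<in> f ` U" "z \<in> ?K"
    then show "z = 0" using ker linear_0[OF fl] by auto
  next
    show "0 \<in> f ` U" using s0[OF rep_map_image_subrep[OF sU f]] .
    show "0 \<in> ?K" using s0[OF sZ] linear_0[OF gl] by simp
    show "x + y \<in> Z" if "x \<in> f ` U" "y \<in> ?K" for x y
      using that rep_mapD(2)[OF f] subspace_add[OF subrepD(1)[OF sZ]] by auto
    fix z assume z: "z \<in> Z"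
    then have "g z \<in> ?h ` U" using surj rep_mapD(2)[OF g] by blast
    then obtain u where u: "u \<in> U" "g z = ?h u" by auto
    then have "z - f u \<in> ?K"
      using z rep_mapD(2)[OF f] subspace_diff[OF subrepD(1)[OF sZ]] by (simp add: linear_diff[OF gl])
    then show "\<exists>v\<in>f ` U. \<exists>w\<in>?K. z = v + w"
      using u by (intro bexI[of _ "f u"] bexI[of _ "z - f u"]) auto
  qed
  note d = this
  from indecomposable_dsum[OF Z rep_map_image_subrep[OF sU f] rep_map_kernel_subrep[OF sZ A g] d]
  show ?thesis
  proof
    assume 0: "f ` U = {0}"
    have "U = {0}"
    proof -
      have "x = 0" if "x \<in> U" for x
      proof -
        have "f x = 0" using 0 that by blast
        then show ?thesis using ker[OF that] linear_0[OF gl] by simp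
      qed
      then show ?thesis using s0[OF sU] by blast
    qed
    then show ?thesis using indecomposableD(2)[OF U] by blast
  next
    assume "?K = {0}"
    then have "z \<in> f ` U" if "z \<in> Z" for z
      using dsumD(5)[OF d that] by auto
    moreover have "f ` U \<subseteq> Z" using rep_mapD(2)[OF f] by blast
    ultimately show ?thesis using fi unfolding bij_betw_def by blast
  qed
qed

lemma indecomposable_rep_iso:
  fixes A :: "'s \<Rightarrow> 'a \<Rightarrow> 'a::real_vector" and B :: "'s \<Rightarrow> 'b \<Rightarrow> 'b::real_vector"
  assumes U: "indecomposable A U" and W: "subrep B W" and iso: "rep_iso A U B W"
  shows "indecomposable B W"
proof -
  note sU = indecomposableD(1)[OF U]
  obtain f where "rep_map A U B W f" "bij_betw f U W"
    using iso rep_iso_iff[OF sU] by blast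
  then obtain g where g: "rep_map B W A U g" "bij_betw g W U"
    using rep_map_inverse[OF sU] by metis
  note gl = rep_mapD(1)[OF g(1)]
  have inj: "inj_on g W" and im: "g ` W = U" using g(2) unfolding bij_betw_def by auto
  have ker: "x = 0" if "x \<in> W" "g x = 0" for x
    using that inj linear_inj_on_iff_eq_0[OF gl subrepD(1)[OF W]] by blast
  have nz: "W \<noteq> {0}"
    using indecomposableD(2)[OF U] im linear_0[OF gl] by auto
  have "W1 = {0} \<or> W2 = {0}" if s: "subrep B W1" "subrep B W2" and d: "dsum W W1 W2" for W1 W2
  proof -
    have sub: "W1 \<subseteq> W" "W2 \<subseteq> W" using dsumD(3,4)[OF d] by auto
    have "dsum U (g ` W1) (g ` W2)"
    proof (rule dsumI)
      fix x assume "x \<in> g ` W1" "x \<in> g ` W2"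
      then obtain a b where ab: "a \<in> W1" "b \<in> W2" "x = g a" "x = g b" by auto
      then have "a = b" using inj sub by (auto simp: inj_on_def)
      then have "a = 0" using ab dsumD(1)[OF d] by blast
      then show "x = 0" using ab linear_0[OF gl] by simp
    next
      show "0 \<in> g ` W1" using dsumD(6)[OF d] linear_0[OF gl] by force
      show "0 \<in> g ` W2" using dsumD(7)[OF d] linear_0[OF gl] by force
      show "x + y \<in> U" if "x \<in> g ` W1" "y \<in> g ` W2" for x y
        using that im dsumD(2)[OF d] by (auto simp: linear_add[OF gl, symmetric])
      fix x assume "x \<in> U"
      then obtain w where w: "w \<in> W" "x = g w" using im by auto
      then obtain v1 v2 where "v1 \<in> W1" "v2 \<in> W2" "w = v1 + v2" using dsumD(5)[OF d] by blast
      then show "\<exists>v\<in>g ` W1. \<exists>v'\<in>g ` W2. x = v + v'"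
        using w by (auto simp: linear_add[OF gl])
    qed
    then have "g ` W1 = {0} \<or> g ` W2 = {0}"
      using indecomposable_dsum[OF U] rep_map_image_subrep[OF s(1) rep_map_subset[OF g(1) sub(1)]]
        rep_map_image_subrep[OF s(2) rep_map_subset[OF g(1) sub(2)]] by blast
    moreover have "W1 = {0}" if "g ` W1 = {0}"
      using that ker sub dsumD(6)[OF d] by blast
    moreover have "W2 = {0}" if "g ` W2 = {0}"
      using that ker sub dsumD(7)[OF d] by blast
    ultimately show ?thesis by blast
  qed
  then show ?thesis using W nz unfolding indecomposable_def dsum_def by simp
qed

text \<open>Coordinates with respect to the decomposition. Linearity, equivariance and the values on
  the components all follow from uniqueness: a family with members in the \<open>Y i\<close> and
  with sum \<open>x\<close> is the family of coordinates of \<open>x\<close>.\<close>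

lemma decomposition_projections:
  fixes A :: "'s \<Rightarrow> 'a \<Rightarrow> 'a::real_vector"
  assumes A: "linear_action A" and D: "decomposition A UNIV s Y"
  obtains e where "\<And>i. i \<in> {1..s} \<Longrightarrow> rep_map A UNIV A (Y i) (e i)"
    "\<And>x. (\<Sum>i\<in>{1..s}. e i x) = x"
    "\<And>i x. i \<in> {1..s} \<Longrightarrow> x \<in> Y i \<Longrightarrow> e i x = x"
    "\<And>i j x. i \<in> {1..s} \<Longrightarrow> j \<in> {1..s} \<Longrightarrow> i \<noteq> j \<Longrightarrow> x \<in> Y j \<Longrightarrow> e i x = 0"
proof -
  let ?S = "\<lambda>y. \<Sum>i\<in>{1..s}. y i" and ?P = "\<Pi>\<^sub>E i\<in>{1..s}. Y i"
  have bij: "bij_betw ?S ?P UNIV" and Y: "\<And>i. i \<in> {1..s} \<Longrightarrow> subrep A (Y i)"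
    using D indecomposableD(1) unfolding decomposition_def by blast+
  note sY = subrepD(1)[OF Y] and aY = subrepD(2)[OF Y]
  define e where "e i x = inv_into ?P ?S x i" for i x
  \<comment> \<open>The sum map is injective only on extensional families, hence the restriction of
    \<open>u\<close> to the index set.\<close>
  have uniq: "e i x = u i" if "\<And>i. i \<in> {1..s} \<Longrightarrow> u i \<in> Y i" "?S u = x" "i \<in> {1..s}" for u x i
  proof -
    have u: "restrict u {1..s} \<in> ?P" using that(1) by auto
    have "?S (restrict u {1..s}) = x" using that(2) by simp
    then have "inv_into ?P ?S x = restrict u {1..s}"
      using u bij inv_into_f_f[of ?S ?P "restrict u {1..s}"] unfolding bij_betw_def by metis
    then show ?thesis using that(3) unfolding e_def by simp
  qed
  have ePE: "inv_into ?P ?S x \<in> ?P" for x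
    using bij by (intro inv_into_into) (simp add: bij_betw_def)
  have eY: "e i x \<in> Y i" if "i \<in> {1..s}" for i x
    using ePE[of x] that unfolding e_def by (rule PiE_mem)
  have esum: "(\<Sum>i\<in>{1..s}. e i x) = x" for x
    unfolding e_def using bij f_inv_into_f[of x ?S ?P] unfolding bij_betw_def by simp
  have el: "linear (e i)" if i: "i \<in> {1..s}" for i
  proof (rule linearI)
    fix x y
    show "e i (x + y) = e i x + e i y"
    proof (rule uniq[OF _ _ i])
      show "e i x + e i y \<in> Y i" if "i \<in> {1..s}" for i
        using eY subspace_add[OF sY] that by blast
      show "(\<Sum>i\<in>{1..s}. e i x + e i y) = x + y"
        unfolding sum.distrib esum ..
    qed
    fix c
    show "e i (c *\<^sub>R x) = c *\<^sub>R e i x"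
    proof (rule uniq[OF _ _ i])
      show "c *\<^sub>R e i x \<in> Y i" if "i \<in> {1..s}" for i
        using eY subspace_scale[OF sY] that by blast
      show "(\<Sum>i\<in>{1..s}. c *\<^sub>R e i x) = c *\<^sub>R x"
        unfolding scaleR_right.sum[symmetric] esum ..
    qed
  qed
  have eA: "e i (A \<sigma> x) = A \<sigma> (e i x)" if i: "i \<in> {1..s}" for i x \<sigma>
  proof (rule uniq[OF _ _ i])
    show "A \<sigma> (e i x) \<in> Y i" if "i \<in> {1..s}" for i
      using aY eY that by blast
    have "linear (A \<sigma>)" using A unfolding linear_action_def by blast
    from linear_sum[OF this, of "\<lambda>i. e i x" "{1..s}"]
    show "(\<Sum>i\<in>{1..s}. A \<sigma> (e i x)) = A \<sigma> x"
      unfolding esum by (rule sym)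
  qed
  have single: "e i x = (if i = j then x else 0)"
    if "i \<in> {1..s}" "j \<in> {1..s}" "x \<in> Y j" for i j x
    by (rule uniq[OF _ _ that(1)]) (use that subspace_0[OF sY] in auto)
  show ?thesis
  proof (rule that)
    show "rep_map A UNIV A (Y i) (e i)" if "i \<in> {1..s}" for i
      using el eY eA that by (intro rep_mapI) auto
  qed (use esum single in auto)
qed

text \<open>The new summand receives the last index, so that later lemmas can tell where a
  prescribed component sits.\<close>

lemma decomposition_insert:
  assumes U: "subspace U" and D: "decomposition A U s Y" and V: "indecomposable A V"
    and d: "dsum X U V"
  shows "decomposition A X (Suc s) (Y(Suc s := V))"
proof -
  let ?S = "\<lambda>s y. \<Sum>i\<in>{1..s}. y i" and ?P = "\<Pi>\<^sub>E i\<in>{1..s}. Y i"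
  let ?Y = "Y(Suc s := V)" let ?Q = "\<Pi>\<^sub>E i\<in>{1..Suc s}. ?Y i"
  have bij: "bij_betw (?S s) ?P U" using D unfolding decomposition_def by blast
  then have inj: "inj_on (?S s) ?P" and im: "?S s ` ?P = U" unfolding bij_betw_def by auto
  have res: "restrict y {1..s} \<in> ?P" "?S s (restrict y {1..s}) = ?S s y" "?S s y \<in> U" "y (Suc s) \<in> V"
    if "y \<in> ?Q" for y
  proof -
    show *: "restrict y {1..s} \<in> ?P"
    proof (rule restrict_PiE_iff[THEN iffD2], rule ballI)
      fix i assume i: "i \<in> {1..s}"
      then have "y i \<in> ?Y i" by (intro PiE_mem[OF that]) simp
      then show "y i \<in> Y i" using i by simp
    qed
    show **: "?S s (restrict y {1..s}) = ?S s y" by simp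
    show "?S s y \<in> U" using * ** im by (metis imageI)
    show "y (Suc s) \<in> V" using PiE_mem[OF that, of "Suc s"] by simp
  qed
  have "bij_betw (?S (Suc s)) ?Q X"
    unfolding bij_betw_def
  proof
    show "inj_on (?S (Suc s)) ?Q"
    proof (rule inj_onI)
      fix y z assume yz: "y \<in> ?Q" "z \<in> ?Q" and eq: "?S (Suc s) y = ?S (Suc s) z"
      have "?S s y - ?S s z \<in> U" using res(3) yz subspace_diff[OF U] by blast
      moreover have "?S s y - ?S s z = z (Suc s) - y (Suc s)"
        using eq by (simp add: algebra_simps)
      moreover have "z (Suc s) - y (Suc s) \<in> V"
        using res(4) yz subspace_diff[OF subrepD(1)[OF indecomposableD(1)[OF V]]] by blast
      ultimately have 0: "?S s y - ?S s z = 0" "z (Suc s) - y (Suc s) = 0"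
        using dsumD(1)[OF d] by metis+
      have "?S s (restrict y {1..s}) = ?S s (restrict z {1..s})"
        unfolding res(2)[OF yz(1)] res(2)[OF yz(2)] using 0(1) by (rule eq_iff_diff_eq_0[THEN iffD2])
      from inj_onD[OF inj this res(1)[OF yz(1)] res(1)[OF yz(2)]]
      have le: "y i = z i" if "i \<in> {1..s}" for i
        using that restrict_apply'[OF that, of y] restrict_apply'[OF that, of z] by argo
      show "y = z"
      proof
        fix i
        consider "i \<in> {1..s}" | "i = Suc s" | "i \<notin> {1..Suc s}" by fastforce
        then show "y i = z i"
        proof cases
          case 3
          then show ?thesis using PiE_arb[OF yz(1) 3] PiE_arb[OF yz(2) 3] by metis
        qed (use le 0(2) in auto)
      qed
    qed
    show "?S (Suc s) ` ?Q = X"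
    proof
      show "?S (Suc s) ` ?Q \<subseteq> X"
        using res dsumD(2)[OF d] by auto
      show "X \<subseteq> ?S (Suc s) ` ?Q"
      proof
        fix x assume "x \<in> X"
        then obtain u v where uv: "u \<in> U" "v \<in> V" "x = u + v" using dsumD(5)[OF d] by blast
        then obtain y where y: "y \<in> ?P" "u = ?S s y" using im by blast
        have "y(Suc s := v) \<in> ?Q"
        proof (rule PiE_I)
          fix i assume "i \<in> {1..Suc s}"
          then show "(y(Suc s := v)) i \<in> ?Y i"
            using PiE_mem[OF y(1), of i] uv(2) by (cases "i = Suc s") auto
        next
          fix i assume "i \<notin> {1..Suc s}"
          then show "(y(Suc s := v)) i = undefined"
            using PiE_arb[OF y(1), of i] by auto
        qed
        moreover have "?S (Suc s) (y(Suc s := v)) = x" using y uv by simp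
        ultimately show "x \<in> ?S (Suc s) ` ?Q" by blast
      qed
    qed
  qed
  moreover have "indecomposable A (?Y i)" if "i \<in> {1..Suc s}" for i
    using that V D unfolding decomposition_def by (cases "i = Suc s") auto
  ultimately show ?thesis unfolding decomposition_def by blast
qed

lemma dsum_nonzero_dim_less:
  fixes U :: "'a::euclidean_space set"
  assumes d: "dsum U V W" and s: "subspace U" "subspace W" and V: "V \<noteq> {0}"
  shows "dim W < dim U"
proof -
  have "W \<subseteq> U" using dsumD(4)[OF d] by blast
  moreover have "W \<noteq> U" using V dsumD(1,3,6)[OF d] by blast
  ultimately show ?thesis
    using subspace_dim_equal[OF s(2,1)] dim_subset[of W U] by linarith
qed

text \<open>Take a nonzero summand of least dimension. If it split into two nonzero parts,
  \<open>dsum_assoc\<close> would make one part a smaller nonzero summand of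
  \<open>U\<close>.\<close>

lemma exists_indecomposable_summand:
  fixes A :: "'s \<Rightarrow> 'a \<Rightarrow> 'a::euclidean_space"
  assumes A: "linear_action A" and U: "subrep A U" "U \<noteq> {0}"
  shows "\<exists>V W. indecomposable A V \<and> subrep A W \<and> dsum U V W"
proof -
  define P where "P V \<longleftrightarrow> subrep A V \<and> V \<noteq> {0} \<and> (\<exists>W. subrep A W \<and> dsum U V W)" for V
  have "dsum U U {0}" by (rule dsumI) (use subspace_0[OF subrepD(1)[OF U(1)]] in auto)
  then have "P U" using U subrep_zero[OF A] unfolding P_def by blast
  then obtain V where V: "P V" and min: "\<And>V'. P V' \<Longrightarrow> dim V \<le> dim V'"
    using ex_has_least_nat[of P U dim] by blast
  then obtain W where W: "subrep A W" "dsum U V W" and sV: "subrep A V" "V \<noteq> {0}"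
    unfolding P_def by blast
  have "V1 = {0} \<or> V2 = {0}" if s: "subrep A V1" "subrep A V2" and d: "dsum V V1 V2" for V1 V2
  proof (rule ccontr)
    assume "\<not> ?thesis"
    then have nz: "V1 \<noteq> {0}" "V2 \<noteq> {0}" by auto
    note a = dsum_assoc[OF W(2) d subrepD(1)[OF sV(1)]]
    have "subrep A {x + y | x y. x \<in> V2 \<and> y \<in> W}"
      by (rule dsum_subrep[OF A s(2) W(1) a(2)])
    then have "P V1" using a(1) s(1) nz(1) unfolding P_def by blast
    then have "dim V \<le> dim V1" by (rule min)
    then show False
      using dsum_nonzero_dim_less[OF dsum_sym[OF d] subrepD(1)[OF sV(1)] subrepD(1)[OF s(1)] nz(2)]
      by linarith
  qed
  then have "indecomposable A V" using sV unfolding indecomposable_def dsum_def by simp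
  then show ?thesis using W by blast
qed

lemma exists_decomposition:
  fixes A :: "'s \<Rightarrow> 'a \<Rightarrow> 'a::euclidean_space"
  assumes A: "linear_action A" and U: "subrep A U"
  shows "\<exists>s Y. decomposition A U s Y"
  using U
proof (induction "dim U" arbitrary: U rule: less_induct)
  case less
  show ?case
  proof (cases "U = {0}")
    case True
    \<comment> \<open>The product over no indices has exactly one element, and the empty sum is
      0.\<close>
    have "decomposition A U 0 (\<lambda>_. {})"
      unfolding decomposition_def True bij_betw_def by auto
    then show ?thesis by blast
  next
    case False
    then obtain V W where V: "indecomposable A V" "subrep A W" "dsum U V W"
      using exists_indecomposable_summand[OF A less.prems] by blast
    have "dim W < dim U"
      by (rule dsum_nonzero_dim_less[OF V(3) subrepD(1)[OF less.prems] subrepD(1)[OF V(2)]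
            indecomposableD(2)[OF V(1)]])
    then obtain s Y where "decomposition A W s Y" using less.hyps V(2) by blast
    from decomposition_insert[OF subrepD(1)[OF V(2)] this V(1) dsum_sym[OF V(3)]]
    show ?thesis by blast
  qed
qed

text \<open>\<open>generic_Hopf_rep\<close> requires a decomposition in which the prescribed
  component occurs. It is found by decomposing the complement and appending
  \<open>V\<close>.\<close>

lemma decomposition_with_summand:
  fixes A :: "'s \<Rightarrow> 'a \<Rightarrow> 'a::euclidean_space"
  assumes A: "linear_action A" and V: "indecomposable A V" "subrep A W" "dsum U V W"
  shows "\<exists>s Y. decomposition A U (Suc s) Y \<and> Y (Suc s) = V"
proof -
  obtain s Y where "decomposition A W s Y" using exists_decomposition[OF A V(2)] by blast
  from decomposition_insert[OF subrepD(1)[OF V(2)] this V(1) dsum_sym[OF V(3)]]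
  show ?thesis by (metis fun_upd_same)
qed

lemma decomposition_with_two_summands:
  fixes A :: "'s \<Rightarrow> 'a \<Rightarrow> 'a::euclidean_space"
  assumes A: "linear_action A" and V: "indecomposable A V1" "dsum U V1 V"
    "indecomposable A V2" "dsum V V2 W" "subrep A W"
  shows "\<exists>s Y. decomposition A U (Suc (Suc s)) Y \<and> Y (Suc s) = V2 \<and> Y (Suc (Suc s)) = V1"
proof -
  obtain s Y where Y: "decomposition A V (Suc s) Y" "Y (Suc s) = V2"
    using decomposition_with_summand[OF A V(3,5,4)] by blast
  have "subspace V"
    using subrepD(1)[OF dsum_subrep[OF A indecomposableD(1)[OF V(3)] V(5) V(4)]] .
  from decomposition_insert[OF this Y(1) V(1) dsum_sym[OF V(2)]] Y(2)
  show ?thesis by (intro exI[of _ s] exI[of _ "Y(Suc (Suc s) := V1)"]) simp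
qed

text \<open>The complement is taken as the kernel of the projection \<open>e i\<close> instead of
  the sum of the other components: it contains each other \<open>Y j\<close> because
  \<open>e i\<close> vanishes there, and \<open>e j\<close> splits \<open>Y j\<close> off inside
  it.\<close>

lemma decomposition_complement:
  fixes A :: "'s \<Rightarrow> 'a \<Rightarrow> 'a::real_vector"
  assumes A: "linear_action A" and D: "decomposition A UNIV s Y" and i: "i \<in> {1..s}"
  obtains V where "subrep A V" "dsum UNIV (Y i) V"
    "\<And>j. j \<in> {1..s} \<Longrightarrow> j \<noteq> i \<Longrightarrow> \<exists>W. subrep A W \<and> dsum V (Y j) W"
proof -
  obtain e where e: "\<And>i. i \<in> {1..s} \<Longrightarrow> rep_map A UNIV A (Y i) (e i)"
    "\<And>x. (\<Sum>i\<in>{1..s}. e i x) = x"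
    "\<And>i x. i \<in> {1..s} \<Longrightarrow> x \<in> Y i \<Longrightarrow> e i x = x"
    "\<And>i j x. i \<in> {1..s} \<Longrightarrow> j \<in> {1..s} \<Longrightarrow> i \<noteq> j \<Longrightarrow> x \<in> Y j \<Longrightarrow> e i x = 0"
    by (rule decomposition_projections[OF A D]) auto
  have sY: "subrep A (Y j)" if "j \<in> {1..s}" for j
    using D that indecomposableD(1) unfolding decomposition_def by blast
  have split: "dsum V (Y j) {x \<in> V. e j x = 0}"
    if j: "j \<in> {1..s}" and V: "subspace V" "Y j \<subseteq> V" for j V
  proof (rule dsumI)
    note l = rep_mapD(1)[OF e(1)[OF j]]
    show "x = 0" if "x \<in> Y j" "x \<in> {x \<in> V. e j x = 0}" for x using that e(3)[OF j] by auto
    show "0 \<in> Y j" using subspace_0[OF subrepD(1)[OF sY[OF j]]] .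
    show "0 \<in> {x \<in> V. e j x = 0}" using linear_0[OF l] subspace_0[OF V(1)] by simp
    show "x + y \<in> V" if "x \<in> Y j" "y \<in> {x \<in> V. e j x = 0}" for x y
      using that V subspace_add by blast
    fix x assume x: "x \<in> V"
    have y: "e j x \<in> Y j" using rep_mapD(2)[OF e(1)[OF j]] by blast
    then have "x - e j x \<in> {x \<in> V. e j x = 0}"
      using x V e(3)[OF j] subspace_diff[OF V(1)] by (auto simp: linear_diff[OF l])
    then show "\<exists>v\<in>Y j. \<exists>w\<in>{x \<in> V. e j x = 0}. x = v + w"
      using y by (intro bexI[of _ "e j x"] bexI[of _ "x - e j x"]) auto
  qed
  have sU: "subrep A UNIV" unfolding subrep_def by simp
  let ?V = "{x \<in> UNIV. e i x = 0}"
  have V: "subrep A ?V" by (rule rep_map_kernel_subrep[OF sU A e(1)[OF i]])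
  show ?thesis
  proof (rule that[OF V split[OF i]])
    fix j assume j: "j \<in> {1..s}" "j \<noteq> i"
    have "subrep A {x \<in> ?V. e j x = 0}"
      by (rule rep_map_kernel_subrep[OF V A rep_map_subset[OF e(1)[OF j(1)] subset_UNIV order_refl]])
    moreover have "dsum ?V (Y j) {x \<in> ?V. e j x = 0}"
      using j e(4)[OF i j(1)] by (intro split subrepD(1)[OF V]) auto
    ultimately show "\<exists>W. subrep A W \<and> dsum ?V (Y j) W" by blast
  qed auto
qed


section \<open>The type of a representation is an isomorphism invariant\<close>

context ring
begin

lemma left_idealI:
  assumes "I \<subseteq> carrier R" "\<zero> \<in> I" "\<And>a b. a \<in> I \<Longrightarrow> b \<in> I \<Longrightarrow> a \<oplus> b \<in> I"
    "\<And>r a. r \<in> carrier R \<Longrightarrow> a \<in> I \<Longrightarrow> r \<otimes> a \<in> I"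
  shows "left_ideal R I"
proof -
  have "\<ominus> a \<in> I" if "a \<in> I" for a
  proof -
    have "\<ominus> \<one> \<otimes> a \<in> I" using assms(4) that by simp
    moreover have "\<ominus> \<one> \<otimes> a = \<ominus> a" using that assms(1) by (simp add: l_minus subsetD)
    ultimately show ?thesis by simp
  qed
  then have "subgroup I (add_monoid R)"
    using assms(1-3) by (intro add.subgroupI) (auto simp: a_inv_def)
  then show ?thesis
    using assms(4) unfolding left_ideal_def additive_subgroup_def by blast
qed

lemma left_idealD:
  assumes "left_ideal R I"
  shows "I \<subseteq> carrier R" "\<zero> \<in> I" "a \<in> I \<Longrightarrow> b \<in> I \<Longrightarrow> a \<oplus> b \<in> I"
    "r \<in> carrier R \<Longrightarrow> a \<in> I \<Longrightarrow> r \<otimes> a \<in> I" "a \<in> I \<Longrightarrow> \<ominus> a \<in> I"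
proof -
  have I: "additive_subgroup I R" using assms unfolding left_ideal_def by blast
  interpret additive_subgroup I R by (rule I)
  show "I \<subseteq> carrier R" "\<zero> \<in> I" "a \<in> I \<Longrightarrow> b \<in> I \<Longrightarrow> a \<oplus> b \<in> I"
    using a_subset a_closed by auto
  show "r \<in> carrier R \<Longrightarrow> a \<in> I \<Longrightarrow> r \<otimes> a \<in> I" for r a
    using assms unfolding left_ideal_def by blast
  from this[of "\<ominus> \<one>" a] a_subset show "a \<in> I \<Longrightarrow> \<ominus> a \<in> I"
    by (simp add: l_minus subsetD)
qed

lemma left_ideal_one: "left_ideal R I \<Longrightarrow> \<one> \<in> I \<Longrightarrow> I = carrier R"
  using left_idealD(1,4)[of I] r_one by (metis subsetI subset_antisym)

text \<open>Let \<open>N\<close> be the pullback of \<open>M\<close> along right multiplication by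
  \<open>r\<close>. If a left ideal \<open>I\<close> is strictly larger than \<open>N\<close>, then
  \<open>M + I r\<close> is strictly larger than \<open>M\<close>, hence everything, and
  \<open>r = m + a r\<close> with \<open>a\<close> in \<open>I\<close>. So \<open>1 - a\<close> lies
  in \<open>N\<close>, thus in \<open>I\<close>, and \<open>I\<close> contains 1.\<close>

lemma maximal_left_ideal_vimage:
  assumes M: "maximal_left_ideal R M" and r: "r \<in> carrier R" "r \<notin> M"
  shows "maximal_left_ideal R {a \<in> carrier R. a \<otimes> r \<in> M}"
proof -
  have lM: "left_ideal R M" and max: "\<And>I. left_ideal R I \<Longrightarrow> M \<subseteq> I \<Longrightarrow> I = M \<or> I = carrier R"
    using M unfolding maximal_left_ideal_def by blast+
  note M' = left_idealD[OF lM]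
  let ?N = "{a \<in> carrier R. a \<otimes> r \<in> M}"
  have lN: "left_ideal R ?N"
    by (rule left_idealI) (use M' r in \<open>auto simp: l_distr m_assoc\<close>)
  have nN: "?N \<noteq> carrier R" using r by (metis (mono_tags, lifting) l_one mem_Collect_eq one_closed)
  have "I = ?N \<or> I = carrier R" if I: "left_ideal R I" "?N \<subseteq> I" for I
  proof (rule disjCI)
    assume "I \<noteq> carrier R"
    note I' = left_idealD[OF I(1)]
    \<comment> \<open>The left ideal \<open>M + I r\<close>.\<close>
    let ?K = "{m \<oplus> a \<otimes> r | m a. m \<in> M \<and> a \<in> I}"
    have lK: "left_ideal R ?K"
    proof (rule left_idealI)
      show "?K \<subseteq> carrier R" using M'(1) I'(1) r(1) by auto
      have "\<zero> = \<zero> \<oplus> \<zero> \<otimes> r" using r(1) by simp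
      then show "\<zero> \<in> ?K" using M'(2) I'(2) by blast
      fix x y assume "x \<in> ?K" "y \<in> ?K"
      then obtain m a n b where x: "m \<in> M" "a \<in> I" "x = m \<oplus> a \<otimes> r"
        "n \<in> M" "b \<in> I" "y = n \<oplus> b \<otimes> r" by blast
      then have c: "m \<in> carrier R" "a \<in> carrier R" "n \<in> carrier R" "b \<in> carrier R"
        using M'(1) I'(1) by auto
      have "x \<oplus> y = (m \<oplus> n) \<oplus> (a \<oplus> b) \<otimes> r"
        using c r(1) x by (simp add: l_distr a_ac)
      then show "x \<oplus> y \<in> ?K" using x M'(3) I'(3) by blast
    next
      fix s x assume s: "s \<in> carrier R" and "x \<in> ?K"
      then obtain m a where x: "m \<in> M" "a \<in> I" "x = m \<oplus> a \<otimes> r" by blast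
      then have c: "m \<in> carrier R" "a \<in> carrier R"
        using M'(1) I'(1) by auto
      have "s \<otimes> x = s \<otimes> m \<oplus> (s \<otimes> a) \<otimes> r"
        using c r(1) x s by (simp add: r_distr m_assoc)
      then show "s \<otimes> x \<in> ?K" using x M'(4) I'(4) s by blast
    qed
    have MK: "M \<subseteq> ?K"
    proof
      fix m assume m: "m \<in> M"
      then have "m = m \<oplus> \<zero> \<otimes> r" using M'(1) r(1) by auto
      then show "m \<in> ?K" using m I'(2) by blast
    qed
    show "I = ?N"
    proof (rule ccontr)
      assume "I \<noteq> ?N"
      then obtain b where b: "b \<in> I" "b \<otimes> r \<notin> M" using I(2) I'(1) by auto
      have "b \<otimes> r = \<zero> \<oplus> b \<otimes> r" using b(1) I'(1) r(1) by auto
      then have "b \<otimes> r \<in> ?K" using b(1) M'(2) by blast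
      then have "?K \<noteq> M" using b(2) by blast
      then have "?K = carrier R" using max[OF lK MK] by argo
      then have "r \<in> ?K" using r(1) by (simp only:)
      then obtain m a where m: "m \<in> M" "a \<in> I" "r = m \<oplus> a \<otimes> r" by auto
      then have c: "m \<in> carrier R" "a \<in> carrier R" using M'(1) I'(1) by auto
      have "(\<one> \<ominus> a) \<otimes> r = r \<ominus> a \<otimes> r"
        using c r(1) by (simp add: minus_eq l_distr l_minus)
      also have "\<dots> = (m \<oplus> a \<otimes> r) \<ominus> a \<otimes> r" using m(3) by (rule arg_cong)
      also have "\<dots> = m" using c r(1) by (simp add: minus_eq a_assoc r_neg)
      finally have "\<one> \<ominus> a \<in> ?N" using m(1) c by simp
      then have "(\<one> \<ominus> a) \<oplus> a \<in> I" using I(2) I'(3) m(2) by blast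
      moreover have "(\<one> \<ominus> a) \<oplus> a = \<one>" using c by (simp add: minus_eq a_assoc l_neg)
      ultimately show False using left_ideal_one[OF I(1)] \<open>I \<noteq> carrier R\<close> by simp
    qed
  qed
  then show ?thesis using lN nN unfolding maximal_left_ideal_def by blast
qed

lemma jacobson_radical_left_ideal: "left_ideal R (jacobson_radical R)"
proof -
  have M: "left_ideal R M" if "maximal_left_ideal R M" for M
    using that unfolding maximal_left_ideal_def by blast
  show ?thesis
    by (rule left_idealI) (use left_idealD[OF M] in \<open>auto simp: jacobson_radical_def\<close>)
qed

text \<open>An intersection of left ideals is visibly closed only under left multiplication. For
  right multiplication by \<open>r\<close>, the condition that \<open>a r\<close> lies in
  \<open>M\<close> says that \<open>a\<close> lies in the pullback of \<open>M\<close>, which is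
  again maximal unless \<open>r\<close> itself belongs to \<open>M\<close>.\<close>

lemma jacobson_radical_ideal: "ideal (jacobson_radical R) R"
proof (rule idealI)
  note J = jacobson_radical_left_ideal
  show "ring R" by (rule ring_axioms)
  show "subgroup (jacobson_radical R) (add_monoid R)"
    using J unfolding left_ideal_def additive_subgroup_def by blast
  fix a r assume a: "a \<in> jacobson_radical R" and r: "r \<in> carrier R"
  show "r \<otimes> a \<in> jacobson_radical R" using left_idealD(4)[OF J r a] .
  have ac: "a \<in> carrier R" using a unfolding jacobson_radical_def by blast
  have "a \<otimes> r \<in> M" if M: "maximal_left_ideal R M" for M
  proof (cases "r \<in> M")
    case True
    then show ?thesis
      using M left_idealD(4) ac unfolding maximal_left_ideal_def by blast
  next
    case False
    from maximal_left_ideal_vimage[OF M r False] a show ?thesis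
      unfolding jacobson_radical_def by blast
  qed
  then show "a \<otimes> r \<in> jacobson_radical R" using ac r unfolding jacobson_radical_def by blast
qed

text \<open>Used to show that an automorphism in the radical would make the quotient ring
  trivial.\<close>

lemma jacobson_radical_left_invertible:
  assumes "x \<in> jacobson_radical R" "y \<in> carrier R" "y \<otimes> x = \<one>"
  shows "jacobson_radical R = carrier R"
  using left_idealD(4)[OF jacobson_radical_left_ideal assms(2,1)] assms(3)
    left_ideal_one[OF jacobson_radical_left_ideal] by simp

end

section \<open>Transport of ideals, radicals and quotients along ring isomorphisms\<close>

lemma ring_iso_left_ideal_image:
  assumes R: "ring R" and S: "ring S" and c: "c \<in> ring_iso R S" and I: "left_ideal R I"
  shows "left_ideal S (c ` I)"
proof -
  interpret R: ring R by (rule R)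
  interpret S: ring S by (rule S)
  have h: "c \<in> ring_hom R S" and b: "bij_betw c (carrier R) (carrier S)"
    using c unfolding ring_iso_def by auto
  interpret h: ring_hom_ring R S c by (rule ring_hom_ringI2[OF R S h])
  note I' = R.left_idealD[OF I]
  show ?thesis
  proof (rule S.left_idealI)
    show "c ` I \<subseteq> carrier S" using I'(1) by auto
    show "\<zero>\<^bsub>S\<^esub> \<in> c ` I" using I'(2) h.hom_zero by force
    fix x y assume "x \<in> c ` I" "y \<in> c ` I"
    then obtain a b where ab: "a \<in> I" "b \<in> I" "x = c a" "y = c b" by blast
    then have "a \<in> carrier R" "b \<in> carrier R" using I'(1) by auto
    then have "x \<oplus>\<^bsub>S\<^esub> y = c (a \<oplus>\<^bsub>R\<^esub> b)" using ring_iso_memE(3)[OF c] ab by simp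
    then show "x \<oplus>\<^bsub>S\<^esub> y \<in> c ` I" using I'(3) ab by blast
  next
    fix r x assume "r \<in> carrier S" "x \<in> c ` I"
    then obtain s a where ab: "s \<in> carrier R" "a \<in> I" "r = c s" "x = c a"
      using b unfolding bij_betw_def by blast
    then have "a \<in> carrier R" using I'(1) by auto
    then have "r \<otimes>\<^bsub>S\<^esub> x = c (s \<otimes>\<^bsub>R\<^esub> a)" using ring_iso_memE(2)[OF c] ab by simp
    then show "r \<otimes>\<^bsub>S\<^esub> x \<in> c ` I" using I'(4) ab by blast
  qed
qed

lemma ring_iso_maximal_left_ideal_image:
  assumes R: "ring R" and S: "ring S" and c: "c \<in> ring_iso R S" and M: "maximal_left_ideal R M"
  shows "maximal_left_ideal S (c ` M)"
proof -
  have lM: "left_ideal R M" and nM: "M \<noteq> carrier R"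
    and max: "\<And>I. left_ideal R I \<Longrightarrow> M \<subseteq> I \<Longrightarrow> I = M \<or> I = carrier R"
    using M unfolding maximal_left_ideal_def by blast+
  have b: "bij_betw c (carrier R) (carrier S)" using c unfolding ring_iso_def by auto
  then have inj: "inj_on c (carrier R)" and im: "c ` carrier R = carrier S"
    unfolding bij_betw_def by auto
  have sub: "M \<subseteq> carrier R" by (rule ring.left_idealD(1)[OF R lM])
  let ?d = "inv_into (carrier R) c"
  have d: "?d \<in> ring_iso S R" by (rule ring_iso_set_sym[OF R c])
  have "c ` M \<noteq> carrier S"
    using nM im inj_on_image_eq_iff[OF inj sub order_refl] by auto
  moreover have "I = c ` M \<or> I = carrier S" if I: "left_ideal S I" "c ` M \<subseteq> I" for I
  proof -
    have "I \<subseteq> carrier S" by (rule ring.left_idealD(1)[OF S I(1)])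
    then have cd: "c ` ?d ` I = I" using im by (intro image_inv_into_cancel) auto
    have "?d ` c ` M \<subseteq> ?d ` I" using I(2) by (rule image_mono)
    moreover have "?d ` c ` M = M" using inj sub by (rule inv_into_image_cancel)
    ultimately have "?d ` I = M \<or> ?d ` I = carrier R"
      using max[OF ring_iso_left_ideal_image[OF S R d I(1)]] by simp
    then show ?thesis using cd im by metis
  qed
  ultimately show ?thesis
    using ring_iso_left_ideal_image[OF R S c lM] unfolding maximal_left_ideal_def by blast
qed

lemma ring_iso_jacobson_radical_image:
  assumes R: "ring R" and S: "ring S" and c: "c \<in> ring_iso R S"
  shows "c ` jacobson_radical R = jacobson_radical S"
proof -
  \<comment> \<open>Stated for arbitrary rings because the reverse inclusion is the same fact for
    the inverse isomorphism.\<close>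
  have sub: "c ` jacobson_radical R \<subseteq> jacobson_radical S"
    if R: "ring R" and S: "ring S" and c: "c \<in> ring_iso R S"
    for R :: "('x, 'y) ring_scheme" and S :: "('z, 'w) ring_scheme" and c
  proof
    fix y assume "y \<in> c ` jacobson_radical R"
    then obtain x where x: "x \<in> jacobson_radical R" "y = c x" by blast
    have b: "bij_betw c (carrier R) (carrier S)" using c unfolding ring_iso_def by auto
    then have im: "c ` carrier R = carrier S" unfolding bij_betw_def by auto
    let ?d = "inv_into (carrier R) c"
    have d: "?d \<in> ring_iso S R" by (rule ring_iso_set_sym[OF R c])
    have xR: "x \<in> carrier R" using x(1) unfolding jacobson_radical_def by blast
    have "y \<in> M" if M: "maximal_left_ideal S M" for M
    proof -
      have "maximal_left_ideal R (?d ` M)" by (rule ring_iso_maximal_left_ideal_image[OF S R d M])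
      then have "x \<in> ?d ` M" using x(1) unfolding jacobson_radical_def by blast
      then obtain m where m: "m \<in> M" "x = ?d m" by blast
      have "M \<subseteq> carrier S"
        using M ring.left_idealD(1)[OF S] unfolding maximal_left_ideal_def by blast
      then have "m \<in> c ` carrier R" using m(1) im by blast
      then have "c x = m" using m(2) by (simp add: f_inv_into_f)
      then show ?thesis using m(1) x(2) by simp
    qed
    then show "y \<in> jacobson_radical S"
      using x(2) xR im unfolding jacobson_radical_def by blast
  qed
  have b: "bij_betw c (carrier R) (carrier S)" using c unfolding ring_iso_def by auto
  then have im: "c ` carrier R = carrier S" unfolding bij_betw_def by auto
  let ?d = "inv_into (carrier R) c"
  have "?d ` jacobson_radical S \<subseteq> jacobson_radical R"
    by (rule sub[OF S R ring_iso_set_sym[OF R c]])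
  then have "c ` ?d ` jacobson_radical S \<subseteq> c ` jacobson_radical R" by (rule image_mono)
  moreover have "c ` ?d ` jacobson_radical S = jacobson_radical S"
    using im by (intro image_inv_into_cancel) (auto simp: jacobson_radical_def)
  ultimately show ?thesis using sub[OF R S c] by blast
qed

lemma ring_iso_coset_image:
  assumes c: "c \<in> ring_iso R S" and I: "I \<subseteq> carrier R" and x: "x \<in> carrier R"
  shows "c ` (I +>\<^bsub>R\<^esub> x) = c ` I +>\<^bsub>S\<^esub> c x"
proof -
  have "c (i \<oplus>\<^bsub>R\<^esub> x) = c i \<oplus>\<^bsub>S\<^esub> c x" if "i \<in> I" for i
    using ring_iso_memE(3)[OF c] that I x by blast
  then show ?thesis unfolding a_r_coset_def' by (simp add: image_UN)
qed

text \<open>An isomorphism maps cosets of \<open>I\<close> onto cosets of \<open>J\<close>, so the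
  induced map of quotients is just the image map on sets.\<close>

lemma ring_iso_Quot:
  assumes R: "ring R" and S: "ring S" and c: "c \<in> ring_iso R S"
    and I: "ideal I R" and J: "ideal J S" and IJ: "c ` I = J"
  shows "(\<lambda>C. c ` C) \<in> ring_iso (R Quot I) (S Quot J)"
proof (rule ring_iso_memI)
  interpret I: ideal I R by (rule I)
  interpret J: ideal J S by (rule J)
  have b: "bij_betw c (carrier R) (carrier S)" using c unfolding ring_iso_def by auto
  then have inj: "inj_on c (carrier R)" and im: "c ` carrier R = carrier S"
    unfolding bij_betw_def by auto
  note co = ring_iso_coset_image[OF c I.a_subset, unfolded IJ]
  have cR: "carrier (R Quot I) = (\<lambda>x. I +>\<^bsub>R\<^esub> x) ` carrier R"
    unfolding FactRing_def A_RCOSETS_def' by auto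
  have cS: "carrier (S Quot J) = (\<lambda>x. J +>\<^bsub>S\<^esub> x) ` carrier S"
    unfolding FactRing_def A_RCOSETS_def' by auto
  show "c ` C \<in> carrier (S Quot J)" if "C \<in> carrier (R Quot I)" for C
    using that co ring_iso_memE(1)[OF c] unfolding cR cS by auto
  fix C D assume C: "C \<in> carrier (R Quot I)" and D: "D \<in> carrier (R Quot I)"
  obtain x where x: "x \<in> carrier R" "C = I +>\<^bsub>R\<^esub> x" using C unfolding cR by blast
  obtain y where y: "y \<in> carrier R" "D = I +>\<^bsub>R\<^esub> y" using D unfolding cR by blast
  have cx: "c x \<in> carrier S" "c y \<in> carrier S" using x y ring_iso_memE(1)[OF c] by auto
  show "c ` (C \<otimes>\<^bsub>R Quot I\<^esub> D) = c ` C \<otimes>\<^bsub>S Quot J\<^esub> c ` D"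
    using x y cx co I.rcoset_mult_add J.rcoset_mult_add ring_iso_memE(2)[OF c]
    by (simp add: FactRing_def)
  show "c ` (C \<oplus>\<^bsub>R Quot I\<^esub> D) = c ` C \<oplus>\<^bsub>S Quot J\<^esub> c ` D"
    using x y cx co I.a_rcos_sum J.a_rcos_sum ring_iso_memE(3)[OF c]
    by (simp add: FactRing_def)
next
  interpret I: ideal I R by (rule I)
  note co = ring_iso_coset_image[OF c I.a_subset, unfolded IJ]
  show "c ` \<one>\<^bsub>R Quot I\<^esub> = \<one>\<^bsub>S Quot J\<^esub>"
    using co ring_iso_memE(4)[OF c] by (simp add: FactRing_def)
  have b: "bij_betw c (carrier R) (carrier S)" using c unfolding ring_iso_def by auto
  then have inj: "inj_on c (carrier R)" and im: "c ` carrier R = carrier S"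
    unfolding bij_betw_def by auto
  have cR: "carrier (R Quot I) = (\<lambda>x. I +>\<^bsub>R\<^esub> x) ` carrier R"
    unfolding FactRing_def A_RCOSETS_def' by auto
  have cS: "carrier (S Quot J) = (\<lambda>x. J +>\<^bsub>S\<^esub> x) ` carrier S"
    unfolding FactRing_def A_RCOSETS_def' by auto
  have sub: "C \<subseteq> carrier R" if "C \<in> carrier (R Quot I)" for C
    using that I.a_r_coset_subset_G[OF I.a_subset] unfolding cR by auto
  show "bij_betw (\<lambda>C. c ` C) (carrier (R Quot I)) (carrier (S Quot J))"
    unfolding bij_betw_def
  proof
    show "inj_on (\<lambda>C. c ` C) (carrier (R Quot I))"
      by (rule inj_onI) (use inj_on_image_eq_iff[OF inj sub sub] in blast)
    show "(\<lambda>C. c ` C) ` carrier (R Quot I) = carrier (S Quot J)"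
      unfolding cR cS im[symmetric] image_image using co by (intro image_cong) auto
  qed
qed

section \<open>Endomorphism rings of subrepresentations\<close>

lemma End_ring_carrier: "f \<in> carrier (End_ring A U) \<longleftrightarrow> f \<in> rep_hom A U A U"
  unfolding End_ring_def by simp

lemma End_ring_restrict:
  assumes U: "subrep A U" and f: "rep_map A U A U f" and g: "rep_map A U A U g"
  shows "restrict f U \<in> carrier (End_ring A U)"
    and "restrict f U \<otimes>\<^bsub>End_ring A U\<^esub> restrict g U = restrict (\<lambda>x. f (g x)) U"
    and "restrict f U \<oplus>\<^bsub>End_ring A U\<^esub> restrict g U = restrict (\<lambda>x. f x + g x) U"
  using rep_map_restrict[OF U f] rep_mapD(2)[OF g] rep_mapD(2)[OF f]
  unfolding End_ring_def compose_def by (auto intro!: restrict_ext)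

text \<open>Representing ring elements by globally linear maps reduces the ring laws to pointwise
  identities.\<close>

lemma End_ring_cases:
  assumes U: "subrep A U" and "x \<in> carrier (End_ring A U)"
  obtains f where "rep_map A U A U f" "x = restrict f U"
  using rep_hom_extend[OF U] assms(2) unfolding End_ring_carrier by metis

lemma ring_End_ring:
  assumes A: "linear_action A" and U: "subrep A U"
  shows "ring (End_ring A U)"
proof -
  let ?E = "End_ring A U"
  note R = End_ring_restrict[OF U] and cs = End_ring_cases[OF U]
  note c = rep_map_compose[of A U A U _ A U] and a = rep_map_add[OF A subrepD(1)[OF U]]
  have z: "rep_map A U A U (\<lambda>x. 0)"
    using rep_map_scale[OF A subrepD(1)[OF U] rep_map_id, of 0] by simp
  have zE: "\<zero>\<^bsub>?E\<^esub> = restrict (\<lambda>x. 0) U" and oE: "\<one>\<^bsub>?E\<^esub> = restrict (\<lambda>x. x) U"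
    unfolding End_ring_def by simp_all
  show ?thesis
  proof (rule ringI)
    show "abelian_group ?E"
    proof (rule abelian_groupI)
      fix x y assume "x \<in> carrier ?E" "y \<in> carrier ?E"
      then obtain f g where fg: "rep_map A U A U f" "x = restrict f U" "rep_map A U A U g" "y = restrict g U"
        by (meson cs)
      show "x \<oplus>\<^bsub>?E\<^esub> y \<in> carrier ?E" "x \<oplus>\<^bsub>?E\<^esub> y = y \<oplus>\<^bsub>?E\<^esub> x"
        unfolding fg R(3)[OF fg(1,3)] R(3)[OF fg(3,1)]
        using R(1)[OF a[OF fg(1,3)] z] by (simp_all add: add.commute)
    next
      show "\<zero>\<^bsub>?E\<^esub> \<in> carrier ?E" unfolding zE by (rule R(1)[OF z z])
    next
      fix x y w assume "x \<in> carrier ?E" "y \<in> carrier ?E" "w \<in> carrier ?E"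
      then obtain f g h where f: "rep_map A U A U f" "x = restrict f U"
        and g: "rep_map A U A U g" "y = restrict g U"
        and h: "rep_map A U A U h" "w = restrict h U"
        by (meson cs)
      show "x \<oplus>\<^bsub>?E\<^esub> y \<oplus>\<^bsub>?E\<^esub> w = x \<oplus>\<^bsub>?E\<^esub> (y \<oplus>\<^bsub>?E\<^esub> w)"
        unfolding f(2) g(2) h(2) R(3)[OF f(1) g(1)] R(3)[OF g(1) h(1)]
          R(3)[OF a[OF f(1) g(1)] h(1)] R(3)[OF f(1) a[OF g(1) h(1)]]
        by (simp add: add.assoc)
    next
      fix x assume "x \<in> carrier ?E"
      then obtain f where f: "rep_map A U A U f" "x = restrict f U" by (meson cs)
      show "\<zero>\<^bsub>?E\<^esub> \<oplus>\<^bsub>?E\<^esub> x = x"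
        unfolding f(2) zE R(3)[OF z f(1)] by simp
      have n: "rep_map A U A U (\<lambda>x. (-1) *\<^sub>R f x)"
        by (rule rep_map_scale[OF A subrepD(1)[OF U] f(1)])
      have "restrict (\<lambda>x. (-1) *\<^sub>R f x) U \<oplus>\<^bsub>?E\<^esub> x = \<zero>\<^bsub>?E\<^esub>"
        unfolding f(2) zE R(3)[OF n f(1)] by simp
      then show "\<exists>y\<in>carrier ?E. y \<oplus>\<^bsub>?E\<^esub> x = \<zero>\<^bsub>?E\<^esub>" using R(1)[OF n z] by blast
    qed
    show "Group.monoid ?E"
    proof (rule monoidI)
      fix x y assume "x \<in> carrier ?E" "y \<in> carrier ?E"
      then obtain f g where fg: "rep_map A U A U f" "x = restrict f U" "rep_map A U A U g" "y = restrict g U"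
        by (meson cs)
      show "x \<otimes>\<^bsub>?E\<^esub> y \<in> carrier ?E"
        unfolding fg R(2)[OF fg(1,3)] by (rule R(1)[OF c[OF fg(3,1)] z])
    next
      show "\<one>\<^bsub>?E\<^esub> \<in> carrier ?E" unfolding oE by (rule R(1)[OF rep_map_id z])
    next
      fix x y w assume "x \<in> carrier ?E" "y \<in> carrier ?E" "w \<in> carrier ?E"
      then obtain f g h where f: "rep_map A U A U f" "x = restrict f U"
        and g: "rep_map A U A U g" "y = restrict g U"
        and h: "rep_map A U A U h" "w = restrict h U"
        by (meson cs)
      show "x \<otimes>\<^bsub>?E\<^esub> y \<otimes>\<^bsub>?E\<^esub> w = x \<otimes>\<^bsub>?E\<^esub> (y \<otimes>\<^bsub>?E\<^esub> w)"
        unfolding f(2) g(2) h(2) R(2)[OF f(1) g(1)] R(2)[OF g(1) h(1)]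
          R(2)[OF c[OF g(1) f(1)] h(1)] R(2)[OF f(1) c[OF h(1) g(1)]] ..
    next
      fix x assume "x \<in> carrier ?E"
      then obtain f where f: "rep_map A U A U f" "x = restrict f U" by (meson cs)
      show "\<one>\<^bsub>?E\<^esub> \<otimes>\<^bsub>?E\<^esub> x = x" "x \<otimes>\<^bsub>?E\<^esub> \<one>\<^bsub>?E\<^esub> = x"
        unfolding f(2) oE R(2)[OF rep_map_id f(1)] R(2)[OF f(1) rep_map_id] by simp_all
    qed
    fix x y w assume "x \<in> carrier ?E" "y \<in> carrier ?E" "w \<in> carrier ?E"
    then obtain f g h where f: "rep_map A U A U f" "x = restrict f U"
      and g: "rep_map A U A U g" "y = restrict g U"
      and h: "rep_map A U A U h" "w = restrict h U"
      by (meson cs)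
    show "(x \<oplus>\<^bsub>?E\<^esub> y) \<otimes>\<^bsub>?E\<^esub> w = x \<otimes>\<^bsub>?E\<^esub> w \<oplus>\<^bsub>?E\<^esub> y \<otimes>\<^bsub>?E\<^esub> w"
      unfolding f(2) g(2) h(2) R(2)[OF f(1) h(1)] R(2)[OF g(1) h(1)] R(3)[OF f(1) g(1)]
        R(2)[OF a[OF f(1) g(1)] h(1)] R(3)[OF c[OF h(1) f(1)] c[OF h(1) g(1)]] ..
    show "w \<otimes>\<^bsub>?E\<^esub> (x \<oplus>\<^bsub>?E\<^esub> y) = w \<otimes>\<^bsub>?E\<^esub> x \<oplus>\<^bsub>?E\<^esub> w \<otimes>\<^bsub>?E\<^esub> y"
      unfolding f(2) g(2) h(2) R(2)[OF h(1) f(1)] R(2)[OF h(1) g(1)] R(3)[OF f(1) g(1)]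
        R(2)[OF h(1) a[OF f(1) g(1)]] R(3)[OF c[OF f(1) h(1)] c[OF g(1) h(1)]]
      by (simp add: linear_add[OF rep_mapD(1)[OF h(1)]])
  qed
qed

lemma End_ring_conjugation:
  assumes A: "linear_action A" and B: "linear_action B"
    and U: "subrep A U" and W: "subrep B W"
    and f: "rep_map A U B W f" and g: "rep_map B W A U g"
    and gf: "\<And>x. x \<in> U \<Longrightarrow> g (f x) = x" and fg: "\<And>y. y \<in> W \<Longrightarrow> f (g y) = y"
  shows "(\<lambda>h. restrict (\<lambda>x. g (h (f x))) U) \<in> ring_iso (End_ring B W) (End_ring A U)"
    (is "?c \<in> ring_iso ?S ?R")
proof (rule ring_iso_memI)
  note fW = rep_mapD(2)[OF f] and gU = rep_mapD(2)[OF g]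
  note RU = End_ring_restrict[OF U] and RW = End_ring_restrict[OF W]
  have conj: "rep_map A U A U (\<lambda>x. g (h (f x)))" if "rep_map B W B W h" for h
    using rep_map_compose[OF f rep_map_compose[OF that g]] .
  have cr: "?c (restrict h W) = restrict (\<lambda>x. g (h (f x))) U" for h
    using fW by (auto intro!: restrict_ext)
  show "?c x \<in> carrier ?R" if x: "x \<in> carrier ?S" for x
  proof -
    obtain h where h: "rep_map B W B W h" "x = restrict h W" using End_ring_cases[OF W x] .
    show ?thesis unfolding h(2) cr by (rule RU(1)[OF conj[OF h(1)] conj[OF h(1)]])
  qed
  fix x y assume x: "x \<in> carrier ?S" and y: "y \<in> carrier ?S"
  obtain h where h: "rep_map B W B W h" "x = restrict h W" using End_ring_cases[OF W x] .
  obtain k where k: "rep_map B W B W k" "y = restrict k W" using End_ring_cases[OF W y] .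
  show "?c (x \<otimes>\<^bsub>?S\<^esub> y) = ?c x \<otimes>\<^bsub>?R\<^esub> ?c y"
    unfolding h(2) k(2) RW(2)[OF h(1) k(1)] cr RU(2)[OF conj[OF h(1)] conj[OF k(1)]]
    using fg fW rep_mapD(2)[OF k(1)] by (auto intro!: restrict_ext)
  show "?c (x \<oplus>\<^bsub>?S\<^esub> y) = ?c x \<oplus>\<^bsub>?R\<^esub> ?c y"
    unfolding h(2) k(2) RW(3)[OF h(1) k(1)] cr RU(3)[OF conj[OF h(1)] conj[OF k(1)]]
    by (simp add: linear_add[OF rep_mapD(1)[OF g]])
next
  note fW = rep_mapD(2)[OF f] and gU = rep_mapD(2)[OF g]
  show "?c \<one>\<^bsub>?S\<^esub> = \<one>\<^bsub>?R\<^esub>"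
    unfolding End_ring_def using fW gf by (auto intro!: restrict_ext)
  have c1: "?c h \<in> carrier ?R" if x: "h \<in> carrier ?S" for h
  proof -
    obtain k where k: "rep_map B W B W k" "h = restrict k W" using End_ring_cases[OF W x] .
    have e: "?c h = restrict (\<lambda>x. g (k (f x))) U"
      unfolding k(2) using fW by (auto intro!: restrict_ext)
    have m: "rep_map A U A U (\<lambda>x. g (k (f x)))"
      using rep_map_compose[OF f rep_map_compose[OF k(1) g]] .
    show ?thesis unfolding e by (rule End_ring_restrict(1)[OF U m m])
  qed
  let ?d = "\<lambda>h. restrict (\<lambda>x. f (h (g x))) W"
  have d1: "?d h \<in> carrier ?S" if x: "h \<in> carrier ?R" for h
  proof -
    obtain k where k: "rep_map A U A U k" "h = restrict k U" using End_ring_cases[OF U x] .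
    have e: "?d h = restrict (\<lambda>x. f (k (g x))) W"
      unfolding k(2) using gU by (auto intro!: restrict_ext)
    have m: "rep_map B W B W (\<lambda>x. f (k (g x)))"
      using rep_map_compose[OF g rep_map_compose[OF k(1) f]] .
    show ?thesis unfolding e by (rule End_ring_restrict(1)[OF W m m])
  qed
  show "bij_betw ?c (carrier ?S) (carrier ?R)"
  proof (rule bij_betw_byWitness[of _ ?d])
    show "\<forall>h\<in>carrier ?S. ?d (?c h) = h"
    proof
      fix h assume x: "h \<in> carrier ?S"
      obtain k where k: "rep_map B W B W k" "h = restrict k W" using End_ring_cases[OF W x] .
      show "?d (?c h) = h"
        unfolding k(2) using fW gU fg rep_mapD(2)[OF k(1)] by (auto intro!: restrict_ext)
    qed
    show "\<forall>h\<in>carrier ?R. ?c (?d h) = h"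
    proof
      fix h assume x: "h \<in> carrier ?R"
      obtain k where k: "rep_map A U A U k" "h = restrict k U" using End_ring_cases[OF U x] .
      show "?c (?d h) = h"
        unfolding k(2) using fW gU gf rep_mapD(2)[OF k(1)] by (auto intro!: restrict_ext)
    qed
  qed (use c1 d1 in auto)
qed

text \<open>Conjugation runs from \<open>End_ring B W\<close> to \<open>End_ring A U\<close>, so
  that on quotients it can be followed by the given isomorphism onto \<open>K\<close>. It takes
  scalars to scalars because \<open>g\<close> is linear, which keeps the embedding
  \<open>\<iota>\<close> intact.\<close>

lemma has_type_rep_iso:
  assumes A: "linear_action A" and B: "linear_action B"
    and U: "subrep A U" and W: "subrep B W" and iso: "rep_iso A U B W" and t: "has_type A U K \<iota>"
  shows "has_type B W K \<iota>"
proof -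
  obtain f where f: "rep_map A U B W f" "bij_betw f U W" using iso rep_iso_iff[OF U] by blast
  obtain g where g: "rep_map B W A U g" "bij_betw g W U"
    and gf: "\<And>x. x \<in> U \<Longrightarrow> g (f x) = x" and fg: "\<And>y. y \<in> W \<Longrightarrow> f (g y) = y"
    by (rule rep_map_inverse[OF U f]) auto
  let ?R = "End_ring A U" and ?S = "End_ring B W"
  note R = ring_End_ring[OF A U] and S = ring_End_ring[OF B W]
  define c where "c = (\<lambda>h. restrict (\<lambda>x. g (h (f x))) U)"
  have c: "c \<in> ring_iso ?S ?R"
    unfolding c_def by (rule End_ring_conjugation[OF A B U W f(1) g(1) gf fg])
  let ?I = "jacobson_radical ?S" and ?J = "jacobson_radical ?R"
  have IJ: "c ` ?I = ?J" by (rule ring_iso_jacobson_radical_image[OF S R c])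
  obtain h where h: "h \<in> ring_iso (?R Quot ?J) K"
    and h\<iota>: "\<And>a. h (?J +>\<^bsub>?R\<^esub> (\<lambda>x\<in>U. a *\<^sub>R x)) = \<iota> a"
    using t unfolding has_type_def by blast
  have q: "(\<lambda>C. c ` C) \<in> ring_iso (?S Quot ?I) (?R Quot ?J)"
    by (rule ring_iso_Quot[OF S R c ring.jacobson_radical_ideal[OF S] ring.jacobson_radical_ideal[OF R] IJ])
  have "h \<circ> (\<lambda>C. c ` C) \<in> ring_iso (?S Quot ?I) K"
    by (rule ring_iso_set_trans[OF q h])
  moreover have "(h \<circ> (\<lambda>C. c ` C)) (?I +>\<^bsub>?S\<^esub> (\<lambda>x\<in>W. a *\<^sub>R x)) = \<iota> a" for a
  proof -
    have m: "rep_map B W B W (\<lambda>x. a *\<^sub>R x)"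
      by (rule rep_map_scale[OF B subrepD(1)[OF W] rep_map_id])
    have I: "?I \<subseteq> carrier ?S" unfolding jacobson_radical_def by blast
    have "c (\<lambda>x\<in>W. a *\<^sub>R x) = (\<lambda>x\<in>U. a *\<^sub>R x)"
      unfolding c_def using rep_mapD(2)[OF f(1)] gf
      by (auto intro!: restrict_ext simp: linear_scale[OF rep_mapD(1)[OF g(1)]])
    then show ?thesis
      using ring_iso_coset_image[OF c I End_ring_restrict(1)[OF W m m]] h\<iota> by (simp add: IJ)
  qed
  ultimately show ?thesis unfolding has_type_def by blast
qed


section \<open>Equivariant complex structures\<close>

text \<open>Lift \<open>z\<close> to an endomorphism \<open>f\<close>. Then
  \<open>N = f f + 1\<close> lies in the radical. Were \<open>N\<close> injective, it would be
  invertible, and the radical would be the whole ring. So \<open>fitting\<close> makes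
  \<open>N\<close> nilpotent; nilpotency of the radical as a whole is not established.\<close>

lemma has_type_sqrt_minus_one:
  fixes A :: "'s \<Rightarrow> 'a \<Rightarrow> 'a::euclidean_space"
  assumes A: "linear_action A" and U: "indecomposable A U" and t: "has_type A U K \<iota>"
    and z: "z \<in> carrier K" "z \<otimes>\<^bsub>K\<^esub> z = \<iota> (-1)" and \<iota>: "\<iota> 0 \<noteq> \<iota> 1"
  obtains f n where "rep_map A U A U f" "\<And>x. x \<in> U \<Longrightarrow> ((\<lambda>x. f (f x) + x) ^^ n) x = 0"
proof -
  note sU = indecomposableD(1)[OF U]
  let ?R = "End_ring A U" let ?J = "jacobson_radical ?R"
  note R = ring_End_ring[OF A sU]
  note J = ring.jacobson_radical_ideal[OF R]
  interpret J: ideal ?J ?R by (rule J)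
  note ER = End_ring_restrict[OF sU]
  note sc = rep_map_scale[OF A subrepD(1)[OF sU] rep_map_id]
  have scE: "(\<lambda>x\<in>U. c *\<^sub>R x) \<in> carrier ?R" for c by (rule ER(1)[OF sc sc])
  obtain h where h: "h \<in> ring_iso (?R Quot ?J) K"
    and h\<iota>: "\<And>a. h (?J +>\<^bsub>?R\<^esub> (\<lambda>x\<in>U. a *\<^sub>R x)) = \<iota> a"
    using t unfolding has_type_def by blast
  have b: "bij_betw h (carrier (?R Quot ?J)) (carrier K)" using ring_iso_memE(5)[OF h] .
  have cQ: "carrier (?R Quot ?J) = (\<lambda>x. ?J +>\<^bsub>?R\<^esub> x) ` carrier ?R"
    unfolding FactRing_def A_RCOSETS_def' by auto
  have "z \<in> h ` carrier (?R Quot ?J)" using z(1) b unfolding bij_betw_def by simp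
  then obtain x where x: "x \<in> carrier ?R" "h (?J +>\<^bsub>?R\<^esub> x) = z" unfolding cQ by blast
  have CQ: "?J +>\<^bsub>?R\<^esub> y \<in> carrier (?R Quot ?J)" if "y \<in> carrier ?R" for y
    using that unfolding cQ by blast
  obtain f where f: "rep_map A U A U f" "x = restrict f U" using End_ring_cases[OF sU x(1)] .
  have xx: "x \<otimes>\<^bsub>?R\<^esub> x \<in> carrier ?R" using x(1) by simp
  have "h (?J +>\<^bsub>?R\<^esub> (x \<otimes>\<^bsub>?R\<^esub> x)) = \<iota> (-1)"
    using ring_iso_memE(2)[OF h CQ[OF x(1)] CQ[OF x(1)]] J.rcoset_mult_add[OF x(1) x(1)] x(2) z(2)
    by (simp add: FactRing_def)
  then have "h (?J +>\<^bsub>?R\<^esub> (x \<otimes>\<^bsub>?R\<^esub> x)) = h (?J +>\<^bsub>?R\<^esub> (\<lambda>x\<in>U. (-1) *\<^sub>R x))"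
    using h\<iota>[of "-1"] by simp
  then have "?J +>\<^bsub>?R\<^esub> (x \<otimes>\<^bsub>?R\<^esub> x) = ?J +>\<^bsub>?R\<^esub> (\<lambda>x\<in>U. (-1) *\<^sub>R x)"
    using b CQ[OF xx] CQ[OF scE] unfolding bij_betw_def by (metis inj_onD)
  then have "x \<otimes>\<^bsub>?R\<^esub> x \<in> ?J +>\<^bsub>?R\<^esub> (\<lambda>x\<in>U. (-1) *\<^sub>R x)"
    using J.a_rcos_self[OF xx] by simp
  then obtain n where n: "n \<in> ?J" "x \<otimes>\<^bsub>?R\<^esub> x = n \<oplus>\<^bsub>?R\<^esub> (\<lambda>x\<in>U. (-1) *\<^sub>R x)"
    unfolding a_r_coset_def' by blast
  have "n \<in> carrier ?R" using n(1) J.a_subset by blast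
  then obtain g where g: "rep_map A U A U g" "n = restrict g U" using End_ring_cases[OF sU] by blast
  define N where "N = (\<lambda>x. f (f x) + x)"
  have N: "rep_map A U A U N"
    unfolding N_def by (rule rep_map_add[OF A subrepD(1)[OF sU] rep_map_compose[OF f(1) f(1)] rep_map_id])
  have gN: "g u = N u" if u: "u \<in> U" for u
  proof -
    have "restrict (\<lambda>x. f (f x)) U u = restrict (\<lambda>x. g x + (-1) *\<^sub>R x) U u"
      using n(2) unfolding f(2) g(2) ER(2)[OF f(1) f(1)] ER(3)[OF g(1) sc] by (rule fun_cong)
    then show ?thesis using u unfolding N_def by simp
  qed
  then have NJ: "restrict N U \<in> ?J" using n(1) unfolding g(2) by (metis restrict_ext)
  have "\<not> inj_on N U"
  proof
    assume inj: "inj_on N U"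
    have "bij_betw N U U"
      by (rule linear_inj_imp_bij_betw[OF rep_mapD(1)[OF N] subrepD(1)[OF sU] subrepD(1)[OF sU] _ inj])
        (use rep_mapD(2)[OF N] in auto)
    then obtain k where k: "rep_map A U A U k" "\<And>x. x \<in> U \<Longrightarrow> k (N x) = x"
      using rep_map_inverse[OF sU N] by metis
    have "restrict k U \<otimes>\<^bsub>?R\<^esub> restrict N U = \<one>\<^bsub>?R\<^esub>"
      unfolding ER(2)[OF k(1) N] using k(2) by (auto simp: End_ring_def intro!: restrict_ext)
    from ring.jacobson_radical_left_invertible[OF R NJ ER(1)[OF k(1) k(1)] this]
    have JR: "?J = carrier ?R" .
    \<comment> \<open>If the radical is everything, all scalars have the same coset, and
      \<open>h\<close> cannot separate \<open>\<iota> 0\<close> from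
      \<open>\<iota> 1\<close>.\<close>
    have co: "?J +>\<^bsub>?R\<^esub> (\<lambda>x\<in>U. c *\<^sub>R x) = ?J" for c
      by (rule J.a_coset_join2[OF scE]) (use J.a_subgroup scE JR in auto)
    show False using h\<iota>[of 0] h\<iota>[of 1] \<iota> unfolding co by simp
  qed
  then show ?thesis using fitting[OF A U N] that[OF f(1)] unfolding N_def by blast
qed

text \<open>If \<open>f\<^sup>2 = -1 + N\<close> with \<open>N\<close> nilpotent, then the square of \<open>f + f N / 2\<close> is
  \<open>-1 + (3 N\<^sup>2 + N\<^sup>3) / 4\<close>; iterating this Newton step kills the nilpotent error.\<close>

lemma complex_structure_lift:
  fixes A :: "'s \<Rightarrow> 'a \<Rightarrow> 'a::real_vector"
  assumes A: "linear_action A" and U: "subrep A U"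
    and "rep_map A U A U f" and "\<And>x. x \<in> U \<Longrightarrow> ((\<lambda>x. f (f x) + x) ^^ n) x = 0"
  shows "\<exists>J. rep_map A U A U J \<and> (\<forall>x\<in>U. J (J x) = - x)"
  using assms(3,4)
proof (induction n arbitrary: f rule: less_induct)
  case (less n)
  note f = less.prems(1) and nil = less.prems(2)
  define N where "N = (\<lambda>x. f (f x) + x)"
  note sU = subrepD(1)[OF U]
  have N: "rep_map A U A U N"
    unfolding N_def by (rule rep_map_add[OF A sU rep_map_compose[OF f f] rep_map_id])
  note fl = rep_mapD(1)[OF f] and Nl = rep_mapD(1)[OF N]
  show ?case
  proof (cases "n \<le> 1")
    case True
    have "f (f x) = - x" if "x \<in> U" for x
    proof -
      consider "n = 0" | "n = 1" using True by linarith
      then show ?thesis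
      proof cases
        case 1
        then have "x = 0" using nil[OF that] by simp
        then show ?thesis using linear_0[OF fl] by simp
      next
        case 2
        then have "f (f x) + x = 0" using nil[OF that] by simp
        then show ?thesis by (rule eq_neg_iff_add_eq_0[THEN iffD2])
      qed
    qed
    then show ?thesis using f by blast
  next
    case False
    define g where "g = (\<lambda>x. f x + (1/2) *\<^sub>R f (N x))"
    have g: "rep_map A U A U g"
      unfolding g_def
      by (rule rep_map_add[OF A sU f rep_map_scale[OF A sU rep_map_compose[OF N f]]])
    have ff: "f (f y) = N y - y" for y unfolding N_def by simp
    have Nf: "N (f x) = f (N x)" for x unfolding N_def by (simp add: linear_add[OF fl])
    \<comment> \<open>The cofactor of \<open>N^2\<close> in the new error:
      \<open>(3 N^2 + N^3) / 4 = N^2 M\<close>.\<close>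
    define M where "M = (\<lambda>x. (3/4) *\<^sub>R x + (1/4) *\<^sub>R N x)"
    have M: "rep_map A U A U M"
      unfolding M_def
      by (rule rep_map_add[OF A sU rep_map_scale[OF A sU rep_map_id] rep_map_scale[OF A sU N]])
    have step: "g (g x) + x = N (N (M x))" for x
    proof -
      have "g (g x) + x = N x + (1/2) *\<^sub>R f (f (N x)) + (1/2) *\<^sub>R f (f (N x))
          + (1/4) *\<^sub>R f (f (N (N x)))"
        unfolding g_def
        by (simp add: linear_add[OF fl] linear_scale[OF fl] linear_add[OF Nl] linear_scale[OF Nl] Nf
            scaleR_add_right ff)
      also have "\<dots> = (3/4) *\<^sub>R N (N x) + (1/4) *\<^sub>R N (N (N x))"
        unfolding ff by (simp add: scaleR_diff_right algebra_simps flip: scaleR_add_left)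
      also have "\<dots> = N (N (M x))"
        unfolding M_def by (simp add: linear_add[OF Nl] linear_scale[OF Nl])
      finally show ?thesis .
    qed
    have MN: "M ((N ^^ k) x) = (N ^^ k) (M x)" for k x
    proof (induction k)
      case (Suc k)
      have "M (N y) = N (M y)" for y
        unfolding M_def by (simp add: linear_add[OF Nl] linear_scale[OF Nl])
      with Suc show ?case by simp
    qed simp
    \<comment> \<open>One factor \<open>N^2\<close> per power of the new error; the accumulated
      cofactors \<open>M\<close> commute with \<open>N\<close> and are absorbed into
      \<open>v\<close>.\<close>
    have pow: "\<exists>v\<in>U. ((\<lambda>x. g (g x) + x) ^^ k) u = (N ^^ (2 * k)) v" if u: "u \<in> U" for k u
    proof (induction k)
      case 0
      then show ?case using u by auto
    next
      case (Suc k)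
      then obtain v where v: "v \<in> U" "((\<lambda>x. g (g x) + x) ^^ k) u = (N ^^ (2 * k)) v" by blast
      have "((\<lambda>x. g (g x) + x) ^^ Suc k) u = (N ^^ (2 * Suc k)) (M v)"
        using v(2) by (simp add: step MN)
      then show ?case using rep_mapD(2)[OF M v(1)] by blast
    qed
    \<comment> \<open>The exponent could be halved, but a decrease by one already feeds the
      induction, and \<open>2 (n - 1)\<close> is at least \<open>n\<close> because \<open>n\<close>
      is at least 2.\<close>
    have "((\<lambda>x. g (g x) + x) ^^ (n - 1)) u = 0" if u: "u \<in> U" for u
    proof -
      obtain v where v: "v \<in> U" "((\<lambda>x. g (g x) + x) ^^ (n - 1)) u = (N ^^ (2 * (n - 1))) v"
        using pow[OF u] by blast
      have "2 * (n - 1) = (n - 2) + n" using False by simp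
      then have "(N ^^ (2 * (n - 1))) v = (N ^^ (n - 2)) ((N ^^ n) v)"
        by (simp add: funpow_add)
      also have "(N ^^ n) v = 0" using nil[OF v(1)] unfolding N_def .
      also have "(N ^^ (n - 2)) 0 = 0"
        by (rule linear_0[OF rep_mapD(1)[OF rep_map_funpow[OF N]]])
      finally show ?thesis using v(2) by simp
    qed
    then show ?thesis using less.IH[of "n - 1" g] g False by simp
  qed
qed

text \<open>Both division algebras contain a square root of -1, namely their unit \<open>i\<close>.
  The real numbers do not, which is why a component of real type has to appear twice.\<close>

lemma complex_or_quaternionic_type_complex_structure:
  fixes A :: "'s \<Rightarrow> 'a \<Rightarrow> 'a::euclidean_space"
  assumes A: "linear_action A" and U: "indecomposable A U"
    and t: "complex_type A U \<or> quaternionic_type A U"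
  shows "\<exists>J. rep_map A U A U J \<and> (\<forall>x\<in>U. J (J x) = - x)"
  using t
proof
  assume "complex_type A U"
  then have "has_type A U (type_ring :: complex ring) complex_of_real" unfolding complex_type_def .
  then obtain f n where f: "rep_map A U A U f" "\<And>x. x \<in> U \<Longrightarrow> ((\<lambda>x. f (f x) + x) ^^ n) x = 0"
    by (rule has_type_sqrt_minus_one[OF A U, where z = \<i>]) (auto simp: type_ring_def)
  then show ?thesis by (rule complex_structure_lift[OF A indecomposableD(1)[OF U]])
next
  assume "quaternionic_type A U"
  then have "has_type A U quaternion_ring (\<lambda>c. (c, 0, 0, 0))" unfolding quaternionic_type_def .
  then obtain f n where f: "rep_map A U A U f" "\<And>x. x \<in> U \<Longrightarrow> ((\<lambda>x. f (f x) + x) ^^ n) x = 0"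
    by (rule has_type_sqrt_minus_one[OF A U, where z = "(0, 1, 0, 0)"]) (auto simp: quaternion_ring_def)
  then show ?thesis by (rule complex_structure_lift[OF A indecomposableD(1)[OF U]])
qed

lemma real_type_rep_iso:
  assumes "linear_action A" "linear_action B" "subrep A U" "subrep B W" "rep_iso A U B W" "real_type A U"
  shows "real_type B W"
  using has_type_rep_iso[OF assms(1-5)] assms(6) unfolding real_type_def by blast

lemma complex_or_quaternionic_type_rep_iso:
  assumes "linear_action A" "linear_action B" "subrep A U" "subrep B W" "rep_iso A U B W"
    "complex_type A U \<or> quaternionic_type A U"
  shows "complex_type B W \<or> quaternionic_type B W"
  using assms(6) unfolding complex_type_def quaternionic_type_def
  by (elim disj_forward) (rule has_type_rep_iso[OF assms(1-5)], assumption)+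


section \<open>Equivalence of reduced problems\<close>

lemma Ck_on_const: "Ck_on k S (\<lambda>x. c)"
proof (induction k arbitrary: c)
  case (Suc k)
  have "\<forall>x\<in>S. ((\<lambda>x. c) has_derivative (\<lambda>h. 0)) (at x within S)" by simp
  with Suc.IH show ?case unfolding Ck_on.simps by (intro exI[of _ "\<lambda>x h. 0"]) simp
qed simp

lemma Ck_on_bounded_linear:
  assumes "bounded_linear f"
  shows "Ck_on k S f"
proof (cases k)
  case 0
  then show ?thesis using linear_continuous_on[OF assms] by simp
next
  case (Suc m)
  have "\<forall>x\<in>S. (f has_derivative f) (at x within S)"
    using bounded_linear_imp_has_derivative[OF assms] by blast
  then show ?thesis unfolding Suc Ck_on.simps by (intro exI[of _ "\<lambda>x. f"]) (simp add: Ck_on_const)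
qed

text \<open>Conjugated problems are extensional functions, so smoothness is first shown for an
  unrestricted formula and then carried over.\<close>

lemma Ck_on_cong:
  assumes "Ck_on k S f" "\<And>x. x \<in> S \<Longrightarrow> g x = f x"
  shows "Ck_on k S g"
proof (cases k)
  case 0
  then show ?thesis using assms continuous_on_cong[OF refl, of S g f] by simp
next
  case (Suc m)
  obtain f' where f': "\<forall>x\<in>S. (f has_derivative f' x) (at x within S)"
    "\<forall>h\<in>S. Ck_on m S (\<lambda>x. f' x h)"
    using assms(1) unfolding Suc Ck_on.simps by blast
  have "\<forall>x\<in>S. (g has_derivative f' x) (at x within S)"
    using f'(1) has_derivative_transform[of _ S g f] assms(2) by blast
  with f'(2) show ?thesis unfolding Suc Ck_on.simps by blast
qed

text \<open>The derivative of the composite in direction \<open>h\<close> is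
  \<open>M (f' (L x) (L h))\<close>, again a composite with \<open>L\<close> and \<open>M\<close>.
  The induction therefore closes without a general chain rule; \<open>L h\<close> is an admissible
  direction because \<open>L\<close> maps \<open>T\<close> into \<open>S\<close>.\<close>

lemma Ck_on_linear_compose:
  assumes L: "bounded_linear L" and M: "bounded_linear M" and LS: "\<And>x. x \<in> T \<Longrightarrow> L x \<in> S"
    and "Ck_on k S f"
  shows "Ck_on k T (\<lambda>x. M (f (L x)))"
  using assms(4)
proof (induction k arbitrary: f)
  case 0
  then have "continuous_on S f" by simp
  then have "continuous_on T (\<lambda>x. f (L x))"
    using LS by (intro continuous_on_compose2[of S f T L] linear_continuous_on[OF L]) auto
  then show ?case
    using continuous_on_compose2[OF linear_continuous_on[OF M, of UNIV]] by simp
next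
  case (Suc k)
  obtain f' where f': "\<forall>x\<in>S. (f has_derivative f' x) (at x within S)"
    "\<forall>h\<in>S. Ck_on k S (\<lambda>x. f' x h)"
    using Suc.prems unfolding Ck_on.simps by blast
  have "((\<lambda>x. M (f (L x))) has_derivative (\<lambda>h. M (f' (L x) (L h)))) (at x within T)"
    if x: "x \<in> T" for x
  proof (rule bounded_linear.has_derivative[OF M])
    have "(f has_derivative f' (L x)) (at (L x) within L ` T)"
      by (rule has_derivative_subset[OF f'(1)[rule_format, OF LS[OF x]]]) (use LS in blast)
    then show "((\<lambda>x. f (L x)) has_derivative (\<lambda>h. f' (L x) (L h))) (at x within T)"
      by (rule has_derivative_in_compose[OF bounded_linear_imp_has_derivative[OF L]])
  qed
  moreover have "Ck_on k T (\<lambda>x. M (f' (L x) (L h)))" if "h \<in> T" for h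
    by (rule Suc.IH[of "\<lambda>x. f' x (L h)"]) (rule f'(2)[rule_format, OF LS[OF that]])
  ultimately show ?case
    unfolding Ck_on.simps by (intro exI[of _ "\<lambda>x h. M (f' (L x) (L h))"] conjI ballI)
qed

text \<open>Choose a linear \<open>q\<close> whose kernel is \<open>X\<close>. Along the line
  through \<open>x\<close> the function \<open>q h\<close> vanishes identically, so its derivative
  \<open>q (L x)\<close> is 0.\<close>

lemma derivative_maps_subspace:
  fixes h :: "'a::euclidean_space \<Rightarrow> 'a"
  assumes X: "subspace X" and h: "\<And>x. x \<in> X \<Longrightarrow> h x \<in> X"
    and L: "(h has_derivative L) (at 0 within X)" and x: "x \<in> X"
  shows "L x \<in> X"
proof -
  obtain p where p: "range p \<subseteq> X" "linear p" "\<And>v. v \<in> X \<Longrightarrow> p v = v"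
    using linear_exists_left_inverse_on[OF linear_ident X inj_on_id2] by blast
  define q where "q = (\<lambda>v. v - p v)"
  have "linear q" unfolding q_def using p(2) by (intro linear_compose_sub linear_ident)
  then have q: "bounded_linear q" by (simp add: linear_conv_bounded_linear)
  have sc: "((\<lambda>t. t *\<^sub>R x) has_derivative (\<lambda>t. t *\<^sub>R x)) (at (0::real))"
    by (intro bounded_linear_imp_has_derivative bounded_linear_scaleR_left)
  have "range (\<lambda>t. t *\<^sub>R x) \<subseteq> X" using subspace_scale[OF X x] by blast
  then have "(h has_derivative L) (at (0 *\<^sub>R x) within range (\<lambda>t. t *\<^sub>R x))"
    unfolding scaleR_zero_left by (rule has_derivative_subset[OF L])
  from bounded_linear.has_derivative[OF q has_derivative_in_compose[OF sc this]]
  have "((\<lambda>t. q (h (t *\<^sub>R x))) has_derivative (\<lambda>t. q (L (t *\<^sub>R x)))) (at (0::real))" .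
  moreover have "q (h (t *\<^sub>R x)) = 0" for t
    unfolding q_def using h[OF subspace_scale[OF X x]] p(3) by simp
  ultimately have "((\<lambda>t. 0) has_derivative (\<lambda>t. q (L (t *\<^sub>R x)))) (at (0::real))" by simp
  then have "(\<lambda>t. q (L (t *\<^sub>R x))) = (\<lambda>t. 0)"
    by (rule has_derivative_unique) simp
  then have "q (L (1 *\<^sub>R x)) = 0" by (rule fun_cong)
  then have "L x = p (L x)" unfolding q_def by simp
  then show ?thesis using p(1) by (metis rangeI subsetD)
qed

lemma map_prod_complex_scale:
  assumes "linear g"
  shows "map_prod g g (complex_scale \<mu> z) = complex_scale \<mu> (map_prod g g z)"
  unfolding complex_scale_def
  by (simp add: linear_add[OF assms] linear_diff[OF assms] linear_scale[OF assms] map_prod_def split_beta)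

text \<open>The linearization becomes \<open>f L g\<close>, and \<open>g\<close> carries its
  eigenvectors in \<open>Z\<close> to eigenvectors of \<open>L\<close> in \<open>X\<close> with the
  same eigenvalue. Cancelling \<open>g f\<close> there requires that \<open>L\<close> preserves
  \<open>X\<close>, which \<open>derivative_maps_subspace\<close> provides.\<close>

lemma reduced_problems_conjugate:
  fixes A :: "'s \<Rightarrow> 'a \<Rightarrow> 'a::euclidean_space" and B :: "'s \<Rightarrow> 'b \<Rightarrow> 'b::euclidean_space"
  assumes X: "subrep A X" and Z: "subrep B Z"
    and f: "rep_map A X B Z f" and g: "rep_map B Z A X g"
    and gf: "\<And>x. x \<in> X \<Longrightarrow> g (f x) = x" and fg: "\<And>y. y \<in> Z \<Longrightarrow> f (g y) = y"
    and r: "r \<in> reduced_problems A X"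
  shows "restrict (\<lambda>(z, l). f (r (g z, l))) (Z \<times> UNIV) \<in> reduced_problems B Z" (is "?r \<in> _")
proof -
  note fl = rep_mapD(1)[OF f] and gl = rep_mapD(1)[OF g]
  note fZ = rep_mapD(2)[OF f] and gX = rep_mapD(2)[OF g]
  have bf: "bounded_linear f" and bg: "bounded_linear g"
    using fl gl by (simp_all add: linear_conv_bounded_linear)
  have r1: "\<And>x l. x \<in> X \<Longrightarrow> r (x, l) \<in> X" and r2: "smooth_on (X \<times> UNIV) r"
    and r3: "\<And>\<sigma> x l. x \<in> X \<Longrightarrow> r (A \<sigma> x, l) = A \<sigma> (r (x, l))" and r4: "r (0, 0) = 0"
    using r unfolding reduced_problems_def by (auto simp: PiE_iff)
  obtain L where L: "((\<lambda>x. r (x, 0)) has_derivative L) (at 0 within X)"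
    and Lim: "\<And>\<mu>. is_eigenvalue L X \<mu> \<Longrightarrow> Re \<mu> = 0"
    using r unfolding reduced_problems_def by blast
  have rr: "?r (z, l) = f (r (g z, l))" if "z \<in> Z" for z l using that by simp
  have 1: "?r \<in> Z \<times> UNIV \<rightarrow>\<^sub>E Z" using fZ gX r1 by auto
  have 2: "smooth_on (Z \<times> UNIV) ?r"
    unfolding smooth_on_def
  proof
    fix k
    have "linear (\<lambda>(z, l::real). (g z, l))"
      by (rule linearI) (auto simp: linear_add[OF gl] linear_scale[OF gl])
    then have "bounded_linear (\<lambda>(z, l::real). (g z, l))" by (simp add: linear_conv_bounded_linear)
    then have "Ck_on k (Z \<times> UNIV) (\<lambda>x. f (r ((\<lambda>(z, l). (g z, l)) x)))"
    proof (rule Ck_on_linear_compose[OF _ bf])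
      show "Ck_on k (X \<times> UNIV) r" using r2 unfolding smooth_on_def by (rule spec)
      show "(case x of (z, l) \<Rightarrow> (g z, l)) \<in> X \<times> UNIV" if "x \<in> Z \<times> (UNIV :: real set)" for x
        using that gX by (cases x) simp
    qed
    then show "Ck_on k (Z \<times> UNIV) ?r"
      by (rule Ck_on_cong) (simp add: split_beta)
  qed
  have 3: "?r (B \<sigma> z, l) = B \<sigma> (?r (z, l))" if z: "z \<in> Z" for \<sigma> z l
    using rr[OF z] rr[OF subrepD(2)[OF Z z]] rep_mapD(3)[OF g z] r3[OF gX[OF z]]
      rep_mapD(3)[OF f r1[OF gX[OF z]]] by simp
  have Z0: "0 \<in> Z" using subspace_0[OF subrepD(1)[OF Z]] .
  have 4: "?r (0, 0) = 0" using rr[OF Z0] r4 linear_0[OF fl] linear_0[OF gl] by simp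
  let ?L = "\<lambda>h. f (L (g h))"
  have "g ` Z \<subseteq> X" using gX by blast
  then have "((\<lambda>x. r (x, 0)) has_derivative L) (at (g 0) within g ` Z)"
    unfolding linear_0[OF gl] by (rule has_derivative_subset[OF L])
  from bounded_linear.has_derivative[OF bf has_derivative_in_compose[OF bounded_linear_imp_has_derivative[OF bg] this]]
  have "((\<lambda>z. f (r (g z, 0))) has_derivative ?L) (at 0 within Z)" .
  from has_derivative_transform[OF Z0 _ this, of "\<lambda>z. ?r (z, 0)"] rr
  have 5: "((\<lambda>z. ?r (z, 0)) has_derivative ?L) (at 0 within Z)" by metis
  have "Re \<mu> = 0" if ev: "is_eigenvalue ?L Z \<mu>" for \<mu>
  proof (rule Lim)
    obtain y where y: "y \<in> Z \<times> Z" "y \<noteq> 0" "map_prod ?L ?L y = complex_scale \<mu> y"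
      using ev[unfolded is_eigenvalue_def] by (elim bexE conjE) (rule that)
    obtain a b where ab: "y = (a, b)" by (cases y)
    have z: "a \<in> Z" "b \<in> Z" "(a, b) \<noteq> 0" "(f (L (g a)), f (L (g b))) = complex_scale \<mu> (a, b)"
      using y unfolding ab by simp_all
    let ?w = "(g a, g b)"
    have w: "?w \<in> X \<times> X" using z(1,2) gX by blast
    have "?w \<noteq> 0"
    proof
      assume "?w = 0"
      then have "f (g a) = 0" "f (g b) = 0" using linear_0[OF fl] by (simp_all add: zero_prod_def)
      then show False using z(1-3) fg by (simp add: zero_prod_def)
    qed
    moreover have LX: "L x \<in> X" if x: "x \<in> X" for x
      by (rule derivative_maps_subspace[OF subrepD(1)[OF X] r1 L x])
    have "map_prod L L ?w = map_prod g g (f (L (g a)), f (L (g b)))"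
      using gf[OF LX[OF gX[OF z(1)]]] gf[OF LX[OF gX[OF z(2)]]] by simp
    then have "map_prod L L ?w = complex_scale \<mu> ?w"
      unfolding z(4) map_prod_complex_scale[OF gl] by simp
    ultimately show "is_eigenvalue L X \<mu>" using w unfolding is_eigenvalue_def by blast
  qed
  with 5 have "\<exists>L. ((\<lambda>z. ?r (z, 0)) has_derivative L) (at 0 within Z) \<and>
      (\<forall>\<mu>. is_eigenvalue L Z \<mu> \<longrightarrow> Re \<mu> = 0)" by blast
  with 1 2 3 4 show ?thesis unfolding reduced_problems_def by simp
qed

text \<open>Conjugation by the inverse isomorphism undoes conjugation by \<open>f\<close>, and both
  preserve the class of reduced problems.\<close>

lemma rep_iso_reduced_equivalent:
  fixes A :: "'s \<Rightarrow> 'a \<Rightarrow> 'a::euclidean_space" and B :: "'s \<Rightarrow> 'b \<Rightarrow> 'b::euclidean_space"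
  assumes X: "subrep A X" and Z: "subrep B Z" and iso: "rep_iso A X B Z"
  shows "reduced_equivalent A X B Z"
proof -
  obtain f where f: "rep_map A X B Z f" "bij_betw f X Z" using iso rep_iso_iff[OF X] by blast
  obtain g where g: "rep_map B Z A X g" "bij_betw g Z X"
    and gf: "\<And>x. x \<in> X \<Longrightarrow> g (f x) = x" and fg: "\<And>y. y \<in> Z \<Longrightarrow> f (g y) = y"
    by (rule rep_map_inverse[OF X f]) auto
  note fZ = rep_mapD(2)[OF f(1)] and gX = rep_mapD(2)[OF g(1)]
  let ?\<phi> = "restrict f X"
  have "?\<phi> \<in> rep_isos A X B Z"
    using rep_map_restrict[OF X f(1)] f(2) unfolding rep_isos_def by simp
  moreover
  let ?F = "\<lambda>r. restrict (\<lambda>(z, l). f (r (g z, l))) (Z \<times> (UNIV :: real set))"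
  let ?G = "\<lambda>r. restrict (\<lambda>(x, l). g (r (f x, l))) (X \<times> (UNIV :: real set))"
  have range: "\<And>x l. x \<in> X \<Longrightarrow> r (x, l) \<in> X" "r \<in> extensional (X \<times> UNIV)"
    if "r \<in> reduced_problems A X" for r and A :: "'s \<Rightarrow> 'c \<Rightarrow> 'c::euclidean_space" and X
    using that unfolding reduced_problems_def by (auto simp: PiE_iff)
  \<comment> \<open>\<open>conjugate\<close> uses the set-theoretic inverse of the restricted map;
    on \<open>Z\<close> it is the linear map \<open>g\<close>.\<close>
  have inv: "inv_into X ?\<phi> z = g z" if "z \<in> Z" for z
  proof (rule inv_into_f_eq)
    show "inj_on ?\<phi> X" using f(2) unfolding bij_betw_def by (simp add: inj_on_restrict_eq)
    show "g z \<in> X" "?\<phi> (g z) = z" using gX fg that by simp_all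
  qed
  have "conjugate ?\<phi> X Z r = ?F r" if r: "r \<in> reduced_problems A X" for r
    unfolding conjugate_def using inv range(1)[OF r] gX by (auto intro!: restrict_ext)
  moreover have "bij_betw ?F (reduced_problems A X) (reduced_problems B Z)"
  proof (rule bij_betw_byWitness[of _ ?G])
    show "\<forall>r\<in>reduced_problems A X. ?G (?F r) = r"
    proof
      fix r assume r: "r \<in> reduced_problems A X"
      show "?G (?F r) = r"
      proof (rule extensionalityI[of _ "X \<times> UNIV"])
        show "?G (?F r) x = r x" if "x \<in> X \<times> UNIV" for x
          using that fZ gf range(1)[OF r] by auto
      qed (use range(2)[OF r] in auto)
    qed
    show "\<forall>r\<in>reduced_problems B Z. ?F (?G r) = r"
    proof
      fix r assume r: "r \<in> reduced_problems B Z"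
      show "?F (?G r) = r"
      proof (rule extensionalityI[of _ "Z \<times> UNIV"])
        show "?F (?G r) x = r x" if "x \<in> Z \<times> UNIV" for x
          using that gX fg range(1)[OF r] by auto
      qed (use range(2)[OF r] in auto)
    qed
    show "?F ` reduced_problems A X \<subseteq> reduced_problems B Z"
      using reduced_problems_conjugate[OF X Z f(1) g(1) gf fg] by blast
    show "?G ` reduced_problems B Z \<subseteq> reduced_problems A X"
      using reduced_problems_conjugate[OF Z X g(1) f(1) fg gf] by blast
  qed
  ultimately show ?thesis
    unfolding reduced_equivalent_def using bij_betw_cong[of "reduced_problems A X" "conjugate ?\<phi> X Z" ?F]
    by blast
qed


section \<open>Realization of center subspaces\<close>

lemma linear_axis: "linear (axis i :: 'a::real_vector \<Rightarrow> 'a ^ 'n::finite)"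
  by (rule linearI) (auto simp: axis_def vec_eq_iff)

text \<open>Each summand is \<open>f\<close> between linear maps, so the derivative can be taken
  termwise.\<close>

lemma Gamma_eq_sum:
  fixes f :: "('v::euclidean_space, 's::{finite, monoid_mult}) net \<times> real \<Rightarrow> 'v"
  shows "Gamma f v l = (\<Sum>\<sigma>\<in>UNIV. axis \<sigma> (f (net_action \<sigma> v, l)))"
  unfolding Gamma_def net_action_def vec_eq_iff by (simp add: axis_def)

lemma Gamma_equivariant: "Gamma f (net_action \<sigma> v) l = net_action \<sigma> (Gamma f v l)"
  unfolding Gamma_def net_action_def vec_eq_iff by (simp add: mult.assoc)

text \<open>Equivariant maps are admissible: entry 1 of \<open>net_action \<sigma> v\<close> is
  entry \<open>\<sigma>\<close> of \<open>v\<close>, so the component at 1 of an equivariant map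
  determines all others.\<close>

lemma Gamma_of_equivariant_map:
  assumes "\<And>\<sigma> v. L (net_action \<sigma> v) = net_action \<sigma> (L v)"
  shows "Gamma (\<lambda>(v, l). L v $ 1) v l = L v"
proof -
  have "L (\<chi> \<tau>. v $ (\<tau> * \<sigma>)) $ 1 = L v $ \<sigma>" for \<sigma>
    using assms[of \<sigma> v] unfolding net_action_def by (simp add: vec_eq_iff)
  then show ?thesis unfolding Gamma_def vec_eq_iff by simp
qed

text \<open>\<open>linearization\<close> is obtained by choice and means something only once
  differentiability is known; smoothness of \<open>f\<close> at the origin gives it.\<close>

lemma has_derivative_linearization:
  fixes f :: "('v::euclidean_space, 's::{finite, monoid_mult}) net \<times> real \<Rightarrow> 'v"
  assumes "smooth_on UNIV f"
  shows "((\<lambda>v. Gamma f v 0) has_derivative linearization f) (at 0)"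
proof -
  have "Ck_on (Suc 0) UNIV f" using assms unfolding smooth_on_def by blast
  then obtain f' where f': "\<And>x. (f has_derivative f' x) (at x)"
    unfolding Ck_on.simps by auto
  have lA: "linear (net_action \<sigma> :: ('v, 's) net \<Rightarrow> _)" for \<sigma> :: 's
    using linear_action_net_action unfolding linear_action_def by blast
  have D: "((\<lambda>v. axis \<sigma> (f (net_action \<sigma> v, 0))) has_derivative
      (\<lambda>h. axis \<sigma> (f' (0, 0) (net_action \<sigma> h, 0)))) (at 0)" for \<sigma> :: 's
  proof -
    have "linear (\<lambda>v :: ('v, 's) net. (net_action \<sigma> v, 0 :: real))"
      by (rule linearI) (auto simp: linear_add[OF lA] linear_scale[OF lA])
    then have 1: "((\<lambda>v :: ('v, 's) net. (net_action \<sigma> v, 0 :: real)) has_derivative (\<lambda>v. (net_action \<sigma> v, 0))) (at 0)"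
      by (intro bounded_linear_imp_has_derivative) (rule linear_conv_bounded_linear[THEN iffD1])
    have "(f has_derivative f' (0, 0)) (at (net_action \<sigma> 0, 0))"
      using f' by (simp add: linear_0[OF lA])
    then have der: "((\<lambda>v. f (net_action \<sigma> v, 0)) has_derivative (\<lambda>h. f' (0, 0) (net_action \<sigma> h, 0))) (at 0)"
      by (rule has_derivative_compose[OF 1])
    have bl: "bounded_linear (axis \<sigma> :: 'v \<Rightarrow> ('v, 's) net)"
      by (rule linear_conv_bounded_linear[THEN iffD1, OF linear_axis])
    show ?thesis by (rule bounded_linear.has_derivative[OF bl der])
  qed
  have "(\<lambda>v. Gamma f v 0) differentiable (at 0)"
    unfolding Gamma_eq_sum differentiable_def by (rule exI, rule has_derivative_sum) (rule D)
  then show ?thesis unfolding linearization_def by (rule frechet_derivative_works[THEN iffD1])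
qed

text \<open>The action fixes the origin, so differentiating the equivariance of \<open>Gamma\<close>
  there and using uniqueness of derivatives suffices.\<close>

lemma linearization_equivariant:
  fixes f :: "('v::euclidean_space, 's::{finite, monoid_mult}) net \<times> real \<Rightarrow> 'v"
  assumes "smooth_on UNIV f"
  shows "linearization f (net_action \<sigma> v) = net_action \<sigma> (linearization f v)"
proof -
  note D = has_derivative_linearization[OF assms]
  have lA: "linear (net_action \<sigma> :: ('v, 's) net \<Rightarrow> _)"
    using linear_action_net_action unfolding linear_action_def by blast
  then have bA: "bounded_linear (net_action \<sigma> :: ('v, 's) net \<Rightarrow> _)"
    by (simp add: linear_conv_bounded_linear)
  have "((\<lambda>v. Gamma f v 0) has_derivative linearization f) (at (net_action \<sigma> 0))"
    using D by (simp add: linear_0[OF lA])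
  from has_derivative_compose[OF bounded_linear_imp_has_derivative[OF bA] this]
  have "((\<lambda>v. net_action \<sigma> (Gamma f v 0)) has_derivative (\<lambda>v. linearization f (net_action \<sigma> v))) (at 0)"
    unfolding Gamma_equivariant .
  moreover have "((\<lambda>v. net_action \<sigma> (Gamma f v 0)) has_derivative
      (\<lambda>v. net_action \<sigma> (linearization f v))) (at 0)"
    by (rule bounded_linear.has_derivative[OF bA D])
  ultimately show ?thesis by (metis has_derivative_unique)
qed

text \<open>The action on pairs commutes with \<open>L - \<mu>\<close> and its powers, so it
  preserves generalized eigenvectors. Invariance matters because isomorphisms are inverted and
  composed only between subrepresentations.\<close>

lemma center_subspace_subrep:
  fixes L :: "'a::real_vector \<Rightarrow> 'a"
  assumes A: "linear_action A" and L: "\<And>\<sigma> v. L (A \<sigma> v) = A \<sigma> (L v)"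
  shows "subrep A (center_subspace L)"
proof -
  let ?S = "\<Union>\<mu>\<in>{\<mu>. is_eigenvalue L UNIV \<mu> \<and> Re \<mu> = 0}. real_gen_eigenspace L \<mu>"
  have "A \<sigma> x \<in> real_gen_eigenspace L \<mu>" if x: "x \<in> real_gen_eigenspace L \<mu>" for \<sigma> x \<mu>
  proof -
    have lA: "linear (A \<sigma>)" using A unfolding linear_action_def by blast
    let ?T = "\<lambda>z. map_prod L L z - complex_scale \<mu> z" and ?A = "map_prod (A \<sigma>) (A \<sigma>)"
    obtain z k where z: "x = fst z" "(?T ^^ k) z = 0"
      using x unfolding real_gen_eigenspace_def by blast
    have "?T (?A w) = ?A (?T w)" for w
      unfolding map_prod_complex_scale[OF lA, symmetric]
      by (cases w, cases "complex_scale \<mu> w") (simp add: L linear_diff[OF lA])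
    note TA = this
    have "(?T ^^ k) (?A w) = ?A ((?T ^^ k) w)" for w
    proof (induction k)
      case (Suc k)
      then show ?case unfolding funpow.simps o_apply by (simp only: TA)
    qed simp
    then have "(?T ^^ k) (?A z) = ?A 0" unfolding z(2)[symmetric] .
    also have "?A 0 = 0" by (simp add: zero_prod_def linear_0[OF lA])
    finally have k: "\<exists>k. (?T ^^ k) (?A z) = 0" ..
    have "A \<sigma> x = fst (?A z)" using z(1) by simp
    then show ?thesis
      unfolding real_gen_eigenspace_def by (intro CollectI exI[of _ "?A z"] conjI k)
  qed
  then have S: "A \<sigma> ` ?S \<subseteq> ?S" for \<sigma> by blast
  have "A \<sigma> ` span ?S \<subseteq> span ?S" for \<sigma>
  proof -
    have lA: "linear (A \<sigma>)" using A unfolding linear_action_def by blast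
    have "A \<sigma> ` span ?S = span (A \<sigma> ` ?S)" using linear_span_image[OF lA] by simp
    then show ?thesis using span_mono[OF S] by simp
  qed
  then show ?thesis
    unfolding subrep_def center_subspace_def by (intro conjI allI subspace_span)
qed

lemma generic_Hopf_center_subrep:
  assumes "generic_Hopf_center X"
  shows "subrep net_action X"
proof -
  obtain f where f: "smooth_on UNIV f" and X: "X = center_subspace (linearization f)"
    using assms unfolding generic_Hopf_center_def generic_Hopf_def by blast
  show ?thesis
    unfolding X by (rule center_subspace_subrep[OF linear_action_net_action linearization_equivariant[OF f]])
qed

lemma complex_scale_mult: "complex_scale a (complex_scale b z) = complex_scale (a * b) z"
  unfolding complex_scale_def by (cases z) (simp add: algebra_simps)

lemma complex_scale_eq_0:
  assumes "complex_scale c z = 0" "c \<noteq> 0"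
  shows "z = 0"
proof -
  have "complex_scale (inverse c) (complex_scale c z) = complex_scale 1 z"
    unfolding complex_scale_mult using assms(2) by simp
  then show ?thesis using assms(1) by (simp add: complex_scale_def prod_eq_iff)
qed

lemma dsum_projection:
  fixes A :: "'s \<Rightarrow> 'a \<Rightarrow> 'a::real_vector"
  assumes A: "linear_action A" and U: "subrep A U" and W: "subrep A W" and d: "dsum UNIV U W"
  obtains p where "rep_map A UNIV A W p" "\<And>x. x \<in> W \<Longrightarrow> p x = x" "\<And>x. x \<in> U \<Longrightarrow> p x = 0"
    "\<And>x. x - p x \<in> U"
proof -
  note sU = subrepD(1)[OF U] and sW = subrepD(1)[OF W]
  define p where "p x = (SOME w. w \<in> W \<and> x - w \<in> U)" for x
  have "\<exists>w. w \<in> W \<and> x - w \<in> U" for x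
    using dsumD(5)[OF d, of x] by (metis UNIV_I add_diff_cancel_right')
  from someI_ex[OF this] have p: "p x \<in> W" "x - p x \<in> U" for x
    unfolding p_def by blast+
  have uniq: "p x = w" if "w \<in> W" "x - w \<in> U" for x w
  proof -
    have "(x - w) - (x - p x) \<in> U" using p that subspace_diff[OF sU] by blast
    then have "p x - w \<in> U" by simp
    moreover have "p x - w \<in> W" using p that subspace_diff[OF sW] by blast
    ultimately have "p x - w = 0" by (rule dsumD(1)[OF d])
    then show ?thesis by simp
  qed
  have lp: "linear p"
  proof (rule linearI)
    fix x y c
    have "(x - p x) + (y - p y) \<in> U" by (intro subspace_add[OF sU] p)
    then show "p (x + y) = p x + p y"
      by (intro uniq subspace_add[OF sW] p) (simp add: algebra_simps)
    have "c *\<^sub>R (x - p x) \<in> U" by (intro subspace_scale[OF sU] p)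
    then show "p (c *\<^sub>R x) = c *\<^sub>R p x"
      by (intro uniq subspace_scale[OF sW] p) (simp add: algebra_simps)
  qed
  have "p (A \<sigma> x) = A \<sigma> (p x)" for \<sigma> x
  proof (rule uniq)
    have "linear (A \<sigma>)" using A unfolding linear_action_def by blast
    then have "A \<sigma> x - A \<sigma> (p x) = A \<sigma> (x - p x)" by (simp add: linear_diff)
    then show "A \<sigma> x - A \<sigma> (p x) \<in> U" using subrepD(2)[OF U p(2)] by simp
  qed (rule subrepD(2)[OF W p(1)])
  then have "rep_map A UNIV A W p" using lp p(1) by (intro rep_mapI)
  moreover have "p x = x" if "x \<in> W" for x
    by (rule uniq) (use that subspace_0[OF sU] in auto)
  moreover have "p x = 0" if "x \<in> U" for x
    by (rule uniq) (use that subspace_0[OF sW] in auto)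
  ultimately show ?thesis using p(2) by (rule that)
qed

text \<open>The map is \<open>J\<close> on \<open>U\<close> and the identity on the range of
  \<open>p\<close>. Applying \<open>p\<close> to \<open>L - \<mu>\<close> multiplies by
  \<open>1 - \<mu>\<close>, which is nonzero for \<open>\<mu>\<close> on the imaginary axis, so
  generalized eigenvectors have components in the kernel \<open>U\<close> of \<open>p\<close>.
  Conversely every \<open>u\<close> in \<open>U\<close> is the real part of an eigenvector.\<close>

lemma center_subspace_complex_structure:
  fixes U :: "'a::real_vector set"
  assumes p: "linear p" "\<And>x. p (p x) = p x" "\<And>x. x \<in> U \<longleftrightarrow> p x = 0"
    and U: "subspace U" and J: "\<And>x. x \<in> U \<Longrightarrow> J x \<in> U" "\<And>x. x \<in> U \<Longrightarrow> J (J x) = - x" "linear J"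
    and ev: "is_eigenvalue (\<lambda>x. J (x - p x) + p x) UNIV \<i>"
  shows "center_subspace (\<lambda>x. J (x - p x) + p x) = U"
proof -
  let ?L = "\<lambda>x. J (x - p x) + p x"
  have d: "x - p x \<in> U" for x by (simp add: p(2,3) linear_diff[OF p(1)])
  let ?S = "\<Union>\<mu>\<in>{\<mu>. is_eigenvalue ?L UNIV \<mu> \<and> Re \<mu> = 0}. real_gen_eigenspace ?L \<mu>"
  have "x \<in> U" if \<mu>: "Re \<mu> = 0" and x: "x \<in> real_gen_eigenspace ?L \<mu>" for x \<mu>
  proof -
    let ?T = "\<lambda>z. map_prod ?L ?L z - complex_scale \<mu> z" and ?P = "map_prod p p"
    obtain z k where z: "x = fst z" "(?T ^^ k) z = 0"
      using x unfolding real_gen_eigenspace_def by blast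
    have pJ: "p (J (v - p v)) = 0" for v using J(1)[OF d[of v]] unfolding p(3) .
    have PT: "?P (?T w) = complex_scale (1 - \<mu>) (?P w)" for w
      unfolding complex_scale_def
      by (cases w) (simp add: linear_diff[OF p(1)] linear_add[OF p(1)] linear_scale[OF p(1)]
          pJ p(2) algebra_simps)
    have \<mu>1: "1 - \<mu> \<noteq> 0" using \<mu> by auto
    have P0: "?P w = 0" if "?P ((?T ^^ k) w) = 0" for w k
      using that
    proof (induction k)
      case (Suc k)
      have "complex_scale (1 - \<mu>) (?P ((?T ^^ k) w)) = 0"
        using Suc.prems unfolding funpow.simps o_apply PT .
      then have "?P ((?T ^^ k) w) = 0" using \<mu>1 by (rule complex_scale_eq_0)
      then show ?case by (rule Suc.IH)
    qed simp
    have "?P ((?T ^^ k) z) = 0" unfolding z(2) by (simp add: zero_prod_def linear_0[OF p(1)])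
    then have "?P z = 0" by (rule P0)
    then show "x \<in> U" unfolding p(3) z(1) by (simp add: prod_eq_iff)
  qed
  then have "?S \<subseteq> U" by blast
  then have "span ?S \<subseteq> U" using U by (rule span_minimal)
  moreover have "U \<subseteq> ?S"
  proof
    fix u assume u: "u \<in> U"
    have L: "?L v = J v" if "v \<in> U" for v using that unfolding p(3) by simp
    \<comment> \<open>The pair stands for \<open>u - i J u\<close>, and
      \<open>J (u - i J u) = J u + i u = i (u - i J u)\<close>.\<close>
    have "map_prod ?L ?L (u, - J u) = complex_scale \<i> (u, - J u)"
      unfolding map_prod_simp L[OF u] L[OF subspace_neg[OF U J(1)[OF u]]]
      by (simp add: complex_scale_def linear_neg[OF J(3)] J(2)[OF u])
    then have "((\<lambda>z. map_prod ?L ?L z - complex_scale \<i> z) ^^ 1) (u, - J u) = 0"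
      unfolding One_nat_def funpow.simps o_apply id_apply by (rule right_minus_eq[THEN iffD2])
    then have k: "\<exists>k. ((\<lambda>z. map_prod ?L ?L z - complex_scale \<i> z) ^^ k) (u, - J u) = 0" ..
    have "u \<in> real_gen_eigenspace ?L \<i>"
      unfolding real_gen_eigenspace_def by (intro CollectI exI[of _ "(u, - J u)"] conjI k) simp
    then show "u \<in> ?S" by (rule UN_I[rotated]) (simp add: ev)
  qed
  then have "U \<subseteq> span ?S" using span_superset by blast
  ultimately show ?thesis unfolding center_subspace_def by blast
qed

text \<open>The vector field is linear and equivariant, hence admissible through its component at 1
  and equal to its own linearization. Its eigenvalue \<open>i\<close> supplies the Hopf
  condition.\<close>

lemma generic_Hopf_center_realization:
  fixes U W :: "('v::euclidean_space, 's::{finite, monoid_mult}) net set"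
  assumes U: "subrep net_action U" and W: "subrep net_action W" and d: "dsum UNIV U W"
    and nz: "U \<noteq> {0}" and J: "rep_map net_action U net_action U J" "\<And>x. x \<in> U \<Longrightarrow> J (J x) = - x"
    and gen: "generic_Hopf_rep (net_action :: 's \<Rightarrow> ('v, 's) net \<Rightarrow> ('v, 's) net) net_action U"
  shows "generic_Hopf_center U"
proof -
  note lact = linear_action_net_action
  have lA: "linear (net_action \<sigma> :: ('v, 's) net \<Rightarrow> _)" for \<sigma> :: 's
    using lact unfolding linear_action_def by blast
  obtain p where p: "rep_map net_action UNIV net_action W p" "\<And>x. x \<in> W \<Longrightarrow> p x = x"
    "\<And>x. x \<in> U \<Longrightarrow> p x = 0" "\<And>x. x - p x \<in> U"
    using dsum_projection[OF lact U W d] by metis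
  note lp = rep_mapD(1)[OF p(1)] and pW = rep_mapD(2)[OF p(1) UNIV_I] and pA = rep_mapD(3)[OF p(1) UNIV_I]
  note lJ = rep_mapD(1)[OF J(1)] and JU = rep_mapD(2)[OF J(1)]
  have pp: "p (p x) = p x" for x using p(2) pW by blast
  have pU: "x \<in> U \<longleftrightarrow> p x = 0" for x using p(3,4)[of x] by auto
  define L where "L = (\<lambda>x. J (x - p x) + p x)"
  have lL: "linear L"
    unfolding L_def
    by (rule linearI)
      (simp_all add: linear_add[OF lp] linear_scale[OF lp] linear_add[OF lJ] linear_diff[OF lJ]
        linear_scale[OF lJ] algebra_simps)
  have LA: "L (net_action \<sigma> v) = net_action \<sigma> (L v)" for \<sigma> v
    using rep_mapD(3)[OF J(1) p(4), of \<sigma> v] unfolding L_def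
    by (simp add: pA linear_diff[OF lA] linear_add[OF lA])
  obtain u where u: "u \<in> U" "u \<noteq> 0"
    using nz subspace_0[OF subrepD(1)[OF U]] by blast
  have LU: "L v = J v" if "v \<in> U" for v using p(3)[OF that] unfolding L_def by simp
  have "map_prod L L (u, - J u) = complex_scale \<i> (u, - J u)"
    unfolding map_prod_simp LU[OF u(1)] LU[OF subspace_neg[OF subrepD(1)[OF U] JU[OF u(1)]]]
    by (simp add: complex_scale_def linear_neg[OF lJ] J(2)[OF u(1)])
  then have ev: "is_eigenvalue L UNIV \<i>"
    unfolding is_eigenvalue_def using u(2) by (intro bexI[of _ "(u, - J u)"]) (auto simp: zero_prod_def)
  have cs: "center_subspace L = U"
    unfolding L_def
    by (rule center_subspace_complex_structure[OF lp pp pU subrepD(1)[OF U] JU J(2) lJ ev[unfolded L_def]])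
  define f where "f = (\<lambda>(v :: ('v, 's) net, l :: real). L v $ 1)"
  have G: "Gamma f v l = L v" for v l unfolding f_def by (rule Gamma_of_equivariant_map[OF LA])
  have "linear f"
    unfolding f_def
    by (rule linearI) (auto simp: linear_add[OF lL] linear_scale[OF lL])
  then have "smooth_on UNIV f"
    unfolding smooth_on_def by (intro allI Ck_on_bounded_linear) (simp add: linear_conv_bounded_linear)
  moreover have "linearization f = L"
    unfolding linearization_def G
    using linear_imp_has_derivative[OF lL] by (rule frechet_derivative_at[symmetric])
  moreover have "Gamma f 0 0 = 0" unfolding G by (rule linear_0[OF lL])
  moreover have "Complex 0 1 = \<i>" by (simp add: complex_eq_iff)
  ultimately have "generic_Hopf f"
    using ev gen cs unfolding generic_Hopf_def by (metis zero_neq_one)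
  then show ?thesis
    using cs \<open>linearization f = L\<close> unfolding generic_Hopf_center_def by metis
qed

lemma generic_Hopf_center_complex_or_quaternionic:
  fixes U W :: "('v::euclidean_space, 's::{finite, monoid_mult}) net set"
  assumes U: "indecomposable net_action U" and W: "subrep net_action W" and d: "dsum UNIV U W"
    and t: "complex_type net_action U \<or> quaternionic_type net_action U"
  shows "generic_Hopf_center U"
proof -
  note lact = linear_action_net_action and sU = indecomposableD(1)[OF U]
  obtain J where J: "rep_map net_action U net_action U J" "\<And>x. x \<in> U \<Longrightarrow> J (J x) = - x"
    using complex_or_quaternionic_type_complex_structure[OF lact U t] by blast
  obtain s Y where Y: "decomposition net_action UNIV (Suc s) Y" "Y (Suc s) = U"
    using decomposition_with_summand[OF lact U W d] by blast
  have gen: "generic_Hopf_rep (net_action :: 's \<Rightarrow> ('v, 's) net \<Rightarrow> ('v, 's) net) net_action U"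
    unfolding generic_Hopf_rep_def
  proof (intro exI conjI)
    have "Suc s \<in> {1..Suc s}" by simp
    then show "(\<exists>i\<in>{1..Suc s}. complex_type net_action (Y i) \<and> rep_iso net_action U net_action (Y i)) \<or>
      (\<exists>i\<in>{1..Suc s}. quaternionic_type net_action (Y i) \<and> rep_iso net_action U net_action (Y i)) \<or>
      (\<exists>i\<in>{1..Suc s}. \<exists>j\<in>{1..Suc s}. i \<noteq> j \<and> real_type net_action (Y i) \<and> real_type net_action (Y j) \<and>
         rep_iso net_action (Y i) net_action (Y j) \<and>
         rep_iso net_action U (prod_action net_action net_action) (Y i \<times> Y j))"
      using t rep_iso_refl[OF sU] Y(2) by metis
  qed (rule Y(1))
  show ?thesis
    by (rule generic_Hopf_center_realization[OF sU W d indecomposableD(2)[OF U] J gen])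
qed

text \<open>Center subspaces are internal sums, while \<open>generic_Hopf_rep\<close> describes them
  by external products; addition is the isomorphism.\<close>

lemma dsum_rep_iso_Times:
  assumes A: "linear_action A" and V: "subrep A V" and W: "subrep A W" and d: "dsum U V W"
  shows "rep_iso (prod_action A A) (V \<times> W) A U"
proof -
  note sV = subrepD(1)[OF V] and sW = subrepD(1)[OF W]
  let ?f = "\<lambda>z. fst z + snd z"
  have lf: "linear ?f" by (rule linearI) (auto simp: scaleR_add_right)
  have "rep_map (prod_action A A) (V \<times> W) A U ?f"
  proof (rule rep_mapI[OF lf])
    fix \<sigma> z assume z: "z \<in> V \<times> W"
    then show "?f z \<in> U" using dsumD(2)[OF d] by auto
    have "linear (A \<sigma>)" using A unfolding linear_action_def by blast
    then show "?f (prod_action A A \<sigma> z) = A \<sigma> (?f z)"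
      unfolding prod_action_def by (simp add: linear_add)
  qed
  moreover have "bij_betw ?f (V \<times> W) U"
    unfolding bij_betw_def
  proof
    show "inj_on ?f (V \<times> W)"
      unfolding linear_inj_on_iff_eq_0[OF lf subspace_Times[OF sV sW]]
    proof (intro ballI impI)
      fix z assume z: "z \<in> V \<times> W" "?f z = 0"
      then have "fst z = - snd z" by (simp add: eq_neg_iff_add_eq_0)
      then have "fst z \<in> W" using z(1) subspace_neg[OF sW] by auto
      then have "fst z = 0" using z(1) dsumD(1)[OF d] by auto
      then show "z = 0" using z(2) by (simp add: prod_eq_iff)
    qed
    show "?f ` (V \<times> W) = U"
    proof
      show "?f ` (V \<times> W) \<subseteq> U" using dsumD(2)[OF d] by auto
      show "U \<subseteq> ?f ` (V \<times> W)"
      proof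
        fix x assume "x \<in> U"
        then obtain v w where "v \<in> V" "w \<in> W" "x = v + w" using dsumD(5)[OF d] by blast
        then show "x \<in> ?f ` (V \<times> W)" by (intro image_eqI[of _ _ "(v, w)"]) auto
      qed
    qed
  qed
  ultimately show ?thesis using rep_iso_iff[OF subrep_Times[OF V W]] by blast
qed

text \<open>\<open>X\<close> is the internal sum \<open>U2 + U1\<close>, and regrouping
  \<open>(W + U2) + U1\<close> leaves \<open>W\<close> as its complement. The complex structure is a
  quarter turn that exchanges the two isomorphic copies.\<close>

lemma generic_Hopf_center_real:
  fixes U1 U2 V W :: "('v::euclidean_space, 's::{finite, monoid_mult}) net set"
  assumes U1: "indecomposable net_action U1" and U2: "indecomposable net_action U2"
    and d1: "dsum UNIV U1 V" and d2: "dsum V U2 W" and W: "subrep net_action W"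
    and t: "real_type net_action U1" "real_type net_action U2"
    and iso: "rep_iso net_action U2 net_action U1"
  shows "\<exists>X :: ('v, 's) net set. generic_Hopf_center X \<and>
    rep_iso net_action X (prod_action net_action net_action) (U2 \<times> U1)"
proof -
  note lact = linear_action_net_action
  note s1 = indecomposableD(1)[OF U1] and s2 = indecomposableD(1)[OF U2]
  have sV: "subrep net_action V" by (rule dsum_subrep[OF lact s2 W d2])
  define X where "X = {x + y | x y. x \<in> U2 \<and> y \<in> U1}"
  note da = dsum_assoc[OF dsum_sym[OF d1] dsum_sym[OF d2] subrepD(1)[OF sV], folded X_def]
  have sX: "subrep net_action X" by (rule dsum_subrep[OF lact s2 s1 da(2)])
  have sP: "subrep (prod_action net_action net_action) (U2 \<times> U1)" by (rule subrep_Times[OF s2 s1])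
  have iP: "rep_iso (prod_action net_action net_action) (U2 \<times> U1) net_action X"
    by (rule dsum_rep_iso_Times[OF lact s2 s1 da(2)])
  have iX: "rep_iso net_action X (prod_action net_action net_action) (U2 \<times> U1)"
    by (rule rep_iso_sym[OF sP sX iP])
  obtain s Y where Y: "decomposition net_action UNIV (Suc (Suc s)) Y" "Y (Suc s) = U2" "Y (Suc (Suc s)) = U1"
    using decomposition_with_two_summands[OF lact U1 d1 U2 d2 W] by blast
  have gen: "generic_Hopf_rep (net_action :: 's \<Rightarrow> ('v, 's) net \<Rightarrow> ('v, 's) net) net_action X"
    unfolding generic_Hopf_rep_def
  proof (intro exI conjI disjI2 bexI)
    show "Suc s \<noteq> Suc (Suc s)" by simp
    show "real_type net_action (Y (Suc s))" "real_type net_action (Y (Suc (Suc s)))"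
      "rep_iso net_action (Y (Suc s)) net_action (Y (Suc (Suc s)))"
      "rep_iso net_action X (prod_action net_action net_action) (Y (Suc s) \<times> Y (Suc (Suc s)))"
      using t iso iX Y(2,3) by simp_all
  qed (use Y(1) in auto)
  obtain f where f: "rep_map net_action U2 net_action U1 f" "bij_betw f U2 U1"
    using iso rep_iso_iff[OF s2] by blast
  obtain g where g: "rep_map net_action U1 net_action U2 g" "\<And>x. x \<in> U2 \<Longrightarrow> g (f x) = x"
    "\<And>y. y \<in> U1 \<Longrightarrow> f (g y) = y"
    by (rule rep_map_inverse[OF s2 f]) auto
  let ?P = "prod_action net_action net_action :: 's \<Rightarrow> ('v, 's) net \<times> ('v, 's) net \<Rightarrow> _"
  \<comment> \<open>The quarter turn \<open>(a, b)\<close> to \<open>(- b, a)\<close>, with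
    \<open>f\<close> and \<open>g\<close> identifying the copies; being mutually inverse, they make
    its square -1.\<close>
  define K where "K = (\<lambda>z. (- g (snd z), f (fst z)))"
  note fl = rep_mapD(1)[OF f(1)] and gl = rep_mapD(1)[OF g(1)]
  have lA: "linear (net_action \<sigma> :: ('v, 's) net \<Rightarrow> _)" for \<sigma> :: 's
    using lact unfolding linear_action_def by blast
  have lK: "linear K"
    unfolding K_def
    by (rule linearI) (simp_all add: linear_add[OF fl] linear_add[OF gl] linear_scale[OF fl] linear_scale[OF gl])
  have K: "rep_map ?P (U2 \<times> U1) ?P (U2 \<times> U1) K"
  proof (rule rep_mapI[OF lK])
    fix z :: "('v, 's) net \<times> ('v, 's) net" and \<sigma> :: 's assume z: "z \<in> U2 \<times> U1"
    then show "K z \<in> U2 \<times> U1"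
      unfolding K_def using rep_mapD(2)[OF f(1)] rep_mapD(2)[OF g(1)] subspace_neg[OF subrepD(1)[OF s2]]
      by auto
    show "K (?P \<sigma> z) = ?P \<sigma> (K z)"
      using z rep_mapD(3)[OF f(1)] rep_mapD(3)[OF g(1)]
      unfolding K_def prod_action_def by (auto simp: linear_neg[OF lA])
  qed
  have KK: "K (K z) = - z" if "z \<in> U2 \<times> U1" for z
    using that g(2,3) unfolding K_def by (auto simp: linear_neg[OF fl])
  obtain h where h: "rep_map net_action X ?P (U2 \<times> U1) h" "bij_betw h X (U2 \<times> U1)"
    using iX rep_iso_iff[OF sX] by blast
  obtain k where k: "rep_map ?P (U2 \<times> U1) net_action X k" "\<And>x. x \<in> X \<Longrightarrow> k (h x) = x"
    "\<And>y. y \<in> U2 \<times> U1 \<Longrightarrow> h (k y) = y"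
    by (rule rep_map_inverse[OF sX h]) auto
  have J: "rep_map net_action X net_action X (\<lambda>x. k (K (h x)))"
    by (rule rep_map_compose[OF h(1) rep_map_compose[OF K k(1)]])
  have JJ: "k (K (h (k (K (h x))))) = - x" if "x \<in> X" for x
    using k(3)[OF rep_mapD(2)[OF K rep_mapD(2)[OF h(1) that]]] KK[OF rep_mapD(2)[OF h(1) that]]
      k(2)[OF that] by (simp add: linear_neg[OF rep_mapD(1)[OF k(1)]])
  have "U2 \<subseteq> X" using dsumD(3)[OF da(2)] by blast
  then have nz: "X \<noteq> {0}"
    using indecomposableD(2)[OF U2] subspace_0[OF subrepD(1)[OF s2]] by blast
  have "generic_Hopf_center X"
    by (rule generic_Hopf_center_realization[OF sX W dsum_sym[OF da(1)] nz J JJ gen])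
  then show ?thesis using iX by blast
qed


section \<open>Krull-Schmidt arguments and the comparison of dimensions\<close>

lemma rep_iso_dim:
  fixes A :: "'s \<Rightarrow> 'a \<Rightarrow> 'a::euclidean_space" and B :: "'s \<Rightarrow> 'b \<Rightarrow> 'b::euclidean_space"
  assumes U: "subrep A U" and iso: "rep_iso A U B W"
  shows "dim U = dim W"
proof -
  obtain f where f: "rep_map A U B W f" "bij_betw f U W" using iso rep_iso_iff[OF U] by blast
  have "dim (f ` U) = dim U"
    using f(2) subrepD(1)[OF U] unfolding bij_betw_def
    by (intro dim_image_eq[OF rep_mapD(1)[OF f(1)]]) (simp add: span_eq_iff[THEN iffD2])
  then show ?thesis using f(2) unfolding bij_betw_def by simp
qed

lemma rep_iso_image:
  assumes U: "subrep A U" and f: "rep_map A U B W f" "inj_on f U"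
  shows "rep_iso A U B (f ` U)"
proof -
  have "rep_map A U B (f ` U) f" using f(1) unfolding rep_map_def by blast
  then show ?thesis using f(2) rep_iso_iff[OF U] unfolding bij_betw_def by blast
qed

text \<open>The hypothesis \<open>id\<close> exhibits the second space as a summand of finitely many
  copies of the first. The identity of \<open>Y' a\<close> is then the sum, over components
  \<open>i\<close> and copies \<open>k\<close>, of its passages through \<open>Y i\<close> in copy
  \<open>k\<close>. Locality makes one passage injective, and \<open>rep_map_split_bij_betw\<close>
  turns it into an isomorphism.\<close>

lemma summand_rep_iso_component:
  fixes A :: "'s \<Rightarrow> 'a \<Rightarrow> 'a::euclidean_space" and B :: "'s \<Rightarrow> 'b \<Rightarrow> 'b::euclidean_space"
  assumes A: "linear_action A" and B: "linear_action B" and K: "finite K"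
    and emb: "\<And>k. k \<in> K \<Longrightarrow> rep_map A UNIV B UNIV (emb k)"
    and pr: "\<And>k. k \<in> K \<Longrightarrow> rep_map B UNIV A UNIV (pr k)"
    and id: "\<And>x. (\<Sum>k\<in>K. emb k (pr k x)) = x"
    and D: "decomposition A UNIV s Y" and D': "decomposition B UNIV s' Y'" and a: "a \<in> {1..s'}"
  shows "\<exists>i\<in>{1..s}. rep_iso B (Y' a) A (Y i)"
proof -
  obtain e where e: "\<And>i. i \<in> {1..s} \<Longrightarrow> rep_map A UNIV A (Y i) (e i)"
    "\<And>x. (\<Sum>i\<in>{1..s}. e i x) = x"
    by (rule decomposition_projections[OF A D]) auto
  obtain q where q: "\<And>i. i \<in> {1..s'} \<Longrightarrow> rep_map B UNIV B (Y' i) (q i)"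
    "\<And>i x. i \<in> {1..s'} \<Longrightarrow> x \<in> Y' i \<Longrightarrow> q i x = x"
    by (rule decomposition_projections[OF B D']) auto
  have U: "indecomposable B (Y' a)" using D' a unfolding decomposition_def by blast
  note sU = indecomposableD(1)[OF U]
  define f where "f = (\<lambda>i k x. e i (pr k x))"
  define g where "g = (\<lambda>k x. q a (emb k x))"
  have f: "rep_map B (Y' a) A (Y i) (f i k)" if "i \<in> {1..s}" "k \<in> K" for i k
    unfolding f_def by (rule rep_map_subset[OF rep_map_compose[OF pr[OF that(2)] e(1)[OF that(1)]]]) auto
  have g: "rep_map A (Y i) B (Y' a) (g k)" if "k \<in> K" for i k
    unfolding g_def by (rule rep_map_subset[OF rep_map_compose[OF emb[OF that] q(1)[OF a]]]) auto
  let ?h = "\<lambda>t x. g (snd t) (f (fst t) (snd t) x)"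
  have sum: "(\<Sum>t\<in>{1..s} \<times> K. ?h t x) = q a x" for x
  proof -
    note ql = rep_mapD(1)[OF q(1)[OF a]]
    have "(\<Sum>t\<in>{1..s} \<times> K. ?h t x) = (\<Sum>i\<in>{1..s}. \<Sum>k\<in>K. g k (f i k x))"
      by (simp add: sum.cartesian_product split_beta)
    also have "\<dots> = (\<Sum>k\<in>K. \<Sum>i\<in>{1..s}. g k (f i k x))" by (rule sum.swap)
    also have "\<dots> = (\<Sum>k\<in>K. q a (emb k (pr k x)))"
    proof (rule sum.cong[OF refl])
      fix k assume k: "k \<in> K"
      have "(\<Sum>i\<in>{1..s}. g k (f i k x)) = q a (emb k (\<Sum>i\<in>{1..s}. e i (pr k x)))"
        unfolding g_def f_def linear_sum[OF rep_mapD(1)[OF emb[OF k]]] linear_sum[OF ql] ..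
      then show "(\<Sum>i\<in>{1..s}. g k (f i k x)) = q a (emb k (pr k x))" unfolding e(2) .
    qed
    also have "\<dots> = q a x" unfolding linear_sum[OF ql, symmetric] id ..
    finally show ?thesis .
  qed
  have "\<exists>t\<in>{1..s} \<times> K. inj_on (?h t) (Y' a)"
  proof (rule endo_sum_inj_on[OF B U])
    show "finite ({1..s} \<times> K)" using K by simp
    show "rep_map B (Y' a) B (Y' a) (?h t)" if "t \<in> {1..s} \<times> K" for t
      using that by (intro rep_map_compose[OF f g]) auto
    show "inj_on (\<lambda>x. \<Sum>t\<in>{1..s} \<times> K. ?h t x) (Y' a)"
      unfolding sum by (rule inj_onI) (simp add: q(2)[OF a])
  qed
  then obtain i k where ik: "i \<in> {1..s}" "k \<in> K" "inj_on (\<lambda>x. g k (f i k x)) (Y' a)" by auto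
  have Yi: "indecomposable A (Y i)" using D ik(1) unfolding decomposition_def by blast
  have "bij_betw (f i k) (Y' a) (Y i)"
    by (rule rep_map_split_bij_betw[OF B U Yi f[OF ik(1,2)] g[OF ik(2)] ik(3)])
  then show ?thesis using rep_iso_iff[OF sU] f[OF ik(1,2)] ik(1) by blast
qed

text \<open>The identity of \<open>U\<close> is the sum of its passages through the two factors;
  locality makes one of them injective.\<close>

lemma retract_of_Times_rep_iso:
  fixes A :: "'s \<Rightarrow> 'a \<Rightarrow> 'a::euclidean_space" and B :: "'s \<Rightarrow> 'b \<Rightarrow> 'b::euclidean_space"
  assumes A: "linear_action A" and B: "linear_action B"
    and U: "indecomposable A U" and Z1: "indecomposable B Z1" and Z2: "indecomposable B Z2"
    and f: "rep_map A U (prod_action B B) (Z1 \<times> Z2) f"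
    and g: "rep_map (prod_action B B) (Z1 \<times> Z2) A U g" and gf: "\<And>x. x \<in> U \<Longrightarrow> g (f x) = x"
  shows "rep_iso A U B Z1 \<or> rep_iso A U B Z2"
proof -
  note sU = indecomposableD(1)[OF U] and gl = rep_mapD(1)[OF g]
  have s0: "0 \<in> Z1" "0 \<in> Z2"
    using subspace_0 subrepD(1)[OF indecomposableD(1)[OF Z1]] subrepD(1)[OF indecomposableD(1)[OF Z2]]
    by auto
  have B0: "B \<sigma> 0 = 0" for \<sigma> using B unfolding linear_action_def by (simp add: linear_0)
  have l1: "linear (\<lambda>z :: 'b. (z, 0 :: 'b))" "linear (\<lambda>z :: 'b. (0 :: 'b, z))"
    by (auto intro!: linearI)
  have f1: "rep_map A U B Z1 (\<lambda>x. fst (f x))"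
    by (rule rep_map_compose[OF f]) (auto simp: rep_map_def prod_action_def linear_fst)
  have f2: "rep_map A U B Z2 (\<lambda>x. snd (f x))"
    by (rule rep_map_compose[OF f]) (auto simp: rep_map_def prod_action_def linear_snd)
  have g1: "rep_map B Z1 A U (\<lambda>z. g (z, 0))"
    by (rule rep_map_compose[OF _ g]) (auto simp: rep_map_def prod_action_def l1 s0 B0)
  have g2: "rep_map B Z2 A U (\<lambda>z. g (0, z))"
    by (rule rep_map_compose[OF _ g]) (auto simp: rep_map_def prod_action_def l1 s0 B0)
  have sum: "g (fst (f x), 0) + g (0, snd (f x)) = x" if "x \<in> U" for x
    using gf[OF that] by (simp add: linear_add[OF gl, symmetric])
  have "inj_on (\<lambda>x. g (fst (f x), 0)) U \<or> inj_on (\<lambda>x. g (0, snd (f x))) U"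
  proof (rule endo_add_inj_on[OF A U rep_map_compose[OF f1 g1] rep_map_compose[OF f2 g2]])
    show "inj_on (\<lambda>x. g (fst (f x), 0) + g (0, snd (f x))) U"
      using sum by (metis (no_types, lifting) inj_onI)
  qed
  then show ?thesis
  proof
    assume "inj_on (\<lambda>x. g (fst (f x), 0)) U"
    from rep_map_split_bij_betw[OF A U Z1 f1 g1 this] show ?thesis
      using rep_iso_iff[OF sU] f1 by blast
  next
    assume "inj_on (\<lambda>x. g (0, snd (f x))) U"
    from rep_map_split_bij_betw[OF A U Z2 f2 g2 this] show ?thesis
      using rep_iso_iff[OF sU] f2 by blast
  qed
qed

text \<open>If only one \<open>Y i\<close> were isomorphic to \<open>Z = Y' a\<close>, the matrix \<open>(\<pi> p \<circ> \<iota> q)\<close> of the two copies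
  of \<open>Z\<close> in \<open>Y'\<close> would be congruent, modulo the non-invertible endomorphisms of \<open>Z\<close>, to one that
  factors through \<open>Y i\<close>; its diagonal being invertible, so would be its off-diagonal entries,
  which vanish.\<close>

lemma decomposition_repeated_component:
  fixes A :: "'s \<Rightarrow> 'a \<Rightarrow> 'a::euclidean_space"
  assumes A: "linear_action A" and D: "decomposition A UNIV s Y" and D': "decomposition A UNIV s' Y'"
    and ab: "a \<in> {1..s'}" "b \<in> {1..s'}" "a \<noteq> b" and iso: "rep_iso A (Y' a) A (Y' b)"
  shows "\<exists>i\<in>{1..s}. \<exists>j\<in>{1..s}. i \<noteq> j \<and> rep_iso A (Y' a) A (Y i) \<and> rep_iso A (Y' a) A (Y j)"
proof -
  obtain e where e: "\<And>i. i \<in> {1..s} \<Longrightarrow> rep_map A UNIV A (Y i) (e i)"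
    "\<And>x. (\<Sum>i\<in>{1..s}. e i x) = x"
    by (rule decomposition_projections[OF A D]) auto
  obtain q where q: "\<And>i. i \<in> {1..s'} \<Longrightarrow> rep_map A UNIV A (Y' i) (q i)"
    "\<And>i x. i \<in> {1..s'} \<Longrightarrow> x \<in> Y' i \<Longrightarrow> q i x = x"
    "\<And>i j x. i \<in> {1..s'} \<Longrightarrow> j \<in> {1..s'} \<Longrightarrow> i \<noteq> j \<Longrightarrow> x \<in> Y' j \<Longrightarrow> q i x = 0"
    by (rule decomposition_projections[OF A D']) auto
  define Z where "Z = Y' a"
  have Z: "indecomposable A Z" using D' ab unfolding decomposition_def Z_def by blast
  have Yi: "indecomposable A (Y i)" if "i \<in> {1..s}" for i
    using D that unfolding decomposition_def by blast
  note sZ = indecomposableD(1)[OF Z]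
  obtain \<phi> where \<phi>: "rep_map A Z A (Y' b) \<phi>" "bij_betw \<phi> Z (Y' b)"
    using iso rep_iso_iff[OF sZ] unfolding Z_def by blast
  obtain \<psi> where \<psi>: "rep_map A (Y' b) A Z \<psi>" "\<And>x. x \<in> Z \<Longrightarrow> \<psi> (\<phi> x) = x"
    by (rule rep_map_inverse[OF sZ \<phi>]) auto
  \<comment> \<open>The Boolean index selects a copy of \<open>Z\<close>: \<open>True\<close> is
    \<open>Y' a\<close>, \<open>False\<close> is \<open>Y' b\<close> identified with
    \<open>Z\<close> by \<open>\<phi>\<close>.\<close>
  define \<iota> where "\<iota> p = (if p then (\<lambda>x. x) else \<phi>)" for p
  define \<pi> where "\<pi> p = (if p then q a else (\<lambda>x. \<psi> (q b x)))" for p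
  have \<iota>: "rep_map A Z A UNIV (\<iota> p)" for p
    unfolding \<iota>_def
    using rep_map_subset[OF rep_map_id order_refl subset_UNIV, of A Z]
      rep_map_subset[OF \<phi>(1) order_refl subset_UNIV] by simp
  have \<pi>: "rep_map A UNIV A Z (\<pi> p)" for p
    unfolding \<pi>_def using q(1)[OF ab(1)] rep_map_compose[OF q(1)[OF ab(2)] \<psi>(1)] by (simp add: Z_def)
  have diag: "\<pi> p (\<iota> p x) = x" if "x \<in> Z" for p x
    using that rep_mapD(2)[OF \<phi>(1) that] \<psi>(2) q(2) ab unfolding \<pi>_def \<iota>_def by (simp add: Z_def)
  have off: "\<pi> True (\<iota> False x) = 0" if "x \<in> Z" for x
    using q(3)[OF ab(1,2,3) rep_mapD(2)[OF \<phi>(1) that]] unfolding \<pi>_def \<iota>_def by simp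
  define f where "f = (\<lambda>i p x. e i (\<iota> p x))"
  have f: "rep_map A Z A (Y i) (f i p)" if "i \<in> {1..s}" for i p
    unfolding f_def by (rule rep_map_compose[OF \<iota> e(1)[OF that]])
  have \<pi>Y: "rep_map A (Y i) A Z (\<pi> p)" for i p by (rule rep_map_subset[OF \<pi>]) auto
  have sum: "(\<Sum>i\<in>{1..s}. \<pi> p (f i p' x)) = \<pi> p (\<iota> p' x)" for p p' x
    unfolding f_def linear_sum[OF rep_mapD(1)[OF \<pi>], symmetric] e(2) ..
  have split: "bij_betw (f i p') Z (Y i)" if "i \<in> {1..s}" "inj_on (\<lambda>x. \<pi> p (f i p' x)) Z" for i p p'
    by (rule rep_map_split_bij_betw[OF A Z Yi[OF that(1)] f[OF that(1)] \<pi>Y that(2)])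
  then have isoY: "rep_iso A Z A (Y i)" if "i \<in> {1..s}" "inj_on (\<lambda>x. \<pi> p (f i p' x)) Z" for i p p'
    using rep_iso_iff[OF sZ] f that by blast
  have ex: "\<exists>i\<in>{1..s}. inj_on (\<lambda>x. \<pi> p (f i p x)) Z" for p
  proof (rule endo_sum_inj_on[OF A Z])
    show "inj_on (\<lambda>x. \<Sum>i\<in>{1..s}. \<pi> p (f i p x)) Z"
      unfolding sum by (rule inj_onI) (simp add: diag)
  qed (auto intro: rep_map_compose[OF f \<pi>Y])
  show ?thesis
  proof (rule ccontr)
    assume "\<not> ?thesis"
    then have uniq: "i = j" if "i \<in> {1..s}" "j \<in> {1..s}" "rep_iso A Z A (Y i)" "rep_iso A Z A (Y j)" for i j
      using that unfolding Z_def by blast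
    obtain i where i: "i \<in> {1..s}" "inj_on (\<lambda>x. \<pi> True (f i True x)) Z" using ex by blast
    obtain j where j: "j \<in> {1..s}" "inj_on (\<lambda>x. \<pi> False (f j False x)) Z" using ex by blast
    have "i = j" by (rule uniq[OF i(1) j(1) isoY[OF i] isoY[OF j]])
    then have bij: "bij_betw (f i True) Z (Y i)" "bij_betw (f i False) Z (Y i)"
      using split i j by blast+
    \<comment> \<open>Both copies of \<open>Z\<close> are mapped onto the same \<open>Y i\<close>,
      so injectivity of \<open>\<pi> True\<close> on it transfers from the diagonal entry to the
      off-diagonal one.\<close>
    have "inj_on (\<pi> True) (f i True ` Z)"
      using i(2) inj_on_imageI[of "\<pi> True" "f i True" Z] unfolding o_def by blast
    then have "inj_on (\<pi> True) (f i False ` Z)" using bij unfolding bij_betw_def by simp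
    then have inj: "inj_on (\<lambda>x. \<pi> True (f i False x)) Z"
      using comp_inj_on[of "f i False" Z "\<pi> True"] bij(2) unfolding bij_betw_def o_def by blast
    have comp: "rep_map A Z A Z (\<lambda>x. \<pi> True (f k False x))" if "k \<in> {1..s}" for k
      by (rule rep_map_compose[OF f[OF that] \<pi>Y])
    let ?g = "\<lambda>x. \<Sum>k\<in>{1..s} - {i}. \<pi> True (f k False x)"
    have g: "rep_map A Z A Z ?g"
      by (rule rep_map_sum[OF A subrepD(1)[OF sZ] comp]) auto
    \<comment> \<open>The whole off-diagonal entry vanishes, so \<open>?g\<close> is minus an
      injective map; locality then yields an index other than \<open>i\<close>, against
      uniqueness.\<close>
    have "\<pi> True (f i False x) + ?g x = 0" if "x \<in> Z" for x
      using sum[of True False x] off[OF that] sum.remove[OF _ i(1), of "\<lambda>k. \<pi> True (f k False x)"]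
      by simp
    then have "\<pi> True (f i False x) = 0" if "x \<in> Z" "?g x = 0" for x
      using that by fastforce
    then have "inj_on ?g Z"
      using inj unfolding linear_inj_on_iff_eq_0[OF rep_mapD(1)[OF g] subrepD(1)[OF sZ]]
        linear_inj_on_iff_eq_0[OF rep_mapD(1)[OF comp[OF i(1)]] subrepD(1)[OF sZ]] by blast
    then have "\<exists>k\<in>{1..s} - {i}. inj_on (\<lambda>x. \<pi> True (f k False x)) Z"
      using comp by (intro endo_sum_inj_on[OF A Z]) auto
    then obtain k where "k \<in> {1..s}" "k \<noteq> i" "inj_on (\<lambda>x. \<pi> True (f k False x)) Z" by blast
    then show False using uniq[OF _ i(1)] isoY i by blast
  qed
qed

text \<open>Pulls a splitting back along a retraction: subtracting \<open>\<epsilon> u\<close> from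
  \<open>x\<close> removes the \<open>U\<close>-part of \<open>\<pi> x\<close>, and the kernel of
  \<open>\<pi>\<close> goes into the second summand. A general \<open>V'\<close> allows the step to
  be repeated inside the complement found before.\<close>

lemma dsum_embedded:
  assumes \<epsilon>: "linear \<epsilon>" and \<pi>: "linear \<pi>" and \<pi>\<epsilon>: "\<And>x. \<pi> (\<epsilon> x) = x"
    and d: "dsum V U W" and V': "subspace V'" "\<epsilon> ` U \<subseteq> V'" "\<pi> ` V' \<subseteq> V"
  shows "dsum V' (\<epsilon> ` U) {x \<in> V'. \<pi> x \<in> W}"
proof (rule dsumI)
  fix x assume "x \<in> \<epsilon> ` U" "x \<in> {x \<in> V'. \<pi> x \<in> W}"
  then obtain u where "u \<in> U" "x = \<epsilon> u" "\<pi> x \<in> W" by blast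
  then show "x = 0" using dsumD(1)[OF d, of u] \<pi>\<epsilon> linear_0[OF \<epsilon>] by simp
next
  show "0 \<in> \<epsilon> ` U" using dsumD(6)[OF d] linear_0[OF \<epsilon>] by force
  show "0 \<in> {x \<in> V'. \<pi> x \<in> W}"
    using dsumD(7)[OF d] linear_0[OF \<pi>] subspace_0[OF V'(1)] by simp
  show "x + y \<in> V'" if "x \<in> \<epsilon> ` U" "y \<in> {x \<in> V'. \<pi> x \<in> W}" for x y
    using that V'(2) subspace_add[OF V'(1)] by blast
  fix x assume x: "x \<in> V'"
  then have "\<pi> x \<in> V" using V'(3) by blast
  then obtain u w where uw: "u \<in> U" "w \<in> W" "\<pi> x = u + w" using dsumD(5)[OF d] by blast
  have "\<epsilon> u \<in> V'" using uw(1) V'(2) by blast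
  then have "x - \<epsilon> u \<in> {x \<in> V'. \<pi> x \<in> W}"
    using uw(2,3) subspace_diff[OF V'(1) x] by (simp add: linear_diff[OF \<pi>] \<pi>\<epsilon>)
  then show "\<exists>v\<in>\<epsilon> ` U. \<exists>w\<in>{x \<in> V'. \<pi> x \<in> W}. x = v + w"
    using uw(1) by (intro bexI[of _ "\<epsilon> u"] bexI[of _ "x - \<epsilon> u"]) auto
qed

lemma subrep_vimage:
  assumes "subrep B V'" "subrep A W" "rep_map B V' A V \<pi>"
  shows "subrep B {x \<in> V'. \<pi> x \<in> W}"
  unfolding subrep_def image_subset_iff
proof (intro conjI allI ballI)
  note l = rep_mapD(1)[OF assms(3)]
  show "subspace {x \<in> V'. \<pi> x \<in> W}"
    using subrepD(1)[OF assms(1)] subrepD(1)[OF assms(2)]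
    by (simp add: subspace_def linear_0[OF l] linear_add[OF l] linear_scale[OF l])
  show "B \<sigma> x \<in> {x \<in> V'. \<pi> x \<in> W}" if "x \<in> {x \<in> V'. \<pi> x \<in> W}" for \<sigma> x
    using that subrepD(2)[OF assms(1)] subrepD(2)[OF assms(2)] rep_mapD(3)[OF assms(3)] by simp
qed

section \<open>Coordinate copies of the one-dimensional network in the multi-dimensional one\<close>

definition net_emb :: "'d \<Rightarrow> (real, 's) net \<Rightarrow> (real ^ 'd, 's::finite) net" where
  "net_emb k v = (\<chi> \<sigma>. axis k (v $ \<sigma>))"

definition net_proj :: "'d \<Rightarrow> (real ^ 'd, 's::finite) net \<Rightarrow> (real, 's) net" where
  "net_proj k w = (\<chi> \<sigma>. w $ \<sigma> $ k)"

lemma rep_map_net_emb: "rep_map net_action UNIV net_action UNIV (net_emb k)"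
  by (rule rep_mapI)
    (auto intro!: linearI simp: net_emb_def net_action_def vec_eq_iff axis_def)

lemma rep_map_net_proj: "rep_map net_action UNIV net_action UNIV (net_proj k)"
  by (rule rep_mapI)
    (auto intro!: linearI simp: net_proj_def net_action_def vec_eq_iff)

lemma net_proj_emb: "net_proj k (net_emb l v) = (if k = l then v else 0)"
  by (simp add: net_proj_def net_emb_def vec_eq_iff axis_def)

lemma sum_net_emb_proj: "(\<Sum>k\<in>UNIV. net_emb k (net_proj k w)) = w"
  by (simp add: net_proj_def net_emb_def vec_eq_iff axis_def)

lemma inj_net_emb: "inj_on (net_emb k) U"
  by (rule inj_onI) (metis net_proj_emb)

lemma rep_iso_net_emb:
  "subrep net_action U \<Longrightarrow> rep_iso net_action U net_action (net_emb k ` U)"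
  by (rule rep_iso_image[OF _ rep_map_subset[OF rep_map_net_emb] inj_net_emb]) auto

lemma subrep_net_emb: "subrep net_action U \<Longrightarrow> subrep net_action (net_emb k ` U)"
  by (rule rep_map_image_subrep[OF _ rep_map_subset[OF rep_map_net_emb]]) auto

lemma subrep_UNIV: "subrep A UNIV"
  unfolding subrep_def by simp

lemma exists_generic_Hopf_center_complex_or_quaternionic:
  fixes U W :: "(real, 's::{finite, monoid_mult}) net set"
  assumes U: "indecomposable net_action U" and W: "subrep net_action W" and d: "dsum UNIV U W"
    and t: "complex_type net_action U \<or> quaternionic_type net_action U"
  shows "\<exists>X :: (real ^ 'd, 's) net set. generic_Hopf_center X \<and> rep_iso net_action U net_action X"
proof -
  note sU = indecomposableD(1)[OF U] and lact = linear_action_net_action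
  \<comment> \<open>Any coordinate will do; index types are nonempty.\<close>
  obtain k :: 'd where True by blast
  let ?X = "net_emb k ` U"
  note iso = rep_iso_net_emb[OF sU, of k] and sX = subrep_net_emb[OF sU, of k]
  have "dsum UNIV ?X {x \<in> UNIV. net_proj k x \<in> W}"
    by (rule dsum_embedded[OF rep_mapD(1)[OF rep_map_net_emb] rep_mapD(1)[OF rep_map_net_proj] _ d])
      (auto simp: net_proj_emb)
  moreover have "subrep net_action {x \<in> UNIV. net_proj k x \<in> W}"
    by (rule subrep_vimage[OF subrep_UNIV W rep_map_net_proj])
  moreover have "indecomposable net_action ?X"
    by (rule indecomposable_rep_iso[OF U sX iso])
  moreover have "complex_type net_action ?X \<or> quaternionic_type net_action ?X"
    by (rule complex_or_quaternionic_type_rep_iso[OF lact lact sU sX iso t])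
  ultimately have "generic_Hopf_center ?X"
    by (intro generic_Hopf_center_complex_or_quaternionic)
  then show ?thesis using iso by blast
qed

text \<open>The coordinates \<open>k\<close> and \<open>l\<close> are free so as to serve two
  situations: two different components inside one copy of the one-dimensional network, and one
  component taken from two copies.\<close>

lemma exists_generic_Hopf_center_real:
  fixes U1 U2 :: "(real, 's::{finite, monoid_mult}) net set" and V W :: "(real ^ 'd, 's) net set"
  assumes U1: "indecomposable net_action U1" and U2: "indecomposable net_action U2"
    and d1: "dsum UNIV (net_emb k ` U1) V" and d2: "dsum V (net_emb l ` U2) W"
    and W: "subrep net_action W"
    and t: "real_type net_action U1" "real_type net_action U2"
    and iso: "rep_iso net_action U2 net_action U1"
  shows "\<exists>X :: (real ^ 'd, 's) net set. generic_Hopf_center X \<and>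
    rep_iso net_action X (prod_action net_action net_action) (U2 \<times> U1)"
proof -
  note s1 = indecomposableD(1)[OF U1] and s2 = indecomposableD(1)[OF U2] and lact = linear_action_net_action
  let ?X1 = "net_emb k ` U1" and ?X2 = "net_emb l ` U2"
  note i1 = rep_iso_net_emb[OF s1, of k] and i2 = rep_iso_net_emb[OF s2, of l]
  note x1 = subrep_net_emb[OF s1, of k] and x2 = subrep_net_emb[OF s2, of l]
  note j1 = rep_iso_sym[OF s1 x1 i1] and j2 = rep_iso_sym[OF s2 x2 i2]
  have iso': "rep_iso net_action ?X2 net_action ?X1"
    by (rule rep_iso_trans[OF x2 s1 rep_iso_trans[OF x2 s2 j2 iso] i1])
  obtain X :: "(real ^ 'd, 's) net set" where X: "generic_Hopf_center X"
    "rep_iso net_action X (prod_action net_action net_action) (?X2 \<times> ?X1)"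
    using generic_Hopf_center_real[OF indecomposable_rep_iso[OF U1 x1 i1]
        indecomposable_rep_iso[OF U2 x2 i2] d1 d2 W
        real_type_rep_iso[OF lact lact s1 x1 i1 t(1)] real_type_rep_iso[OF lact lact s2 x2 i2 t(2)] iso']
    by blast
  have "rep_iso net_action X (prod_action net_action net_action) (U2 \<times> U1)"
    by (rule rep_iso_trans[OF generic_Hopf_center_subrep[OF X(1)] subrep_Times[OF x2 x1] X(2)
          rep_iso_Times[OF x2 x1 j2 j1]])
  then show ?thesis using X(1) by blast
qed

section \<open>Comparison of the generic center subspaces for different internal dimensions\<close>

lemma generic_Hopf_repE:
  assumes "generic_Hopf_rep A B X"
  obtains (one) s Y i where "decomposition A UNIV s Y" "i \<in> {1..s}"
    "complex_type A (Y i) \<or> quaternionic_type A (Y i)" "rep_iso B X A (Y i)"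
  | (two) s Y i j where "decomposition A UNIV s Y" "i \<in> {1..s}" "j \<in> {1..s}" "i \<noteq> j"
    "real_type A (Y i)" "real_type A (Y j)" "rep_iso A (Y i) A (Y j)"
    "rep_iso B X (prod_action A A) (Y i \<times> Y j)"
  using assms unfolding generic_Hopf_rep_def by blast

lemma generic_Hopf_center_rep:
  fixes X :: "('v::euclidean_space, 's::{finite, monoid_mult}) net set"
  assumes "generic_Hopf_center X"
  shows "generic_Hopf_rep (net_action :: 's \<Rightarrow> ('v, 's) net \<Rightarrow> ('v, 's) net) net_action X"
  using assms unfolding generic_Hopf_center_def generic_Hopf_def by blast

lemma decomposition_subrep:
  "decomposition A U s Y \<Longrightarrow> i \<in> {1..s} \<Longrightarrow> indecomposable A (Y i)"
  unfolding decomposition_def by blast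

text \<open>One coordinate copy contains all components of the one-dimensional network, so even the
  pair needed for real type fits into a single copy.\<close>

lemma one_dim_center_exists_multi_dim:
  fixes X :: "(real, 's::{finite, monoid_mult}) net set"
  assumes X: "generic_Hopf_center X"
  shows "\<exists>X' :: (real ^ 'd, 's) net set. generic_Hopf_center X' \<and> rep_iso net_action X net_action X'"
proof -
  note lact = linear_action_net_action and sX = generic_Hopf_center_subrep[OF X]
  from generic_Hopf_center_rep[OF X] show ?thesis
  proof (cases rule: generic_Hopf_repE)
    case (one s Y i)
    have Yi: "indecomposable net_action (Y i)" by (rule decomposition_subrep[OF one(1,2)])
    obtain V where V: "subrep net_action V" "dsum UNIV (Y i) V"
      using decomposition_complement[OF lact one(1,2)] by metis
    obtain X' :: "(real ^ 'd, 's) net set" where X': "generic_Hopf_center X'"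
      "rep_iso net_action (Y i) net_action X'"
      using exists_generic_Hopf_center_complex_or_quaternionic[OF Yi V one(3)] by blast
    have "rep_iso net_action X net_action X'"
      by (rule rep_iso_trans[OF sX indecomposableD(1)[OF Yi] one(4) X'(2)])
    then show ?thesis using X'(1) by blast
  next
    case (two s Y i j)
    have Yi: "indecomposable net_action (Y i)" by (rule decomposition_subrep[OF two(1,2)])
    have Yj: "indecomposable net_action (Y j)" by (rule decomposition_subrep[OF two(1,3)])
    note si = indecomposableD(1)[OF Yi] and sj = indecomposableD(1)[OF Yj]
    note iji = rep_iso_sym[OF si sj two(7)]
    obtain V where V: "subrep net_action V" "dsum UNIV (Y i) V"
      "\<And>j. j \<in> {1..s} \<Longrightarrow> j \<noteq> i \<Longrightarrow> \<exists>W. subrep net_action W \<and> dsum V (Y j) W"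
      using decomposition_complement[OF lact two(1,2)] by metis
    obtain W where W: "subrep net_action W" "dsum V (Y j) W" using V(3)[OF two(3)] two(4) by blast
    obtain k :: 'd where True by blast
    note le = rep_mapD(1)[OF rep_map_net_emb] and lp = rep_mapD(1)[OF rep_map_net_proj]
    let ?V = "{x \<in> UNIV. net_proj k x \<in> V}" and ?W = "{x \<in> {x \<in> UNIV. net_proj k x \<in> V}. net_proj k x \<in> W}"
    have sV: "subrep net_action ?V"
      by (rule subrep_vimage[OF subrep_UNIV V(1) rep_map_net_proj])
    have d1: "dsum UNIV (net_emb k ` Y i) ?V"
      by (rule dsum_embedded[OF le lp _ V(2)]) (auto simp: net_proj_emb)
    have d2: "dsum ?V (net_emb k ` Y j) ?W"
      by (rule dsum_embedded[OF le lp _ W(2) subrepD(1)[OF sV]])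
        (use dsumD(3)[OF W(2)] in \<open>auto simp: net_proj_emb\<close>)
    have sW: "subrep net_action ?W"
      by (rule subrep_vimage[OF sV W(1) rep_map_subset[OF rep_map_net_proj subset_UNIV order_refl]])
    obtain X' :: "(real ^ 'd, 's) net set" where X': "generic_Hopf_center X'"
      "rep_iso net_action X' (prod_action net_action net_action) (Y j \<times> Y i)"
      using exists_generic_Hopf_center_real[OF Yi Yj d1 d2 sW two(5,6) iji] by blast
    have "rep_iso net_action X' (prod_action net_action net_action) (Y i \<times> Y j)"
      by (rule rep_iso_trans[OF generic_Hopf_center_subrep[OF X'(1)] subrep_Times[OF sj si] X'(2)
            rep_iso_Times[OF sj si iji two(7)]])
    from rep_iso_sym[OF generic_Hopf_center_subrep[OF X'(1)] subrep_Times[OF si sj] this]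
    have "rep_iso net_action X net_action X'"
      by (rule rep_iso_trans[OF sX subrep_Times[OF si sj] two(8)])
    then show ?thesis using X'(1) by blast
  qed
qed

lemma exists_doubled_multi_dim_center:
  fixes U W :: "(real, 's::{finite, monoid_mult}) net set"
  assumes U: "indecomposable net_action U" and W: "subrep net_action W" and d: "dsum UNIV U W"
    and t: "real_type net_action U" and card: "CARD('d) \<ge> 2"
  shows "\<exists>X :: (real ^ 'd, 's) net set. generic_Hopf_center X \<and>
    rep_iso net_action X (prod_action net_action net_action) (U \<times> U)"
proof -
  note s = indecomposableD(1)[OF U]
  obtain k l :: 'd where kl: "k \<noteq> l"
    using card card_le_Suc0_iff_eq[of "UNIV :: 'd set"] by fastforce
  note le = rep_mapD(1)[OF rep_map_net_emb] and lp = rep_mapD(1)[OF rep_map_net_proj]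
  let ?V = "{x \<in> UNIV. net_proj k x \<in> W}" and ?W = "{x \<in> {x \<in> UNIV. net_proj k x \<in> W}. net_proj l x \<in> W}"
  have sV: "subrep net_action ?V"
    by (rule subrep_vimage[OF subrep_UNIV W rep_map_net_proj])
  have d1: "dsum UNIV (net_emb k ` U) ?V"
    by (rule dsum_embedded[OF le lp _ d]) (auto simp: net_proj_emb)
  \<comment> \<open>Copy \<open>l\<close> lies in \<open>?V\<close> because it is annihilated by
    \<open>net_proj k\<close> for \<open>k \<noteq> l\<close>.\<close>
  have d2: "dsum ?V (net_emb l ` U) ?W"
    by (rule dsum_embedded[OF le lp _ d subrepD(1)[OF sV]])
      (use kl dsumD(7)[OF d] in \<open>auto simp: net_proj_emb\<close>)
  have sW: "subrep net_action ?W"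
    by (rule subrep_vimage[OF sV W rep_map_subset[OF rep_map_net_proj subset_UNIV order_refl]])
  show ?thesis
    by (rule exists_generic_Hopf_center_real[OF U U d1 d2 sW t t rep_iso_refl[OF s]])
qed

text \<open>If \<open>X\<close> is a single component, it is isomorphic both to \<open>Y i\<close>
  and to its square, which the dimensions forbid. If it is a pair from some decomposition,
  \<open>Y i\<close> is isomorphic to both members, and
  \<open>decomposition_repeated_component\<close> carries the repetition over to
  \<open>Y\<close>.\<close>

lemma no_doubled_one_dim_center:
  fixes Y :: "nat \<Rightarrow> ('v::euclidean_space, 's::{finite, monoid_mult}) net set"
  assumes D: "decomposition net_action UNIV s Y" and i: "i \<in> {1..s}"
    and uniq: "\<And>j. j \<in> {1..s} - {i} \<Longrightarrow> \<not> rep_iso net_action (Y i) net_action (Y j)"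
    and X: "generic_Hopf_center (X :: ('v, 's) net set)"
    and iso: "rep_iso net_action X (prod_action net_action net_action) (Y i \<times> Y i)"
  shows False
proof -
  note lact = linear_action_net_action and sX = generic_Hopf_center_subrep[OF X]
  have Yi: "indecomposable net_action (Y i)" by (rule decomposition_subrep[OF D i])
  note si = indecomposableD(1)[OF Yi]
  note sii = subrep_Times[OF si si]
  note iso' = rep_iso_sym[OF sX sii iso]
  from generic_Hopf_center_rep[OF X] show False
  proof (cases rule: generic_Hopf_repE)
    case (one s' Y' a)
    have Ya: "indecomposable net_action (Y' a)" by (rule decomposition_subrep[OF one(1,2)])
    note sa = indecomposableD(1)[OF Ya]
    have ia: "rep_iso net_action (Y' a) (prod_action net_action net_action) (Y i \<times> Y i)"
      by (rule rep_iso_trans[OF sa sX rep_iso_sym[OF sX sa one(4)] iso])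
    obtain f where f: "rep_map net_action (Y' a) (prod_action net_action net_action) (Y i \<times> Y i) f"
      "bij_betw f (Y' a) (Y i \<times> Y i)" using ia rep_iso_iff[OF sa] by blast
    obtain g where g: "rep_map (prod_action net_action net_action) (Y i \<times> Y i) net_action (Y' a) g"
      "\<And>x. x \<in> Y' a \<Longrightarrow> g (f x) = x"
      by (rule rep_map_inverse[OF sa f]) auto
    have iai: "rep_iso net_action (Y' a) net_action (Y i)"
      using retract_of_Times_rep_iso[OF lact lact Ya Yi Yi f(1) g] by blast
    \<comment> \<open>The right-hand side is twice the left-hand side, so \<open>Y i\<close> would
      be zero.\<close>
    have "dim (Y i) = dim (Y i \<times> Y i)"
      using rep_iso_dim[OF sa iai] rep_iso_dim[OF sa ia] by simp
    then have "dim (Y i) = 0"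
      using dim_Times[OF subrepD(1)[OF si] subrepD(1)[OF si]] by simp
    then show False
      using indecomposableD(2)[OF Yi] subspace_0[OF subrepD(1)[OF si]] by auto
  next
    case (two s' Y' a b)
    have Ya: "indecomposable net_action (Y' a)" by (rule decomposition_subrep[OF two(1,2)])
    have Yb: "indecomposable net_action (Y' b)" by (rule decomposition_subrep[OF two(1,3)])
    note sa = indecomposableD(1)[OF Ya] and sb = indecomposableD(1)[OF Yb]
    have "rep_iso (prod_action net_action net_action) (Y i \<times> Y i)
      (prod_action net_action net_action) (Y' a \<times> Y' b)"
      by (rule rep_iso_trans[OF sii sX iso' two(8)])
    then obtain f where f: "rep_map (prod_action net_action net_action) (Y i \<times> Y i)
      (prod_action net_action net_action) (Y' a \<times> Y' b) f" "bij_betw f (Y i \<times> Y i) (Y' a \<times> Y' b)"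
      using rep_iso_iff[OF sii] by blast
    obtain g where g: "rep_map (prod_action net_action net_action) (Y' a \<times> Y' b)
      (prod_action net_action net_action) (Y i \<times> Y i) g"
      "\<And>x. x \<in> Y i \<times> Y i \<Longrightarrow> g (f x) = x"
      by (rule rep_map_inverse[OF sii f]) auto
    have 0: "0 \<in> Y i" using subspace_0[OF subrepD(1)[OF si]] .
    have A0: "net_action \<sigma> 0 = (0 :: ('v, 's) net)" for \<sigma> :: 's
      by (simp add: net_action_def vec_eq_iff)
    have l1: "linear (\<lambda>z :: ('v, 's) net. (z, 0 :: ('v, 's) net))" by (auto intro!: linearI)
    have in1: "rep_map net_action (Y i) (prod_action net_action net_action) (Y i \<times> Y i) (\<lambda>z. (z, 0))"
      using l1 0 A0 unfolding rep_map_def prod_action_def by auto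
    have pr1: "rep_map (prod_action net_action net_action) (Y i \<times> Y i) net_action (Y i) fst"
      unfolding rep_map_def prod_action_def by (auto simp: linear_fst)
    have "rep_iso net_action (Y i) net_action (Y' a) \<or> rep_iso net_action (Y i) net_action (Y' b)"
      by (rule retract_of_Times_rep_iso[OF lact lact Yi Ya Yb rep_map_compose[OF in1 f(1)]
            rep_map_compose[OF g(1) pr1]]) (simp add: g(2) 0)
    then have ia: "rep_iso net_action (Y i) net_action (Y' a)"
      using rep_iso_trans[OF si sb _ rep_iso_sym[OF sa sb two(7)]] by blast
    obtain j k where jk: "j \<in> {1..s}" "k \<in> {1..s}" "j \<noteq> k" "rep_iso net_action (Y' a) net_action (Y j)"
      "rep_iso net_action (Y' a) net_action (Y k)"
      using decomposition_repeated_component[OF lact D two(1-4,7)] by blast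
    then have "rep_iso net_action (Y i) net_action (Y j)" "rep_iso net_action (Y i) net_action (Y k)"
      using rep_iso_trans[OF si sa ia] by blast+
    then show False using uniq[of j] uniq[of k] jk(1-3) by blast
  qed
qed

text \<open>The components of \<open>X'\<close> already occur in the one-dimensional network. For a
  single component this is enough; for a pair, two different indices of \<open>Y\<close> are needed,
  and their existence is exactly what \<open>not_doubled\<close> encodes.\<close>

lemma multi_dim_center_one_dim:
  fixes Y :: "nat \<Rightarrow> (real, 's::{finite, monoid_mult}) net set" and X' :: "(real ^ 'd, 's) net set"
  assumes D: "decomposition net_action UNIV s Y" and X': "generic_Hopf_center X'"
    and not_doubled: "\<not> (\<exists>i\<in>{1..s}. real_type net_action (Y i) \<and>
      (\<forall>j\<in>{1..s} - {i}. \<not> rep_iso net_action (Y i) net_action (Y j)) \<and>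
      rep_iso net_action X' (prod_action net_action net_action) (Y i \<times> Y i))"
  shows "\<exists>X :: (real, 's) net set. generic_Hopf_center X \<and> rep_iso net_action X net_action X'"
proof -
  note lact = linear_action_net_action and sX' = generic_Hopf_center_subrep[OF X']
  have comp: "\<exists>i\<in>{1..s}. rep_iso net_action (Y' a) net_action (Y i)"
    if "decomposition net_action UNIV s' Y'" "a \<in> {1..s'}"
    for s' and Y' :: "nat \<Rightarrow> (real ^ 'd, 's) net set" and a
    by (rule summand_rep_iso_component[OF lact lact finite_class.finite_UNIV rep_map_net_emb rep_map_net_proj
          sum_net_emb_proj D that])
  from generic_Hopf_center_rep[OF X'] show ?thesis
  proof (cases rule: generic_Hopf_repE)
    case (one s' Y' a)
    have Ya: "indecomposable net_action (Y' a)" by (rule decomposition_subrep[OF one(1,2)])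
    note sa = indecomposableD(1)[OF Ya]
    obtain i where i: "i \<in> {1..s}" "rep_iso net_action (Y' a) net_action (Y i)"
      using comp[OF one(1,2)] by blast
    have Yi: "indecomposable net_action (Y i)" by (rule decomposition_subrep[OF D i(1)])
    note si = indecomposableD(1)[OF Yi]
    obtain V where V: "subrep net_action V" "dsum UNIV (Y i) V"
      using decomposition_complement[OF lact D i(1)] by metis
    have "generic_Hopf_center (Y i)"
      by (rule generic_Hopf_center_complex_or_quaternionic[OF Yi V
            complex_or_quaternionic_type_rep_iso[OF lact lact sa si i(2) one(3)]])
    moreover have "rep_iso net_action (Y i) net_action X'"
      by (rule rep_iso_trans[OF si sa rep_iso_sym[OF sa si i(2)] rep_iso_sym[OF sX' sa one(4)]])
    ultimately show ?thesis by blast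
  next
    case (two s' Y' a b)
    have Ya: "indecomposable net_action (Y' a)" by (rule decomposition_subrep[OF two(1,2)])
    have Yb: "indecomposable net_action (Y' b)" by (rule decomposition_subrep[OF two(1,3)])
    note sa = indecomposableD(1)[OF Ya] and sb = indecomposableD(1)[OF Yb]
    obtain i where i: "i \<in> {1..s}" "rep_iso net_action (Y' a) net_action (Y i)"
      using comp[OF two(1,2)] by blast
    have Yi: "indecomposable net_action (Y i)" by (rule decomposition_subrep[OF D i(1)])
    note si = indecomposableD(1)[OF Yi]
    have ib: "rep_iso net_action (Y' b) net_action (Y i)"
      by (rule rep_iso_trans[OF sb sa rep_iso_sym[OF sa sb two(7)] i(2)])
    have X'i: "rep_iso net_action X' (prod_action net_action net_action) (Y i \<times> Y i)"
      by (rule rep_iso_trans[OF sX' subrep_Times[OF sa sb] two(8) rep_iso_Times[OF sa sb i(2) ib]])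
    have ti: "real_type net_action (Y i)"
      by (rule real_type_rep_iso[OF lact lact sa si i(2) two(5)])
    \<comment> \<open>Real type and the isomorphism with the square hold for this \<open>i\<close>,
      so only the uniqueness clause of \<open>not_doubled\<close> can fail.\<close>
    obtain j where j: "j \<in> {1..s}" "j \<noteq> i" "rep_iso net_action (Y i) net_action (Y j)"
      using not_doubled i(1) ti X'i by blast
    have Yj: "indecomposable net_action (Y j)" by (rule decomposition_subrep[OF D j(1)])
    note sj = indecomposableD(1)[OF Yj]
    have tj: "real_type net_action (Y j)"
      by (rule real_type_rep_iso[OF lact lact si sj j(3) ti])
    note iji = rep_iso_sym[OF si sj j(3)]
    obtain V where V: "subrep net_action V" "dsum UNIV (Y i) V"
      "\<And>j. j \<in> {1..s} \<Longrightarrow> j \<noteq> i \<Longrightarrow> \<exists>W. subrep net_action W \<and> dsum V (Y j) W"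
      using decomposition_complement[OF lact D i(1)] by metis
    obtain W where W: "subrep net_action W" "dsum V (Y j) W" using V(3)[OF j(1,2)] by blast
    obtain X :: "(real, 's) net set" where X: "generic_Hopf_center X"
      "rep_iso net_action X (prod_action net_action net_action) (Y j \<times> Y i)"
      using generic_Hopf_center_real[OF Yi Yj V(2) W(2,1) ti tj iji] by blast
    note sX = generic_Hopf_center_subrep[OF X(1)]
    have "rep_iso net_action X (prod_action net_action net_action) (Y i \<times> Y i)"
      by (rule rep_iso_trans[OF sX subrep_Times[OF sj si] X(2)
            rep_iso_Times[OF sj si iji rep_iso_refl[OF si]]])
    from rep_iso_trans[OF sX subrep_Times[OF si si] this rep_iso_sym[OF sX' subrep_Times[OF si si] X'i]]
    show ?thesis using X(1) by blast
  qed
qed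

lemma generic_Hopf_center_reduced_equivalent:
  assumes "generic_Hopf_center X" "generic_Hopf_center Z" "rep_iso net_action X net_action Z"
  shows "reduced_equivalent net_action X net_action Z"
  by (rule rep_iso_reduced_equivalent[OF generic_Hopf_center_subrep[OF assms(1)]
        generic_Hopf_center_subrep[OF assms(2)] assms(3)])

text \<open>The internal dimension is the cardinality of an index type; \<open>'d\<close> and
  \<open>'e\<close> are two arbitrary choices, whose reduced problems are compared through their
  common one-dimensional center subspace. The remaining bifurcations are those whose center subspace
  is not the square of a real component occurring once.\<close>

theorem theorem3p2:
  shows
   "(\<forall>X :: (real, 's::{finite, monoid_mult}) net set. generic_Hopf_center X \<longrightarrow>
       (\<exists>X' :: (real ^ 'd, 's) net set. generic_Hopf_center X' \<and> rep_iso net_action X net_action X') \<and>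
       (\<forall>X' :: (real ^ 'd, 's) net set. generic_Hopf_center X' \<and> rep_iso net_action X net_action X' \<longrightarrow>
          reduced_equivalent net_action X net_action X' \<and>
          (\<forall>X'' :: (real ^ 'e, 's) net set. generic_Hopf_center X'' \<and> rep_iso net_action X net_action X'' \<longrightarrow>
             reduced_equivalent net_action X' net_action X'')))
    \<and>
    (\<forall>s (Y :: nat \<Rightarrow> (real, 's) net set). decomposition net_action UNIV s Y \<and> CARD('d) \<ge> 2 \<longrightarrow>
       (\<forall>i\<in>{1..s}. real_type net_action (Y i) \<and>
            (\<forall>j\<in>{1..s} - {i}. \<not> rep_iso net_action (Y i) net_action (Y j)) \<longrightarrow>
          (\<exists>X' :: (real ^ 'd, 's) net set. generic_Hopf_center X' \<and>
             rep_iso net_action X' (prod_action net_action net_action) (Y i \<times> Y i)) \<and>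
          \<not> (\<exists>X :: (real, 's) net set. generic_Hopf_center X \<and>
             rep_iso net_action X (prod_action net_action net_action) (Y i \<times> Y i))) \<and>
       (\<forall>X' :: (real ^ 'd, 's) net set. generic_Hopf_center X' \<and>
          \<not> (\<exists>i\<in>{1..s}. real_type net_action (Y i) \<and>
               (\<forall>j\<in>{1..s} - {i}. \<not> rep_iso net_action (Y i) net_action (Y j)) \<and>
               rep_iso net_action X' (prod_action net_action net_action) (Y i \<times> Y i)) \<longrightarrow>
          (\<exists>X :: (real, 's) net set. generic_Hopf_center X \<and> rep_iso net_action X net_action X' \<and>
             reduced_equivalent net_action X net_action X')))"
proof (intro conjI allI impI ballI; (elim conjE)?)
  fix X :: "(real, 's) net set"
  assume X: "generic_Hopf_center X"
  show "\<exists>X' :: (real ^ 'd, 's) net set. generic_Hopf_center X' \<and> rep_iso net_action X net_action X'"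
    by (rule one_dim_center_exists_multi_dim[OF X])
  fix X' :: "(real ^ 'd, 's) net set"
  assume X': "generic_Hopf_center X'" "rep_iso net_action X net_action X'"
  show "reduced_equivalent net_action X net_action X'"
    by (rule generic_Hopf_center_reduced_equivalent[OF X X'])
  fix X'' :: "(real ^ 'e, 's) net set"
  assume X'': "generic_Hopf_center X''" "rep_iso net_action X net_action X''"
  note s = generic_Hopf_center_subrep[OF X] generic_Hopf_center_subrep[OF X'(1)]
  have "rep_iso net_action X' net_action X''"
    by (rule rep_iso_trans[OF s(2,1) rep_iso_sym[OF s X'(2)] X''(2)])
  then show "reduced_equivalent net_action X' net_action X''"
    by (rule generic_Hopf_center_reduced_equivalent[OF X'(1) X''(1)])
next
  fix s i and Y :: "nat \<Rightarrow> (real, 's) net set"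
  assume D: "decomposition net_action UNIV s Y" and card: "CARD('d) \<ge> 2" and i: "i \<in> {1..s}"
    and t: "real_type net_action (Y i)"
    and uniq: "\<forall>j\<in>{1..s} - {i}. \<not> rep_iso net_action (Y i) net_action (Y j)"
  obtain V where V: "subrep net_action V" "dsum UNIV (Y i) V"
    using decomposition_complement[OF linear_action_net_action D i] by metis
  show "\<exists>X' :: (real ^ 'd, 's) net set. generic_Hopf_center X' \<and>
      rep_iso net_action X' (prod_action net_action net_action) (Y i \<times> Y i)"
    by (rule exists_doubled_multi_dim_center[OF decomposition_subrep[OF D i] V t card])
  show "\<not> (\<exists>X :: (real, 's) net set. generic_Hopf_center X \<and>
      rep_iso net_action X (prod_action net_action net_action) (Y i \<times> Y i))"
    using no_doubled_one_dim_center[OF D i] uniq by blast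
next
  fix s and Y :: "nat \<Rightarrow> (real, 's) net set" and X' :: "(real ^ 'd, 's) net set"
  assume D: "decomposition net_action UNIV s Y" and X': "generic_Hopf_center X'"
    and nd: "\<not> (\<exists>i\<in>{1..s}. real_type net_action (Y i) \<and>
      (\<forall>j\<in>{1..s} - {i}. \<not> rep_iso net_action (Y i) net_action (Y j)) \<and>
      rep_iso net_action X' (prod_action net_action net_action) (Y i \<times> Y i))"
  from multi_dim_center_one_dim[OF this]
  show "\<exists>X :: (real, 's) net set. generic_Hopf_center X \<and> rep_iso net_action X net_action X' \<and>
      reduced_equivalent net_action X net_action X'"
    using generic_Hopf_center_reduced_equivalent X' by blast
qed

end
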